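(* Let assumptions (i), (ii'), (iii') (the last for the on-line case only) and (iv) of the context hold, and let $\epsilon,\delta>0$. Put $$M=\left\lfloor\max\left(\frac{3\rho^2\Delta}{\delta^3},\frac{4\Delta\rho}{\delta\epsilon}\right)\right\rfloor,\quad J=4M+4,\quad\mathscr{K}=\frac{\delta Ln_0}{\rho\epsilon},\quad K_0=(4M+4)\frac{Ln_0\delta}{\rho\epsilon},\quad\eta=\frac{\epsilon}{Ln_0}.$$ On-line case: set $S_1=\frac{2\sigma^2}{\epsilon^2}$, $S_2=\frac{2\sigma}{\epsilon n_0}$, $q=\frac{\sigma n_0}{\epsilon}$ with any choice of $n_0\in[1,2\sigma/\epsilon]$, and $\tilde\epsilon=10\epsilon\log\left(256(M+1)\frac{\delta Ln_0}{\rho\epsilon}+64\right)=\tilde{\mathcal{O}}(\epsilon)$. Then with probability at least $1/2$, SPIDER-SFO$^+$ (described in the context) outputs an $\mathbf{x}^k$, with $j\le J$ and $k\le K_0$, satisfying $$\|\nabla f(\mathbf{x}^k)\|\le3\tilde\epsilon\quad\text{and}\quad\lambda_{\min}(\nabla^2f(\mathbf{x}^k))\ge-3\delta,\qquad( * )$$ and the gradient cost to find such a point with probability at least $1/2$ is upper bounded by $$\tilde{\mathcal{O}}\left(\frac{\Delta L\sigma}{\epsilon^3}+\frac{\Delta\sigma L\rho}{\epsilon^2\delta^2}+\frac{\Delta L^2\rho^2}{\delta^5}+\frac{\Delta L^2\rho}{\epsilon\delta^3}+\frac{\sigma^2}{\epsilon^2}+\frac{L^2}{\delta^2}+\frac{L\sigma\delta}{\rho\epsilon^2}\right).$$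 Finite-sum case: set $\mathcal{S}_1=[n]$ (full gradient), $S_2=\frac{n^{1/2}}{n_0}$, $q=n_0n^{1/2}$ with any choice of $n_0\in[1,n^{1/2}]$, and $\tilde\epsilon=16\epsilon\log\left(256(M+1)\frac{\delta Ln_0}{\rho\epsilon}+64\right)=\tilde{\mathcal{O}}(\epsilon)$. Then with probability at least $1/2$, SPIDER-SFO$^+$ outputs an $\mathbf{x}^k$ satisfying $( * )$, with $j\le J$ and $k\le K_0$, and with gradient cost $$\tilde{\mathcal{O}}\left(\frac{\Delta Ln^{1/2}}{\epsilon^2}+\frac{\Delta\rho Ln^{1/2}}{\epsilon\delta^2}+\frac{\Delta L^2\rho^2}{\delta^5}+\frac{\Delta L^2\rho}{\epsilon\delta^3}+n+\frac{L^2}{\delta^2}+\frac{Ln^{1/2}\delta}{\rho\epsilon}\right).$$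
   Context: Setting: $f:\mathbb{R}^d\to\mathbb{R}$ is $f(\mathbf{x})=\mathbb{E}_i[f_i(\mathbf{x})]$; in the finite-sum case $i$ is uniform on $[n]=\{1,\dots,n\}$, so $f=\frac1n\sum_{i=1}^nf_i$; in the on-line case $i$ is a random index from a possibly infinite set. Each $f_i$ is twice differentiable, possibly non-convex, and $\mathbb{E}_i\nabla f_i=\nabla f$. $\|\cdot\|$ is the Euclidean norm of vectors / spectral norm of matrices, $\lambda_{\min}$ the least eigenvalue. For a multiset $\mathcal{S}$ of $S$ sampled indices, $\nabla f_{\mathcal{S}}:=\frac1S\sum_{i\in\mathcal{S}}\nabla f_i$. Assumptions: (i) $\Delta:=f(\mathbf{x}^0)-f^*<\infty$, $f^*=\inf f$; (ii') $\|\nabla f_i(\mathbf{x})-\nabla f_i(\mathbf{y})\|\le L\|\mathbf{x}-\mathbf{y}\|$ for all $i,\mathbf{x},\mathbf{y}$; (iii') (on-line case only) $\|\nabla f_i(\mathbf{x})-\nabla f(\mathbf{x})\|^2\le\sigma^2$ for all $i,\mathbf{x}$; (iv) $\|\nabla^2f_i(\mathbf{x})-\nabla^2f_i(\mathbf{y})\|\le\rho\|\mathbf{x}-\mathbf{y}\|$ for all $i,\mathbf{x},\mathbf{y}$. NC-search: a randomized procedure using stochastic gradients (e.g. Neon2) which, on input $(f,\mathbf{x},\delta',p')$, outputs $\mathbf{w}$ such that with probability at least $1-p'$: if $\mathbf{w}=\bot$ then $\nabla^2f(\mathbf{x})\succeq-\delta'\mathbf{I}$; if $\mathbf{w}\ne\bot$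 then $\|\mathbf{w}\|=1$ and $\mathbf{w}^\top\nabla^2f(\mathbf{x})\mathbf{w}\le-\delta'/2$. It uses $\mathcal{O}(\log^2(d/p')L^2\delta'^{-2})$ stochastic gradient evaluations. SPIDER-SFO$^+$: start with $k=0$ at $\mathbf{x}^0$. Throughout, the estimator is maintained at every $k$ by: if $k$ is a multiple of $q$, draw $S_1$ fresh independent samples $\mathcal{S}_1$ and set $\mathbf{v}^k=\nabla f_{\mathcal{S}_1}(\mathbf{x}^k)$ (in the finite-sum case $\mathbf{v}^k=\nabla f(\mathbf{x}^k)$); otherwise draw $S_2$ fresh independent samples $\mathcal{S}_2$ (with replacement) and set $\mathbf{v}^k=\nabla f_{\mathcal{S}_2}(\mathbf{x}^k)-\nabla f_{\mathcal{S}_2}(\mathbf{x}^{k-1})+\mathbf{v}^{k-1}$. For $j=0,1,\dots,J$: run NC-search on $(f,\mathbf{x}^k,2\delta,\frac1{16J})$ to obtain $\mathbf{w}_1$. If $\mathbf{w}_1\ne\bot$ (second-order descent): draw a uniformly random sign, set $\mathbf{w}_2=\pm\eta\mathbf{w}_1$, and for the next $\mathscr{K}$ values of $k$ update $\mathbf{v}^k$ and set $\mathbf{x}^{k+1}=\mathbf{x}^k-\mathbf{w}_2$. If $\mathbf{w}_1=\bot$ (first-order descent): for the next $\mathscr{K}$ values of $k$, update $\mathbf{v}^k$; if $\|\mathbf{v}^k\|\le2\tilde\epsilon$, stop and return $\mathbf{x}^k$; otherwise set $\mathbf{x}^{k+1}=\mathbf{x}^k-\eta\,\mathbf{v}^k/\|\mathbf{v}^k\|$.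 The quantities $S_1,S_2,q,\mathscr{K}$ are treated as positive integers. Gradient cost: total number of stochastic (component) gradient accesses, where maintaining $\mathbf{v}^k$ counts $S_1$ ($n$ in the finite-sum case) when $k$ is a multiple of $q$ and $S_2$ otherwise, plus the cost of all NC-searches. $\tilde{\mathcal{O}}$ hides poly-logarithmic factors of the parameters (including $d$). *)

theory Defs
  imports "HOL-Probability.Probability"
begin

section \<open>Gradient, Hessian, least eigenvalue\<close>

definition grad :: "(real^'n \<Rightarrow> real) \<Rightarrow> real^'n \<Rightarrow> real^'n" where
  "grad g x = (THE D. GDERIV g x :> D)"

definition hess :: "(real^'n \<Rightarrow> real) \<Rightarrow> real^'n \<Rightarrow> real^'n^'n" where
  "hess g x = jacobian (grad g) (at x)"

definition twice_differentiable :: "(real^'n \<Rightarrow> real) \<Rightarrow> bool" where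
  "twice_differentiable g \<longleftrightarrow>
     (\<forall>x. g differentiable (at x)) \<and> (\<forall>x. grad g differentiable (at x))"

text \<open>The type class norm on \<open>real^'n^'n\<close> is the Frobenius norm, hence the operator norm.\<close>

definition spectral_norm :: "real^'n^'n \<Rightarrow> real" where
  "spectral_norm A = onorm (\<lambda>v. A *v v)"

definition lambda_min :: "real^'n^'n \<Rightarrow> real" where
  "lambda_min A = Min {c. \<exists>v. v \<noteq> 0 \<and> A *v v = c *\<^sub>R v}"

section \<open>Objective and assumptions\<close>

text \<open>The random index \<open>i\<close> has law \<open>D\<close>, and its index set is \<open>space D\<close>.\<close>

definition mean_obj :: "'i measure \<Rightarrow> ('i \<Rightarrow> real^'n \<Rightarrow> real) \<Rightarrow> real^'n \<Rightarrow> real" where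
  "mean_obj D f x = (\<integral>i. f i x \<partial>D)"

lemma mean_obj_uniform:
  assumes "finite I"
  shows "mean_obj (uniform_count_measure I) f x = (1 / real (card I)) * (\<Sum>i\<in>I. f i x)"
  using assms
  by (simp add: mean_obj_def uniform_count_measure_def lebesgue_integral_point_measure_finite
      sum_distrib_left divide_inverse)

definition stochastic_objective :: "'i measure \<Rightarrow> ('i \<Rightarrow> real^'n \<Rightarrow> real) \<Rightarrow> bool" where
  "stochastic_objective D f \<longleftrightarrow>
     prob_space D \<and>
     (\<forall>x. integrable D (\<lambda>i. f i x)) \<and>
     (\<forall>i\<in>space D. twice_differentiable (f i)) \<and>
     (\<forall>x. integrable D (\<lambda>i. grad (f i) x) \<and>
          (\<integral>i. grad (f i) x \<partial>D) = grad (mean_obj D f) x)"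

definition gradients_lipschitz ::
  "'i measure \<Rightarrow> ('i \<Rightarrow> real^'n \<Rightarrow> real) \<Rightarrow> real \<Rightarrow> bool" where
  "gradients_lipschitz D f L \<longleftrightarrow>
     (\<forall>i\<in>space D. \<forall>x y. norm (grad (f i) x - grad (f i) y) \<le> L * norm (x - y))"

definition gradient_noise_bounded ::
  "'i measure \<Rightarrow> ('i \<Rightarrow> real^'n \<Rightarrow> real) \<Rightarrow> real \<Rightarrow> bool" where
  "gradient_noise_bounded D f \<sigma> \<longleftrightarrow>
     (\<forall>i\<in>space D. \<forall>x. (norm (grad (f i) x - grad (mean_obj D f) x))\<^sup>2 \<le> \<sigma>\<^sup>2)"

definition hessians_lipschitz ::
  "'i measure \<Rightarrow> ('i \<Rightarrow> real^'n \<Rightarrow> real) \<Rightarrow> real \<Rightarrow> bool" where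
  "hessians_lipschitz D f \<rho> \<longleftrightarrow>
     (\<forall>i\<in>space D. \<forall>x y. spectral_norm (hess (f i) x - hess (f i) y) \<le> \<rho> * norm (x - y))"

section \<open>NC-search\<close>

text \<open>
  A randomized procedure is a function of its input \<open>x\<close>, \<open>\<delta>'\<close>, \<open>p'\<close> and of a random seed \<open>r\<close> with
  law \<open>R\<close>; the seed comprises every sample the procedure draws. The output \<open>None\<close> stands for
  \<open>\<bottom>\<close>, and \<open>cost x \<delta>' p' r\<close> is the number of stochastic gradients evaluated.
\<close>

type_synonym ('r, 'n) nc_proc = "real^'n \<Rightarrow> real \<Rightarrow> real \<Rightarrow> 'r \<Rightarrow> (real^'n) option"
type_synonym ('r, 'n) nc_cost = "real^'n \<Rightarrow> real \<Rightarrow> real \<Rightarrow> 'r \<Rightarrow> nat"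

definition nc_correct ::
  "(real^'n \<Rightarrow> real) \<Rightarrow> real^'n \<Rightarrow> real \<Rightarrow> (real^'n) option \<Rightarrow> bool" where
  "nc_correct F x \<delta>' out \<longleftrightarrow>
     (case out of
        None \<Rightarrow> (\<forall>u. u \<bullet> (hess F x *v u) \<ge> - \<delta>' * (u \<bullet> u))
      | Some w \<Rightarrow> norm w = 1 \<and> w \<bullet> (hess F x *v w) \<le> - \<delta>' / 2)"

text \<open>
  The first two conditions say that the output is a measurable function of the seed and the query
  point; \<open>C\<close> is the constant hidden in the cost \<open>O(log\<^sup>2(d/p') L\<^sup>2 / \<delta>'\<^sup>2)\<close>.
\<close>

definition nc_search ::
  "'r measure \<Rightarrow> (real^'n \<Rightarrow> real) \<Rightarrow> real \<Rightarrow> real \<Rightarrow>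
   ('r, 'n) nc_proc \<Rightarrow> ('r, 'n) nc_cost \<Rightarrow> bool" where
  "nc_search R F L C nc cost \<longleftrightarrow>
     prob_space R \<and> 0 \<le> C \<and>
     (\<forall>\<delta>' p'. 0 < \<delta>' \<longrightarrow> 0 < p' \<longrightarrow> p' < 1 \<longrightarrow>
        Measurable.pred (borel \<Otimes>\<^sub>M R) (\<lambda>(x, r). nc x \<delta>' p' r = None) \<and>
        (\<lambda>(x, r). case nc x \<delta>' p' r of None \<Rightarrow> 0 | Some w \<Rightarrow> w) \<in> borel_measurable (borel \<Otimes>\<^sub>M R) \<and>
        (\<forall>x. \<P>(r in R. nc_correct F x \<delta>' (nc x \<delta>' p' r)) \<ge> 1 - p') \<and>
        (\<forall>x. \<forall>r\<in>space R.
           real (cost x \<delta>' p' r) \<le> C * (ln (real CARD('n) / p'))\<^sup>2 * L\<^sup>2 / \<delta>'\<^sup>2))"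

section \<open>SPIDER-SFO+\<close>

definition batch_grad ::
  "('i \<Rightarrow> real^'n \<Rightarrow> real) \<Rightarrow> nat \<Rightarrow> (nat \<Rightarrow> 'i) \<Rightarrow> real^'n \<Rightarrow> real^'n" where
  "batch_grad f S \<xi> x = (1 / real S) *\<^sub>R (\<Sum>s<S. grad (f (\<xi> s)) x)"

text \<open>
  \<open>anchor\<close> is the estimator used when \<open>k\<close> is a multiple of \<open>period\<close>; it is a function of the fresh
  samples and of the point, and costs \<open>anchor_cost\<close> component gradients.
\<close>

record ('i, 'n) sfo_params =
  anchor :: "(nat \<Rightarrow> 'i) \<Rightarrow> real^'n \<Rightarrow> real^'n"
  anchor_cost :: nat
  batch :: nat
  period :: nat
  round_length :: nat
  last_round :: nat
  step_size :: real
  tol :: real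
  curvature :: real

text \<open>
  \<open>Running x x' v w c\<close>: about to perform iteration \<open>k\<close>, with \<open>x = x\<^sup>k\<close>, \<open>x' = x\<^sup>k\<^sup>-\<^sup>1\<close>, \<open>v = v\<^sup>k\<^sup>-\<^sup>1\<close>, \<open>w\<close> the
  latest NC-search output and \<open>c\<close> the gradient cost so far.
  \<open>Returned j k x c\<close>: iteration \<open>k\<close>, in round \<open>j\<close>, has returned \<open>x = x\<^sup>k\<close> at total cost \<open>c\<close>.
\<close>

datatype 'n sfo_state =
    Running "real^'n" "real^'n" "real^'n" "(real^'n) option" nat
  | Returned nat nat "real^'n" nat

text \<open>
  The randomness is \<open>(\<xi>, r, s)\<close>: \<open>\<xi> (k, l)\<close> is the \<open>l\<close>-th index drawn at iteration \<open>k\<close>, and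
  \<open>r j\<close>, \<open>s j\<close> are the NC-search seed and the sign of round \<open>j\<close>. All of these are independent.
  (Coordinates that the algorithm does not look at are harmless.)
\<close>

type_synonym ('i, 'r) sfo_seed = "(nat \<times> nat \<Rightarrow> 'i) \<times> (nat \<Rightarrow> 'r) \<times> (nat \<Rightarrow> real)"

definition sfo_space :: "'i measure \<Rightarrow> 'r measure \<Rightarrow> ('i, 'r) sfo_seed measure" where
  "sfo_space D R =
     (\<Pi>\<^sub>M (_::nat \<times> nat)\<in>UNIV. D) \<Otimes>\<^sub>M
     ((\<Pi>\<^sub>M (_::nat)\<in>UNIV. R) \<Otimes>\<^sub>M
      (\<Pi>\<^sub>M (_::nat)\<in>UNIV. measure_pmf (pmf_of_set {1, -1 :: real})))"

text \<open>
  Every round that does not return takes exactly \<open>round_length\<close> iterations, so round \<open>j\<close> consists of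
  the iterations \<open>k\<close> with \<open>k div round_length = j\<close>, and NC-search is run at those \<open>k\<close> that are
  multiples of \<open>round_length\<close>.
\<close>

fun sfo_step ::
  "('i, 'n) sfo_params \<Rightarrow> ('i \<Rightarrow> real^'n \<Rightarrow> real) \<Rightarrow> ('r, 'n) nc_proc \<Rightarrow> ('r, 'n) nc_cost \<Rightarrow>
   ('i, 'r) sfo_seed \<Rightarrow> nat \<Rightarrow> 'n sfo_state \<Rightarrow> 'n sfo_state" where
  "sfo_step P f nc cost (\<xi>, r, s) k (Running x x' v' w' c) =
     (let j = k div round_length P;
          \<delta>' = 2 * curvature P;
          p' = 1 / (16 * real (last_round P));
          new_round = (k mod round_length P = 0);
          w = (if new_round then nc x \<delta>' p' (r j) else w');
          c1 = (if new_round then cost x \<delta>' p' (r j) else 0);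
          \<xi>k = (\<lambda>l. \<xi> (k, l));
          v = (if k mod period P = 0 then anchor P \<xi>k x
               else batch_grad f (batch P) \<xi>k x - batch_grad f (batch P) \<xi>k x' + v');
          c2 = (if k mod period P = 0 then anchor_cost P else batch P);
          c' = c + c1 + c2
      in (case w of
            Some w1 \<Rightarrow> Running (x - (s j * step_size P) *\<^sub>R w1) x v w c'
          | None \<Rightarrow>
              if norm v \<le> 2 * tol P then Returned j k x c'
              else Running (x - (step_size P / norm v) *\<^sub>R v) x v w c'))"
| "sfo_step P f nc cost \<omega> k (Returned j' k' x c) = Returned j' k' x c"

text \<open>The initial values of \<open>x\<^sup>k\<^sup>-\<^sup>1\<close>, \<open>v\<^sup>k\<^sup>-\<^sup>1\<close> and \<open>w\<close> are never used.\<close>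

primrec sfo_iter ::
  "('i, 'n) sfo_params \<Rightarrow> ('i \<Rightarrow> real^'n \<Rightarrow> real) \<Rightarrow> ('r, 'n) nc_proc \<Rightarrow> ('r, 'n) nc_cost \<Rightarrow>
   real^'n \<Rightarrow> ('i, 'r) sfo_seed \<Rightarrow> nat \<Rightarrow> 'n sfo_state" where
  "sfo_iter P f nc cost x0 \<omega> 0 = Running x0 x0 0 None 0"
| "sfo_iter P f nc cost x0 \<omega> (Suc k) = sfo_step P f nc cost \<omega> k (sfo_iter P f nc cost x0 \<omega> k)"

definition spider_sfo_plus ::
  "('i, 'n) sfo_params \<Rightarrow> ('i \<Rightarrow> real^'n \<Rightarrow> real) \<Rightarrow> ('r, 'n) nc_proc \<Rightarrow> ('r, 'n) nc_cost \<Rightarrow>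
   real^'n \<Rightarrow> ('i, 'r) sfo_seed \<Rightarrow> 'n sfo_state" where
  "spider_sfo_plus P f nc cost x0 \<omega> =
     sfo_iter P f nc cost x0 \<omega> ((last_round P + 1) * round_length P)"

text \<open>The run has returned a point, within the given limits on \<open>j\<close>, \<open>k\<close> and the gradient cost, that
  is stationary to the given first- and second-order accuracies.\<close>

definition returns_stationary ::
  "(real^'n \<Rightarrow> real) \<Rightarrow> real \<Rightarrow> real \<Rightarrow> nat \<Rightarrow> real \<Rightarrow> real \<Rightarrow> 'n sfo_state \<Rightarrow> bool" where
  "returns_stationary F eps1 eps2 J K0 B out \<longleftrightarrow>
     (\<exists>j k x c. out = Returned j k x c \<and> j \<le> J \<and> real k \<le> K0 \<and> real c \<le> B \<and>
        norm (grad F x) \<le> eps1 \<and> lambda_min (hess F x) \<ge> - eps2)"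

section \<open>Poly-logarithmic factors\<close>

text \<open>
  \<open>a = \<O>~(b)\<close> is rendered as \<open>a \<le> C * polylog ps * b\<close>, where \<open>ps\<close> lists the parameters of the problem
  and \<open>C\<close> is a numeral (times a factor from the constant of NC-search). A numeral rather than an
  existentially quantified \<open>C\<close>: the latter could depend on the type \<open>'n\<close>, hence on the dimension.
\<close>

definition polylog :: "real list \<Rightarrow> real" where
  "polylog ps = (1 + (\<Sum>p\<leftarrow>ps. \<bar>ln p\<bar>))\<^sup>2"

end

theory Submission
  imports Defs "HOL-Probability.Hoeffding"
begin

text \<open>
  Write \<open>F\<close> for the averaged objective, \<open>x\<^sub>k\<close> for the iterates and \<open>err\<^sub>k\<close> for the error of the gradient
  estimator at iteration \<open>k\<close>. The run can only miss a good point in one of three ways, and each of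
  them is improbable.

  First, an NC-search may answer wrongly. Its seed is independent of the past, so a union bound over
  the \<open>J\<close> rounds with failure probability \<open>1 / (16 J)\<close> each costs \<open>1/16\<close> (\<open>prob_nc_bad\<close>).

  Second, the estimator may be off by more than the tolerance. Consecutive iterates are at distance at
  most \<open>\<eta>\<close>, so \<open>err\<^sub>k\<close> is, within one period, a sum of bounded centred vectors, each centred
  conditionally on the past. The potential \<open>exp (sqrt (1 + |z|\<^sup>2))\<close> grows by at most the factor
  \<open>exp (B\<^sup>2)\<close> in expectation when a centred vector of norm at most \<open>B\<close> is added
  (\<open>nn_integral_exp_pot_add\<close>), which gives a tail bound that does not depend on the dimension
  (\<open>prob_estimate_bad\<close>). The parameters make the sum of all \<open>B\<^sup>2\<close> a constant multiple of \<open>\<epsilon>\<^sup>2\<close>, and the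
  tolerance exceeds \<open>\<epsilon>\<close> by a logarithm of the number of iterations, so a union bound over all
  iterations costs another \<open>1/16\<close>.

  Third, the run may go on for all \<open>J\<close> rounds without either failure. Such rounds lower \<open>F\<close> by a fixed
  amount \<open>gain\<close>: a first-order round in every case, because each step follows a direction close to the
  gradient (\<open>first_order_round\<close>); a second-order round in expectation over its random sign, because a
  displacement of length \<open>\<delta> / \<rho>\<close> along a direction of curvature at most \<open>-\<delta>\<close> loses \<open>\<delta>\<^sup>3 / (3 \<rho>\<^sup>2)\<close> on
  average over the two signs (\<open>two_sided_curvature_step\<close>). As \<open>F\<close> can fall by \<open>\<Delta>\<close> only, Markov's
  inequality bounds the probability of \<open>J\<close> such rounds by \<open>\<Delta> / (J gain) \<le> 1/4\<close> (\<open>prob_on_track_last\<close>).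

  Outside these events, of total probability less than \<open>1/2\<close>, the run halts in a first-order round.
  There the estimated gradient is small, hence so is the true one; and the NC-search at the start of
  that round has certified \<open>- 2 \<delta>\<close> as a lower bound for the Hessian at a point at distance at most
  \<open>\<delta> / \<rho>\<close>, so Lipschitz continuity of the Hessian gives \<open>- 3 \<delta>\<close> (\<open>halt_accuracy\<close>).

  The bound on the gradient cost holds for every seed, so it amounts to counting rounds and periods.
  Since the cost of an NC-search need not be measurable in the seed, it is this sure bound that makes
  the success event measurable.

  Independence enters in one form throughout: the expectation of a function of the seed does not change
  when a block of coordinates is replaced by a fresh independent copy (\<open>resampling\<close>). Anything
  that depends on the past alone is unaffected by the replacement and acts as a constant in the inner
  integral.
\<close>

section \<open>Gradients and Hessians\<close>

lemma grad_eqI: "GDERIV g x :> D \<Longrightarrow> grad g x = D"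
proof -
  assume D: "GDERIV g x :> D"
  have "D' = D" if "GDERIV g x :> D'" for D'
  proof -
    have "(\<lambda>h. inner h D') = (\<lambda>h. inner h D)"
      using D that has_derivative_unique unfolding gderiv_def by blast
    hence "h \<bullet> (D' - D) = 0" for h by (simp add: inner_diff_right fun_eq_iff)
    from this[of "D' - D"] show ?thesis by simp
  qed
  thus ?thesis unfolding grad_def using D by blast
qed

text \<open>The gradient is the Riesz representative of the derivative, written in the standard basis.\<close>
lemma has_derivative_grad:
  assumes "g differentiable (at x)"
  shows "(g has_derivative (\<lambda>h. grad g x \<bullet> h)) (at x)"
proof -
  obtain g' where g': "(g has_derivative g') (at x)" using assms by (auto simp: differentiable_def)
  interpret g': bounded_linear g' using g' by (rule has_derivative_bounded_linear)
  define D where "D = (\<Sum>b\<in>Basis. g' b *\<^sub>R b)"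
  have "g' h = h \<bullet> D" for h
  proof -
    have "g' h = g' (\<Sum>b\<in>Basis. (h \<bullet> b) *\<^sub>R b)" by (simp add: euclidean_representation)
    also have "\<dots> = h \<bullet> D"
      by (simp add: g'.sum g'.scaleR D_def inner_sum_right mult.commute)
    finally show ?thesis .
  qed
  hence "g' = (\<lambda>h. h \<bullet> D)" by (rule ext)
  hence "GDERIV g x :> D" using g' unfolding gderiv_def by simp
  thus ?thesis using grad_eqI[OF \<open>GDERIV g x :> D\<close>] by (simp add: gderiv_def inner_commute)
qed

lemma has_derivative_hess:
  assumes "grad g differentiable (at x)"
  shows "(grad g has_derivative (\<lambda>h. hess g x *v h)) (at x)"
  using assms unfolding hess_def jacobian_works .

lemma DERIV_along_line:
  fixes g :: "real^'n \<Rightarrow> real"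
  assumes "\<And>x. g differentiable (at x)"
  shows "((\<lambda>t. g (x + t *\<^sub>R u)) has_real_derivative grad g (x + t *\<^sub>R u) \<bullet> u) (at t)"
proof -
  have "((\<lambda>t. g (x + t *\<^sub>R u)) has_derivative (\<lambda>h. grad g (x + t *\<^sub>R u) \<bullet> (h *\<^sub>R u))) (at t)"
    by (rule has_derivative_compose[OF _ has_derivative_grad[OF assms], where f = "\<lambda>t. x + t *\<^sub>R u"])
      (auto intro!: derivative_eq_intros)
  thus ?thesis by (simp add: has_field_derivative_def mult.commute[of _ "grad g (x + t *\<^sub>R u) \<bullet> u"])
qed

lemma DERIV_grad_along_line:
  fixes g :: "real^'n \<Rightarrow> real"
  assumes "\<And>x. grad g differentiable (at x)"
  shows "((\<lambda>t. grad g (x + t *\<^sub>R u) \<bullet> v) has_real_derivative (hess g (x + t *\<^sub>R u) *v u) \<bullet> v) (at t)"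
proof -
  have "((\<lambda>t. grad g (x + t *\<^sub>R u)) has_derivative (\<lambda>h. hess g (x + t *\<^sub>R u) *v (h *\<^sub>R u))) (at t)"
    by (rule has_derivative_compose[OF _ has_derivative_hess[OF assms], where f = "\<lambda>t. x + t *\<^sub>R u"])
      (auto intro!: derivative_eq_intros)
  hence "((\<lambda>t. grad g (x + t *\<^sub>R u) \<bullet> v) has_derivative
      (\<lambda>h. (hess g (x + t *\<^sub>R u) *v (h *\<^sub>R u)) \<bullet> v)) (at t)"
    by (auto intro!: derivative_eq_intros)
  thus ?thesis
    by (simp add: has_field_derivative_def matrix_vector_mult_scaleR
        mult.commute[of _ "(hess g (x + t *\<^sub>R u) *v u) \<bullet> v"])
qed

text \<open>The Taylor estimates below compare a function along a segment with a polynomial whose derivative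
  dominates; this is the comparison principle that they share.\<close>
lemma le_at_1_of_deriv_le:
  fixes \<phi> \<psi> :: "real \<Rightarrow> real"
  assumes "\<And>t. (\<phi> has_real_derivative \<phi>' t) (at t)" "\<And>t. (\<psi> has_real_derivative \<psi>' t) (at t)"
    and le: "\<And>t. 0 \<le> t \<Longrightarrow> t \<le> 1 \<Longrightarrow> \<phi>' t \<le> \<psi>' t" and "0 \<le> s" "s \<le> 1"
  shows "\<phi> s - \<phi> 0 \<le> \<psi> s - \<psi> 0"
proof -
  have "(\<lambda>t. \<phi> t - \<psi> t) s \<le> (\<lambda>t. \<phi> t - \<psi> t) 0"
  proof (rule DERIV_nonpos_imp_nonincreasing[OF \<open>0 \<le> s\<close>])
    fix t assume "0 \<le> t" "t \<le> s"
    hence "\<phi>' t - \<psi>' t \<le> 0" using le[of t] \<open>s \<le> 1\<close> by simp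
    moreover have "((\<lambda>t. \<phi> t - \<psi> t) has_real_derivative \<phi>' t - \<psi>' t) (at t)"
      using assms(1,2) by (auto intro!: derivative_eq_intros)
    ultimately show "\<exists>y. ((\<lambda>t. \<phi> t - \<psi> t) has_real_derivative y) (at t) \<and> y \<le> 0" by blast
  qed
  thus ?thesis by simp
qed

lemma lipschitz_grad_upper:
  fixes g :: "real^'n \<Rightarrow> real"
  assumes diff: "\<And>x. g differentiable (at x)"
    and lip: "\<And>x y. norm (grad g x - grad g y) \<le> L * norm (x - y)"
  shows "g (x + u) \<le> g x + grad g x \<bullet> u + L / 2 * (norm u)\<^sup>2"
proof -
  have *: "grad g (x + t *\<^sub>R u) \<bullet> u \<le> grad g x \<bullet> u + L * t * (norm u)\<^sup>2" if "0 \<le> t" for t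
  proof -
    have "(grad g (x + t *\<^sub>R u) - grad g x) \<bullet> u \<le> norm (grad g (x + t *\<^sub>R u) - grad g x) * norm u"
      by (rule norm_cauchy_schwarz)
    also have "\<dots> \<le> (L * norm (t *\<^sub>R u)) * norm u"
      using lip[of "x + t *\<^sub>R u" x] by (intro mult_right_mono) auto
    finally show ?thesis using that by (simp add: inner_diff_left power2_eq_square algebra_simps)
  qed
  have "(\<lambda>t. g (x + t *\<^sub>R u)) 1 - (\<lambda>t. g (x + t *\<^sub>R u)) 0
      \<le> (\<lambda>t. t * (grad g x \<bullet> u) + L / 2 * t\<^sup>2 * (norm u)\<^sup>2) 1
        - (\<lambda>t. t * (grad g x \<bullet> u) + L / 2 * t\<^sup>2 * (norm u)\<^sup>2) 0"
    by (rule le_at_1_of_deriv_le[OF DERIV_along_line[OF diff],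
          where \<psi>' = "\<lambda>t. grad g x \<bullet> u + L * t * (norm u)\<^sup>2"])
      (auto intro!: derivative_eq_intros *)
  thus ?thesis by simp
qed

text \<open>The lower estimate is the upper one, read from \<open>x + u\<close> back to \<open>x\<close>. It costs a factor in the
  constant, which is harmless: the purpose is to integrate the remainder over the random index.\<close>
lemma lipschitz_grad_remainder:
  fixes g :: "real^'n \<Rightarrow> real"
  assumes diff: "\<And>x. g differentiable (at x)"
    and lip: "\<And>x y. norm (grad g x - grad g y) \<le> L * norm (x - y)"
  shows "\<bar>g (x + u) - g x - grad g x \<bullet> u\<bar> \<le> 3 * L / 2 * (norm u)\<^sup>2"
proof -
  have "g x \<le> g (x + u) - grad g (x + u) \<bullet> u + L / 2 * (norm u)\<^sup>2"
    using lipschitz_grad_upper[OF diff lip, of "x + u" "- u"] by simp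
  moreover have "\<bar>(grad g (x + u) - grad g x) \<bullet> u\<bar> \<le> L * (norm u)\<^sup>2"
  proof -
    have "\<bar>(grad g (x + u) - grad g x) \<bullet> u\<bar> \<le> norm (grad g (x + u) - grad g x) * norm u"
      by (rule Cauchy_Schwarz_ineq2)
    also have "\<dots> \<le> (L * norm u) * norm u"
      using lip[of "x + u" x] by (intro mult_right_mono) auto
    finally show ?thesis by (simp add: power2_eq_square mult_ac)
  qed
  moreover have "g (x + u) \<le> g x + grad g x \<bullet> u + L / 2 * (norm u)\<^sup>2"
    by (rule lipschitz_grad_upper[OF diff lip])
  moreover have "0 \<le> L * (norm u)\<^sup>2"
    using calculation(2) abs_ge_zero order_trans by blast
  ultimately show ?thesis by (simp only: inner_diff_left abs_le_iff) linarith
qed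

lemma norm_le_spectral_norm: "norm ((A::real^'n^'n) *v u) \<le> spectral_norm A * norm u"
  unfolding spectral_norm_def by (rule onorm) (rule matrix_vector_mul_bounded_linear)

lemma hess_remainder:
  fixes g :: "real^'n \<Rightarrow> real"
  assumes diff: "\<And>x. grad g differentiable (at x)"
    and lip: "\<And>x y. spectral_norm (hess g x - hess g y) \<le> \<rho> * norm (x - y)" and "0 \<le> \<rho>"
  shows "norm (grad g (x + u) - grad g x - hess g x *v u) \<le> \<rho> * (norm u)\<^sup>2"
proof -
  define S where "S = closed_segment x (x + u)"
  have "norm (grad g (x + u) - grad g x - hess g x *v (x + u - x)) \<le> norm (x + u - x) * (\<rho> * norm u)"
  proof (rule differentiable_bound_linearization[where S = S and f' = "\<lambda>x h. hess g x *v h"])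
    show "x + t *\<^sub>R (x + u - x) \<in> S" if "t \<in> {0..1}" for t
      using that unfolding S_def closed_segment_def by (auto intro!: exI[of _ t] simp: algebra_simps)
    show "(grad g has_derivative (*v) (hess g y)) (at y within S)" for y
      using has_derivative_hess[OF diff] by (rule has_derivative_at_withinI)
    show "onorm ((*v) (hess g y) - (*v) (hess g x)) \<le> \<rho> * norm u" if "y \<in> S" for y
    proof -
      have "(*v) (hess g y) - (*v) (hess g x) = (*v) (hess g y - hess g x)"
        by (simp add: fun_eq_iff matrix_vector_mult_diff_rdistrib)
      hence "onorm ((*v) (hess g y) - (*v) (hess g x)) \<le> \<rho> * norm (y - x)"
        using lip[of y x] by (simp add: spectral_norm_def)
      also have "norm (y - x) \<le> norm u"
        using that segment_bound(1)[of y x "x + u"] unfolding S_def by simp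
      finally show ?thesis using \<open>0 \<le> \<rho>\<close> by (simp add: mult_left_mono)
    qed
    show "x \<in> S" by (simp add: S_def)
  qed
  thus ?thesis by (simp add: power2_eq_square mult_ac)
qed

lemma cubic_taylor_upper:
  fixes g :: "real^'n \<Rightarrow> real"
  assumes diff: "\<And>x. g differentiable (at x)" "\<And>x. grad g differentiable (at x)"
    and lip: "\<And>x y. spectral_norm (hess g x - hess g y) \<le> \<rho> * norm (x - y)"
  shows "g (x + u) \<le> g x + grad g x \<bullet> u + (u \<bullet> (hess g x *v u)) / 2 + \<rho> / 6 * (norm u)^3"
proof -
  let ?q = "u \<bullet> (hess g x *v u)"
  have hess: "(hess g (x + t *\<^sub>R u) *v u) \<bullet> u \<le> ?q + \<rho> * t * (norm u)^3" if "0 \<le> t" for t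
  proof -
    have "((hess g (x + t *\<^sub>R u) - hess g x) *v u) \<bullet> u
        \<le> norm ((hess g (x + t *\<^sub>R u) - hess g x) *v u) * norm u"
      by (rule norm_cauchy_schwarz)
    also have "\<dots> \<le> (spectral_norm (hess g (x + t *\<^sub>R u) - hess g x) * norm u) * norm u"
      by (intro mult_right_mono norm_le_spectral_norm) auto
    also have "\<dots> \<le> ((\<rho> * norm (x + t *\<^sub>R u - x)) * norm u) * norm u"
      by (intro mult_right_mono lip) auto
    finally show ?thesis using that
      by (simp add: matrix_vector_mult_diff_rdistrib inner_diff_left power3_eq_cube inner_commute algebra_simps)
  qed
  have slope: "grad g (x + t *\<^sub>R u) \<bullet> u \<le> grad g x \<bullet> u + t * ?q + \<rho> * t\<^sup>2 * (norm u)^3 / 2"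
    if "0 \<le> t" "t \<le> 1" for t
  proof -
    have "(\<lambda>t. grad g (x + t *\<^sub>R u) \<bullet> u) t - (\<lambda>t. grad g (x + t *\<^sub>R u) \<bullet> u) 0
      \<le> (\<lambda>t. t * ?q + \<rho> / 2 * t\<^sup>2 * (norm u)^3) t - (\<lambda>t. t * ?q + \<rho> / 2 * t\<^sup>2 * (norm u)^3) 0"
      by (rule le_at_1_of_deriv_le[OF DERIV_grad_along_line[OF diff(2)],
            where \<psi>' = "\<lambda>t. ?q + \<rho> * t * (norm u)^3"])
        (auto intro!: derivative_eq_intros hess that)
    thus ?thesis by simp
  qed
  have "(\<lambda>t. g (x + t *\<^sub>R u)) 1 - (\<lambda>t. g (x + t *\<^sub>R u)) 0
      \<le> (\<lambda>t. t * (grad g x \<bullet> u) + t\<^sup>2 / 2 * ?q + \<rho> / 6 * t^3 * (norm u)^3) 1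
        - (\<lambda>t. t * (grad g x \<bullet> u) + t\<^sup>2 / 2 * ?q + \<rho> / 6 * t^3 * (norm u)^3) 0"
    by (rule le_at_1_of_deriv_le[OF DERIV_along_line[OF diff(1)],
          where \<psi>' = "\<lambda>t. grad g x \<bullet> u + t * ?q + \<rho> * t\<^sup>2 * (norm u)^3 / 2"])
      (auto intro!: derivative_eq_intros slope)
  thus ?thesis by simp
qed

text \<open>Both \<open>u\<close>-then-\<open>v\<close> and \<open>v\<close>-then-\<open>u\<close> differencing approximate the same second difference of \<open>g\<close>
  over the parallelogram spanned by \<open>t u\<close> and \<open>t v\<close> up to order \<open>t\<^sup>3\<close>; division by \<open>t\<^sup>2\<close> and \<open>t \<rightarrow> 0\<close>
  give symmetry. Without symmetry the Hessian might have no real eigenvalue, and its least one would be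
  meaningless.\<close>
lemma hess_symmetric:
  fixes g :: "real^'n \<Rightarrow> real"
  assumes diff: "\<And>x. g differentiable (at x)" "\<And>x. grad g differentiable (at x)"
    and lip: "\<And>x y. spectral_norm (hess g x - hess g y) \<le> \<rho> * norm (x - y)" and "0 \<le> \<rho>"
  shows "u \<bullet> (hess g x *v v) = v \<bullet> (hess g x *v u)"
proof -
  define c where "c u v = \<rho> * ((norm u + norm v)\<^sup>2 + (norm u)\<^sup>2) * norm u" for u v :: "real^'n"
  define S where "S t u v = g (x + t *\<^sub>R u + t *\<^sub>R v) - g (x + t *\<^sub>R u) - g (x + t *\<^sub>R v) + g x" for t u v
  have S_sym: "S t u v = S t v u" for t u v by (simp add: S_def algebra_simps)
  have est: "\<bar>S t u v - t\<^sup>2 * (u \<bullet> (hess g x *v v))\<bar> \<le> c u v * t^3" if "0 < t" for t u v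
  proof -
    define \<phi> where "\<phi> \<tau> = g ((x + t *\<^sub>R v) + \<tau> *\<^sub>R (t *\<^sub>R u)) - g (x + \<tau> *\<^sub>R (t *\<^sub>R u))" for \<tau>
    define \<phi>' where "\<phi>' \<tau> = (grad g ((x + t *\<^sub>R v) + \<tau> *\<^sub>R (t *\<^sub>R u)) - grad g (x + \<tau> *\<^sub>R (t *\<^sub>R u))) \<bullet> (t *\<^sub>R u)" for \<tau>
    have der: "(\<phi> has_real_derivative \<phi>' \<tau>) (at \<tau>)" for \<tau>
      unfolding \<phi>_def \<phi>'_def inner_diff_left
      by (intro DERIV_diff DERIV_along_line diff)
    obtain \<tau> where \<tau>: "0 < \<tau>" "\<tau> < 1" "\<phi> 1 - \<phi> 0 = \<phi>' \<tau>"
      using MVT2[of 0 1 \<phi> \<phi>'] der by auto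
    let ?H = "hess g x"
    define r1 where "r1 = grad g (x + (t *\<^sub>R v + \<tau> *\<^sub>R (t *\<^sub>R u))) - grad g x - ?H *v (t *\<^sub>R v + \<tau> *\<^sub>R (t *\<^sub>R u))"
    define r2 where "r2 = grad g (x + \<tau> *\<^sub>R (t *\<^sub>R u)) - grad g x - ?H *v (\<tau> *\<^sub>R (t *\<^sub>R u))"
    have \<tau>u: "norm (\<tau> *\<^sub>R (t *\<^sub>R u)) \<le> t * norm u"
      using \<tau> that by (simp add: mult_left_le_one_le)
    have "norm (t *\<^sub>R v + \<tau> *\<^sub>R (t *\<^sub>R u)) \<le> t * (norm u + norm v)"
      using norm_triangle_ineq[of "t *\<^sub>R v" "\<tau> *\<^sub>R (t *\<^sub>R u)"] \<tau>u that by (simp add: algebra_simps)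
    hence "norm r1 \<le> \<rho> * (t * (norm u + norm v))\<^sup>2"
      unfolding r1_def
      by (intro order_trans[OF hess_remainder[OF diff(2) lip]] mult_left_mono power_mono) (auto simp: \<open>0 \<le> \<rho>\<close>)
    moreover have "norm r2 \<le> \<rho> * (t * norm u)\<^sup>2"
      unfolding r2_def
      by (intro order_trans[OF hess_remainder[OF diff(2) lip]] mult_left_mono power_mono \<tau>u) (auto simp: \<open>0 \<le> \<rho>\<close>)
    ultimately have r: "norm (r1 - r2) \<le> \<rho> * (t * (norm u + norm v))\<^sup>2 + \<rho> * (t * norm u)\<^sup>2"
      using norm_triangle_ineq4[of r1 r2] by linarith
    have "\<phi>' \<tau> = (?H *v (t *\<^sub>R v) + (r1 - r2)) \<bullet> (t *\<^sub>R u)"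
      unfolding \<phi>'_def r1_def r2_def by (simp add: algebra_simps matrix_vector_right_distrib)
    also have "\<dots> = t\<^sup>2 * (u \<bullet> (?H *v v)) + t * ((r1 - r2) \<bullet> u)"
      by (simp add: inner_add_left inner_add_right matrix_vector_mult_scaleR power2_eq_square
          inner_commute algebra_simps)
    finally have "S t u v - t\<^sup>2 * (u \<bullet> (?H *v v)) = t * ((r1 - r2) \<bullet> u)"
      using \<tau>(3) unfolding S_def \<phi>_def by (simp add: algebra_simps)
    also have "\<bar>\<dots>\<bar> \<le> t * (norm (r1 - r2) * norm u)"
      using that Cauchy_Schwarz_ineq2[of "r1 - r2" u] by (simp add: abs_mult)
    also have "\<dots> \<le> t * ((\<rho> * (t * (norm u + norm v))\<^sup>2 + \<rho> * (t * norm u)\<^sup>2) * norm u)"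
      using that r by (intro mult_left_mono mult_right_mono) auto
    also have "\<dots> = c u v * t^3" unfolding c_def by algebra
    finally show ?thesis .
  qed
  have bound: "\<bar>u \<bullet> (hess g x *v v) - v \<bullet> (hess g x *v u)\<bar> \<le> (c u v + c v u) * t" if "0 < t" for t
  proof -
    have "\<bar>t\<^sup>2 * (u \<bullet> (hess g x *v v)) - t\<^sup>2 * (v \<bullet> (hess g x *v u))\<bar> \<le> c u v * t^3 + c v u * t^3"
      using est[OF that, of u v] est[OF that, of v u] S_sym[of t u v] by linarith
    also have "\<bar>t\<^sup>2 * (u \<bullet> (hess g x *v v)) - t\<^sup>2 * (v \<bullet> (hess g x *v u))\<bar>
        = t\<^sup>2 * \<bar>u \<bullet> (hess g x *v v) - v \<bullet> (hess g x *v u)\<bar>"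
      by (simp add: right_diff_distrib[symmetric] abs_mult)
    also have "c u v * t^3 + c v u * t^3 = t\<^sup>2 * ((c u v + c v u) * t)" by algebra
    finally show ?thesis using that by simp
  qed
  have "((\<lambda>t. (c u v + c v u) * t) \<longlongrightarrow> (c u v + c v u) * 0) (at_right 0)"
    by (intro tendsto_intros)
  hence "\<bar>u \<bullet> (hess g x *v v) - v \<bullet> (hess g x *v u)\<bar> \<le> (c u v + c v u) * 0"
    by (rule tendsto_lowerbound) (use bound in \<open>auto simp: eventually_at intro!: exI[of _ 1]\<close>)
  thus ?thesis by simp
qed

section \<open>The least eigenvalue of a symmetric matrix\<close>

text \<open>Eigenvectors of distinct eigenvalues are orthogonal, and a pairwise orthogonal set of vectors is
  finite.\<close>
lemma symmetric_eigenvalues_finite: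
  fixes A :: "real^'n^'n"
  assumes sym: "\<And>u v. u \<bullet> (A *v v) = v \<bullet> (A *v u)"
  shows "finite {c. \<exists>v. v \<noteq> 0 \<and> A *v v = c *\<^sub>R v}" (is "finite ?E")
proof -
  define e where "e c = (SOME v. v \<noteq> 0 \<and> A *v v = c *\<^sub>R v)" for c
  have e: "e c \<noteq> 0" "A *v e c = c *\<^sub>R e c" if "c \<in> ?E" for c
    using someI_ex[of "\<lambda>v. v \<noteq> 0 \<and> A *v v = c *\<^sub>R v"] that unfolding e_def by auto
  have orth: "e c \<bullet> e d = 0" if "c \<in> ?E" "d \<in> ?E" "c \<noteq> d" for c d
  proof -
    have "d * (e c \<bullet> e d) = c * (e c \<bullet> e d)"
      using sym[of "e c" "e d"] e(2)[OF that(1)] e(2)[OF that(2)] by (simp add: inner_commute)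
    thus ?thesis using that(3) by simp
  qed
  have "inj_on e ?E"
  proof (rule inj_onI, rule ccontr)
    fix c d assume "c \<in> ?E" "d \<in> ?E" "e c = e d" "c \<noteq> d"
    thus False using orth[of c d] e(1)[of d] by simp
  qed
  moreover have "finite (e ` ?E)"
  proof (rule pairwise_orthogonal_imp_finite)
    show "pairwise orthogonal (e ` ?E)"
      unfolding pairwise_def orthogonal_def using orth by (metis (no_types, lifting) imageE)
  qed
  ultimately show ?thesis using finite_imageD by blast
qed

text \<open>A minimiser of the quadratic form on the unit sphere is an eigenvector: a first-order variation
  in any direction \<open>z\<close> would otherwise decrease the form.\<close>
lemma symmetric_min_eigenvalue:
  fixes A :: "real^'n^'n"
  assumes sym: "\<And>u v. u \<bullet> (A *v v) = v \<bullet> (A *v u)"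
  obtains c v where "norm v = 1" "A *v v = c *\<^sub>R v" "\<And>u. c * (u \<bullet> u) \<le> u \<bullet> (A *v u)"
proof -
  have "continuous_on (sphere 0 1) (\<lambda>u::real^'n. u \<bullet> (A *v u))"
    by (intro continuous_intros linear_continuous_on matrix_vector_mul_bounded_linear)
  moreover have "sphere (0::real^'n) 1 \<noteq> {}" by simp
  ultimately obtain v where v: "v \<in> sphere 0 1" "\<And>u. u \<in> sphere 0 1 \<Longrightarrow> v \<bullet> (A *v v) \<le> u \<bullet> (A *v u)"
    using continuous_attains_inf[OF compact_sphere, of 0 1 "\<lambda>u::real^'n. u \<bullet> (A *v u)"] by blast
  define c where "c = v \<bullet> (A *v v)"
  have vv: "v \<bullet> v = 1" "norm v = 1" using v(1) by (auto simp: norm_eq_1)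
  have ray: "c * (u \<bullet> u) \<le> u \<bullet> (A *v u)" for u
  proof (cases "u = 0")
    case False
    define w where "w = (1 / norm u) *\<^sub>R u"
    have "w \<in> sphere 0 1" using False by (simp add: w_def)
    hence "c \<le> w \<bullet> (A *v w)" using v(2) by (simp add: c_def)
    also have "\<dots> = (u \<bullet> (A *v u)) / (u \<bullet> u)"
      by (simp add: w_def matrix_vector_mult_scaleR dot_square_norm power2_eq_square)
    finally show ?thesis using False by (simp add: pos_le_divide_eq)
  qed simp
  have "z \<bullet> (A *v v - c *\<^sub>R v) = 0" for z
  proof -
    define a where "a = z \<bullet> (A *v v - c *\<^sub>R v)"
    define b where "b = z \<bullet> (A *v z) - c * (z \<bullet> z)"
    have ge: "0 \<le> 2 * t * a + t\<^sup>2 * b" for t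
    proof -
      have "c * ((v + t *\<^sub>R z) \<bullet> (v + t *\<^sub>R z)) \<le> (v + t *\<^sub>R z) \<bullet> (A *v (v + t *\<^sub>R z))" by (rule ray)
      thus ?thesis
        using sym[of v z] vv unfolding a_def b_def
        by (simp add: inner_add_left inner_add_right inner_diff_right matrix_vector_right_distrib
            matrix_vector_mult_scaleR c_def[symmetric] inner_commute[of v z] power2_eq_square algebra_simps)
    qed
    have "b \<ge> 0" using ray[of z] by (simp add: b_def)
    show ?thesis
    proof (rule ccontr)
      assume "z \<bullet> (A *v v - c *\<^sub>R v) \<noteq> 0"
      hence a: "a \<noteq> 0" by (simp add: a_def)
      \<comment> \<open>The value of \<open>t\<close> that minimises \<open>2 t a + t\<^sup>2 (b + 1)\<close>; the \<open>+ 1\<close> avoids the case \<open>b = 0\<close>.\<close>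
      have "0 \<le> 2 * (- a / (b + 1)) * a + (- a / (b + 1))\<^sup>2 * b" by (rule ge)
      also have "\<dots> = - (a\<^sup>2 * (b + 2)) / (b + 1)\<^sup>2"
        using \<open>b \<ge> 0\<close> by (simp add: divide_simps) algebra
      also have "\<dots> < 0" using a \<open>b \<ge> 0\<close> by (simp add: divide_neg_pos mult_pos_pos)
      finally show False by simp
    qed
  qed
  from this[of "A *v v - c *\<^sub>R v"] have "A *v v = c *\<^sub>R v" by simp
  thus thesis using that vv ray by blast
qed

lemma lambda_min_ge_iff:
  fixes A :: "real^'n^'n"
  assumes sym: "\<And>u v. u \<bullet> (A *v v) = v \<bullet> (A *v u)"
  shows "m \<le> lambda_min A \<longleftrightarrow> (\<forall>u. m * (u \<bullet> u) \<le> u \<bullet> (A *v u))"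
proof -
  let ?E = "{c. \<exists>v. v \<noteq> 0 \<and> A *v v = c *\<^sub>R v}"
  obtain c v where c: "norm v = 1" "A *v v = c *\<^sub>R v" "\<And>u. c * (u \<bullet> u) \<le> u \<bullet> (A *v u)"
    using symmetric_min_eigenvalue[OF sym] by metis
  have "lambda_min A = c"
    unfolding lambda_min_def
  proof (rule Min_eqI)
    show "finite ?E" by (rule symmetric_eigenvalues_finite[OF sym])
    show "c \<in> ?E" using c(1,2) by (intro CollectI exI[of _ v]) auto
    fix d assume "d \<in> ?E"
    then obtain w where w: "w \<noteq> 0" "A *v w = d *\<^sub>R w" by auto
    hence "c * (w \<bullet> w) \<le> d * (w \<bullet> w)" using c(3)[of w] by simp
    thus "c \<le> d" using w by simp
  qed
  moreover have "m \<le> c" if "\<forall>u. m * (u \<bullet> u) \<le> u \<bullet> (A *v u)"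
    using that[rule_format, of v] c(1,2) by (simp add: dot_square_norm)
  moreover have "m * (u \<bullet> u) \<le> u \<bullet> (A *v u)" if "m \<le> c" for u
    using c(3)[of u] mult_right_mono[OF that, of "u \<bullet> u"] by simp
  ultimately show ?thesis by blast
qed

section \<open>The averaged objective\<close>

lemma has_derivative_of_quadratic_remainder:
  fixes g :: "'a::real_normed_vector \<Rightarrow> 'b::real_normed_vector"
  assumes "bounded_linear A" and rem: "\<And>u. norm (g (x + u) - g x - A u) \<le> c * (norm u)\<^sup>2"
  shows "(g has_derivative A) (at x)"
  unfolding has_derivative_at
proof (intro conjI assms(1))
  have *: "norm (norm (g (x + u) - g x - A u) / norm u) \<le> c * norm u" for u
    using rem[of u] by (cases "u = 0") (auto simp: divide_simps power2_eq_square mult_ac)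
  have "((\<lambda>u. c * norm u) \<longlongrightarrow> c * norm (0::'a)) (at (0::'a))" by (intro tendsto_intros)
  hence "((\<lambda>u. c * norm u) \<longlongrightarrow> 0) (at (0::'a))" by simp
  thus "(\<lambda>u. norm (g (x + u) - g x - A u) / norm u) \<midarrow>0\<rightarrow> 0"
    by (rule Lim_null_comparison[rotated]) (use * in auto)
qed

lemma (in prob_space) norm_expectation_le:
  fixes g :: "'a \<Rightarrow> 'b::{banach, second_countable_topology}"
  assumes "integrable M g" "\<And>i. i \<in> space M \<Longrightarrow> norm (g i) \<le> c"
  shows "norm (\<integral>i. g i \<partial>M) \<le> c"
proof -
  have "norm (\<integral>i. g i \<partial>M) \<le> (\<integral>i. norm (g i) \<partial>M)" by (rule integral_norm_bound)
  also have "\<dots> \<le> c" using assms by (intro integral_le_const integrable_norm) auto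
  finally show ?thesis .
qed

text \<open>Approximate the second argument by the first point of a countable dense sequence within
  \<open>1 / (n + 1)\<close>. A function of countably many values may be substituted measurably, and continuity lets
  \<open>n\<close> tend to infinity. This gives sense to a random gradient at a random point.\<close>
lemma borel_measurable_Caratheodory:
  fixes g :: "'a \<Rightarrow> 'c::{metric_space, second_countable_topology} \<Rightarrow> 'b::metric_space"
  assumes meas: "\<And>x. (\<lambda>i. g i x) \<in> borel_measurable M"
    and cont: "\<And>i. i \<in> space M \<Longrightarrow> continuous_on UNIV (g i)"
  shows "(\<lambda>(i, x). g i x) \<in> borel_measurable (M \<Otimes>\<^sub>M borel)"
proof -
  obtain E :: "'c set" where E: "countable E" "\<And>X. open X \<Longrightarrow> X \<noteq> {} \<Longrightarrow> \<exists>d\<in>E. d \<in> X"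
    by (rule countable_dense_setE) blast
  define d where "d = from_nat_into E"
  define k where "k n x = (LEAST m. dist (d m) x < inverse (real (Suc n)))" for n x
  have near: "dist (d (k n x)) x < inverse (real (Suc n))" for n x
  proof -
    obtain e where e: "e \<in> E" "dist e x < inverse (real (Suc n))"
      using E(2)[of "ball x (inverse (real (Suc n)))"] by (auto simp: dist_commute)
    then obtain m where "e = d m" using from_nat_into_surj[OF E(1) e(1)] by (auto simp: d_def)
    hence "dist (d m) x < inverse (real (Suc n))" using e(2) by simp
    thus ?thesis unfolding k_def by (rule LeastI)
  qed
  have conv: "(\<lambda>n. d (k n x)) \<longlonglongrightarrow> x" for x
    by (rule tendsto_dist_iff[THEN iffD2], rule tendsto_sandwich[OF _ _ tendsto_const LIMSEQ_inverse_real_of_nat])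
      (auto intro!: always_eventually less_imp_le near simp del: of_nat_Suc)
  show ?thesis
  proof (rule borel_measurable_LIMSEQ_metric)
    fix n
    have [measurable]: "k n \<in> borel \<rightarrow>\<^sub>M count_space UNIV"
      unfolding k_def by measurable
    have "(\<lambda>p. g (fst p) (d (k n (snd p)))) \<in> borel_measurable (M \<Otimes>\<^sub>M borel)"
      by (rule measurable_compose_countable[where f = "\<lambda>m p. g (fst p) (d m)" and g = "\<lambda>p. k n (snd p)"])
        (auto intro!: measurable_compose[OF measurable_fst meas])
    thus "(\<lambda>(i, x). g i (d (k n x))) \<in> borel_measurable (M \<Otimes>\<^sub>M borel)" by (simp add: case_prod_beta')
  next
    fix p assume "p \<in> space (M \<Otimes>\<^sub>M (borel :: 'c measure))"
    then obtain i x where p: "p = (i, x)" "i \<in> space M" by (auto simp: space_pair_measure)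
    have "(\<lambda>n. g i (d (k n x))) \<longlonglongrightarrow> g i x"
      using cont[OF p(2)] conv
      by (intro isCont_tendsto_compose[where g = "g i"]) (auto simp: continuous_on_eq_continuous_at)
    thus "(\<lambda>n. (\<lambda>(i, x). g i (d (k n x))) p) \<longlonglongrightarrow> (\<lambda>(i, x). g i x) p" by (simp add: p)
  qed
qed

locale smooth_objective =
  fixes D :: "'i measure" and f :: "'i \<Rightarrow> real^'n \<Rightarrow> real" and L \<rho> :: real
  assumes objective: "stochastic_objective D f"
    and L_pos: "0 < L" and rho_pos: "0 < \<rho>"
    and gradients_lipschitz: "gradients_lipschitz D f L"
    and hessians_lipschitz: "hessians_lipschitz D f \<rho>"
begin

abbreviation F where "F \<equiv> mean_obj D f"

sublocale D: prob_space D
  using objective unfolding stochastic_objective_def by blast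

lemma component_differentiable: "i \<in> space D \<Longrightarrow> f i differentiable (at x)"
  and grad_component_differentiable: "i \<in> space D \<Longrightarrow> grad (f i) differentiable (at x)"
  and integrable_component: "integrable D (\<lambda>i. f i x)"
  and integrable_grad_component: "integrable D (\<lambda>i. grad (f i) x)"
  and expectation_grad_component: "(\<integral>i. grad (f i) x \<partial>D) = grad F x"
  using objective unfolding stochastic_objective_def twice_differentiable_def by blast+

lemma grad_component_lipschitz:
  "i \<in> space D \<Longrightarrow> norm (grad (f i) x - grad (f i) y) \<le> L * norm (x - y)"
  using gradients_lipschitz unfolding gradients_lipschitz_def by blast

lemma hess_component_lipschitz:
  "i \<in> space D \<Longrightarrow> spectral_norm (hess (f i) x - hess (f i) y) \<le> \<rho> * norm (x - y)"
  using hessians_lipschitz unfolding hessians_lipschitz_def by blast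

lemma borel_measurable_grad_component:
  "(\<lambda>(i, x). grad (f i) x) \<in> borel_measurable (D \<Otimes>\<^sub>M borel)"
proof (rule borel_measurable_Caratheodory)
  show "(\<lambda>i. grad (f i) x) \<in> borel_measurable D" for x
    by (rule borel_measurable_integrable[OF integrable_grad_component])
  show "continuous_on UNIV (grad (f i))" if "i \<in> space D" for i
    using grad_component_differentiable[OF that] differentiable_imp_continuous_within
    by (auto simp: continuous_on_eq_continuous_at)
qed

lemma F_differentiable: "F differentiable (at x)"
proof -
  define G where "G = (\<integral>i. grad (f i) x \<partial>D)"
  have "norm (F (x + u) - F x - G \<bullet> u) \<le> 3 * L / 2 * (norm u)\<^sup>2" for u
  proof -
    have "F (x + u) - F x - G \<bullet> u = (\<integral>i. f i (x + u) - f i x - grad (f i) x \<bullet> u \<partial>D)"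
      using integrable_component integrable_grad_component unfolding mean_obj_def G_def by simp
    also have "norm \<dots> \<le> 3 * L / 2 * (norm u)\<^sup>2"
      using integrable_component integrable_grad_component
        lipschitz_grad_remainder[OF component_differentiable grad_component_lipschitz]
      by (intro D.norm_expectation_le) auto
    finally show ?thesis .
  qed
  hence "(F has_derivative (\<lambda>u. G \<bullet> u)) (at x)"
    by (rule has_derivative_of_quadratic_remainder[OF bounded_linear_inner_right])
  thus ?thesis by (auto simp: differentiable_def)
qed

lemma grad_F_lipschitz: "norm (grad F x - grad F y) \<le> L * norm (x - y)"
proof -
  have "grad F x - grad F y = (\<integral>i. grad (f i) x - grad (f i) y \<partial>D)"
    using integrable_grad_component by (simp add: expectation_grad_component)
  also have "norm \<dots> \<le> L * norm (x - y)"
    using integrable_grad_component grad_component_lipschitz by (intro D.norm_expectation_le) auto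
  finally show ?thesis .
qed

text \<open>Hessians are pointwise limits of difference quotients of the gradients, hence measurable in the
  index. The Lipschitz constants bound them uniformly.\<close>
lemma integrable_hess_component: "integrable D (\<lambda>i. hess (f i) x *v v)"
proof -
  have rem: "norm (grad (f i) (x + u) - grad (f i) x - hess (f i) x *v u) \<le> \<rho> * (norm u)\<^sup>2"
    if "i \<in> space D" for i u
    using hess_remainder[OF grad_component_differentiable[OF that] hess_component_lipschitz[OF that]]
      rho_pos by simp
  have "(\<lambda>i. hess (f i) x *v v) \<in> borel_measurable D"
  proof (rule borel_measurable_LIMSEQ_metric)
    fix n
    show "(\<lambda>i. real (Suc n) *\<^sub>R (grad (f i) (x + (1 / real (Suc n)) *\<^sub>R v) - grad (f i) x))
        \<in> borel_measurable D"
      using integrable_grad_component by (intro borel_measurable_scaleR borel_measurable_diff) auto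
  next
    fix i assume i: "i \<in> space D"
    let ?q = "\<lambda>n. real (Suc n) *\<^sub>R (grad (f i) (x + (1 / real (Suc n)) *\<^sub>R v) - grad (f i) x)"
    have bound: "norm (?q n - hess (f i) x *v v) \<le> (\<rho> * (norm v)\<^sup>2) * inverse (real (Suc n))" for n
    proof -
      let ?u = "(1 / real (Suc n)) *\<^sub>R v"
      have "?q n - hess (f i) x *v v
          = real (Suc n) *\<^sub>R (grad (f i) (x + ?u) - grad (f i) x - hess (f i) x *v ?u)"
        by (simp add: matrix_vector_mult_scaleR scaleR_diff_right del: of_nat_Suc)
      also have "norm \<dots> \<le> real (Suc n) * (\<rho> * (norm ?u)\<^sup>2)"
        unfolding norm_scaleR using rem[OF i, of ?u] by (intro mult_mono) auto
      also have "\<dots> = (\<rho> * (norm v)\<^sup>2) * inverse (real (Suc n))"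
        by (simp add: power2_eq_square field_simps del: of_nat_Suc)
      finally show ?thesis .
    qed
    have "(\<lambda>n. (\<rho> * (norm v)\<^sup>2) * inverse (real (Suc n))) \<longlonglongrightarrow> (\<rho> * (norm v)\<^sup>2) * 0"
      by (intro tendsto_intros LIMSEQ_inverse_real_of_nat)
    hence "(\<lambda>n. (\<rho> * (norm v)\<^sup>2) * inverse (real (Suc n))) \<longlonglongrightarrow> 0" by (simp only: mult_zero_right)
    hence "(\<lambda>n. ?q n - hess (f i) x *v v) \<longlonglongrightarrow> 0"
      by (rule Lim_null_comparison[OF always_eventually, rotated]) (use bound in blast)
    thus "?q \<longlonglongrightarrow> hess (f i) x *v v" by (rule LIM_zero_cancel)
  qed
  moreover have "AE i in D. norm (hess (f i) x *v v) \<le> L * norm v + \<rho> * (norm v)\<^sup>2"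
  proof (intro AE_I2)
    fix i assume i: "i \<in> space D"
    have "norm (hess (f i) x *v v) \<le> norm (grad (f i) (x + v) - grad (f i) x)
        + norm (grad (f i) (x + v) - grad (f i) x - hess (f i) x *v v)"
      using norm_triangle_ineq4[of "grad (f i) (x + v) - grad (f i) x"
          "grad (f i) (x + v) - grad (f i) x - hess (f i) x *v v"] by simp
    thus "norm (hess (f i) x *v v) \<le> L * norm v + \<rho> * (norm v)\<^sup>2"
      using grad_component_lipschitz[OF i, of "x + v" x] rem[OF i, of v] by simp
  qed
  ultimately show ?thesis by (intro D.integrable_const_bound)
qed

text \<open>The second-order remainder is uniform in the index, so it survives averaging; this is
  differentiation under the integral sign.\<close>
lemma has_derivative_grad_F:
  "(grad F has_derivative (\<lambda>v. \<integral>i. hess (f i) x *v v \<partial>D)) (at x)"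
proof (rule has_derivative_of_quadratic_remainder)
  have "linear (\<lambda>v. \<integral>i. hess (f i) x *v v \<partial>D)"
    using integrable_hess_component
    by (intro linearI) (simp_all add: matrix_vector_right_distrib matrix_vector_mult_scaleR)
  thus "bounded_linear (\<lambda>v. \<integral>i. hess (f i) x *v v \<partial>D)" by (simp add: linear_conv_bounded_linear)
next
  fix u
  have "grad F (x + u) - grad F x - (\<integral>i. hess (f i) x *v u \<partial>D)
      = (\<integral>i. grad (f i) (x + u) - grad (f i) x - hess (f i) x *v u \<partial>D)"
    using integrable_hess_component integrable_grad_component
    by (simp add: expectation_grad_component)
  also have "norm \<dots> \<le> \<rho> * (norm u)\<^sup>2"
    using integrable_hess_component integrable_grad_component rho_pos
      hess_remainder[OF grad_component_differentiable hess_component_lipschitz]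
    by (intro D.norm_expectation_le) auto
  finally show "norm (grad F (x + u) - grad F x - (\<integral>i. hess (f i) x *v u \<partial>D)) \<le> \<rho> * (norm u)\<^sup>2" .
qed

lemma grad_F_differentiable: "grad F differentiable (at x)"
  using has_derivative_grad_F by (auto simp: differentiable_def)

lemma hess_F_mult: "hess F x *v v = (\<integral>i. hess (f i) x *v v \<partial>D)"
  using has_derivative_unique[OF has_derivative_hess[OF grad_F_differentiable] has_derivative_grad_F]
  by metis

lemma hess_F_lipschitz: "spectral_norm (hess F x - hess F y) \<le> \<rho> * norm (x - y)"
  unfolding spectral_norm_def
proof (rule onorm_le)
  fix v
  have "(hess F x - hess F y) *v v = (\<integral>i. hess (f i) x *v v - hess (f i) y *v v \<partial>D)"
    using integrable_hess_component by (simp add: matrix_vector_mult_diff_rdistrib hess_F_mult)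
  also have "norm \<dots> \<le> \<rho> * norm (x - y) * norm v"
  proof (rule D.norm_expectation_le)
    fix i assume i: "i \<in> space D"
    have "norm (hess (f i) x *v v - hess (f i) y *v v) \<le> spectral_norm (hess (f i) x - hess (f i) y) * norm v"
      by (metis matrix_vector_mult_diff_rdistrib norm_le_spectral_norm)
    also have "\<dots> \<le> \<rho> * norm (x - y) * norm v"
      by (intro mult_right_mono hess_component_lipschitz i) auto
    finally show "norm (hess (f i) x *v v - hess (f i) y *v v) \<le> \<rho> * norm (x - y) * norm v" .
  qed (use integrable_hess_component in simp)
  finally show "norm ((hess F x - hess F y) *v v) \<le> \<rho> * norm (x - y) * norm v" .
qed

lemmas hess_F_symmetric =
  hess_symmetric[OF F_differentiable grad_F_differentiable hess_F_lipschitz less_imp_le[OF rho_pos]]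

lemma continuous_grad_F: "continuous_on UNIV (grad F)"
  using grad_F_differentiable differentiable_imp_continuous_within
  by (auto simp: continuous_on_eq_continuous_at)

lemma continuous_F: "continuous_on UNIV F"
  using F_differentiable differentiable_imp_continuous_within
  by (auto simp: continuous_on_eq_continuous_at)

lemma quadratic_form_hess_F_diff:
  "\<bar>u \<bullet> (hess F x *v u) - u \<bullet> (hess F y *v u)\<bar> \<le> \<rho> * norm (x - y) * (u \<bullet> u)"
proof -
  have "\<bar>u \<bullet> ((hess F x - hess F y) *v u)\<bar> \<le> norm u * norm ((hess F x - hess F y) *v u)"
    by (rule Cauchy_Schwarz_ineq2)
  also have "\<dots> \<le> norm u * ((\<rho> * norm (x - y)) * norm u)"
    by (intro mult_left_mono order_trans[OF norm_le_spectral_norm] mult_right_mono hess_F_lipschitz) auto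
  finally show ?thesis
    by (simp add: matrix_vector_mult_diff_rdistrib inner_diff_right dot_square_norm power2_eq_square mult_ac)
qed

lemma continuous_hess_F_mult: "continuous_on UNIV (\<lambda>x. hess F x *v v)"
proof (rule continuous_at_imp_continuous_on, intro ballI)
  fix x :: "real^'n"
  have "((\<lambda>y. (\<rho> * norm (y - x)) * norm v) \<longlongrightarrow> (\<rho> * norm (x - x)) * norm v) (at x)"
    by (intro tendsto_intros)
  hence lim: "((\<lambda>y. (\<rho> * norm (y - x)) * norm v) \<longlongrightarrow> 0) (at x)" by simp
  have bound: "norm (hess F y *v v - hess F x *v v) \<le> (\<rho> * norm (y - x)) * norm v" for y
    using order_trans[OF norm_le_spectral_norm mult_right_mono[OF hess_F_lipschitz norm_ge_zero]]
    by (simp only: matrix_vector_mult_diff_rdistrib[symmetric])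
  have "((\<lambda>y. hess F y *v v - hess F x *v v) \<longlongrightarrow> 0) (at x)"
    by (rule Lim_null_comparison[OF always_eventually lim]) (use bound in blast)
  thus "isCont (\<lambda>x. hess F x *v v) x" unfolding isCont_def by (rule LIM_zero_cancel)
qed

lemma continuous_hess_F: "continuous_on UNIV (hess F)"
proof -
  have "continuous_on UNIV (\<lambda>x. \<chi> i j. (hess F x *v axis j 1) $ i)"
    by (intro continuous_on_vec_lambda continuous_on_component continuous_hess_F_mult)
  moreover have "(\<chi> i j. (hess F x *v axis j 1) $ i) = hess F x" for x
    by (simp add: vec_eq_iff matrix_vector_mul_component inner_axis)
  ultimately show ?thesis by simp
qed

lemma measurable_grad_F[measurable]: "grad F \<in> borel_measurable borel"
  by (rule borel_measurable_continuous_onI) (rule continuous_grad_F)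

lemma measurable_F[measurable]: "F \<in> borel_measurable borel"
  by (rule borel_measurable_continuous_onI) (rule continuous_F)

lemma measurable_grad_sample:
  assumes [measurable]: "X \<in> borel_measurable M" "I \<in> M \<rightarrow>\<^sub>M D"
  shows "(\<lambda>\<omega>. grad (f (I \<omega>)) (X \<omega>)) \<in> borel_measurable M"
  using measurable_compose[OF _ borel_measurable_grad_component, of "\<lambda>\<omega>. (I \<omega>, X \<omega>)" M] by simp

lemma measurable_batch_grad:
  assumes [measurable]: "X \<in> borel_measurable M" "\<And>l. (\<lambda>\<omega>. I \<omega> l) \<in> M \<rightarrow>\<^sub>M D"
  shows "(\<lambda>\<omega>. batch_grad f S (I \<omega>) (X \<omega>)) \<in> borel_measurable M"
  unfolding batch_grad_def
  by (intro borel_measurable_scaleR borel_measurable_sum measurable_grad_sample) auto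

end

section \<open>Replacing a block of independent coordinates by a fresh copy\<close>

text \<open>\<open>m x y\<close> stands for \<open>x\<close> with some of its coordinates overwritten by those of \<open>y\<close>. The definition
  says that overwriting with an independent copy preserves the law, which is how independence of the
  overwritten coordinates from the others is expressed without conditional expectations.\<close>
definition resampling :: "'a measure \<Rightarrow> ('a \<Rightarrow> 'a \<Rightarrow> 'a) \<Rightarrow> bool" where
  "resampling M m \<longleftrightarrow> case_prod m \<in> M \<Otimes>\<^sub>M M \<rightarrow>\<^sub>M M \<and> distr (M \<Otimes>\<^sub>M M) M (case_prod m) = M"

lemma nn_integral_resampling:
  assumes "resampling M m" "prob_space M" and [measurable]: "h \<in> borel_measurable M"
  shows "(\<integral>\<^sup>+x. h x \<partial>M) = (\<integral>\<^sup>+x. \<integral>\<^sup>+y. h (m x y) \<partial>M \<partial>M)"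
proof -
  interpret prob_space M by fact
  have m[measurable]: "case_prod m \<in> M \<Otimes>\<^sub>M M \<rightarrow>\<^sub>M M" and eq: "distr (M \<Otimes>\<^sub>M M) M (case_prod m) = M"
    using assms(1) by (auto simp: resampling_def)
  have "(\<integral>\<^sup>+x. h x \<partial>M) = (\<integral>\<^sup>+x. h x \<partial>distr (M \<Otimes>\<^sub>M M) M (case_prod m))"
    by (simp add: eq)
  also have "\<dots> = (\<integral>\<^sup>+p. h (case_prod m p) \<partial>(M \<Otimes>\<^sub>M M))" by (rule nn_integral_distr) auto
  also have "\<dots> = (\<integral>\<^sup>+x. \<integral>\<^sup>+y. h (case_prod m (x, y)) \<partial>M \<partial>M)"
    by (rule nn_integral_fst[symmetric]) measurable
  finally show ?thesis by simp
qed

lemma resampling_pair: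
  assumes M: "resampling M m" "prob_space M" and N: "resampling N n" "prob_space N"
  shows "resampling (M \<Otimes>\<^sub>M N) (\<lambda>(a, b) (a', b'). (m a a', n b b'))"
proof -
  interpret M: prob_space M by fact
  interpret N: prob_space N by fact
  interpret MN: pair_prob_space M N ..
  let ?P = "M \<Otimes>\<^sub>M N" and ?k = "\<lambda>(p, q). (m (fst p) (fst q), n (snd p) (snd q))"
  have [measurable]: "case_prod m \<in> M \<Otimes>\<^sub>M M \<rightarrow>\<^sub>M M" "case_prod n \<in> N \<Otimes>\<^sub>M N \<rightarrow>\<^sub>M N"
    using M N by (auto simp: resampling_def)
  have [measurable]: "?k \<in> ?P \<Otimes>\<^sub>M ?P \<rightarrow>\<^sub>M ?P" by measurable
  have "distr (?P \<Otimes>\<^sub>M ?P) ?P ?k = ?P"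
  proof (rule measure_eqI)
    fix A assume "A \<in> sets (distr (?P \<Otimes>\<^sub>M ?P) ?P ?k)"
    hence A[measurable]: "A \<in> sets ?P" by simp
    let ?I = "indicator A :: _ \<Rightarrow> ennreal"
    have "emeasure (distr (?P \<Otimes>\<^sub>M ?P) ?P ?k) A = (\<integral>\<^sup>+x. ?I x \<partial>distr (?P \<Otimes>\<^sub>M ?P) ?P ?k)"
      by simp
    also have "\<dots> = (\<integral>\<^sup>+z. ?I (?k z) \<partial>(?P \<Otimes>\<^sub>M ?P))" by (rule nn_integral_distr) auto
    also have "\<dots> = (\<integral>\<^sup>+p. \<integral>\<^sup>+q. ?I (?k (p, q)) \<partial>?P \<partial>?P)"
      by (rule MN.nn_integral_fst[symmetric]) measurable
    also have "\<dots> = (\<integral>\<^sup>+a. \<integral>\<^sup>+b. \<integral>\<^sup>+q. ?I (?k ((a, b), q)) \<partial>?P \<partial>N \<partial>M)"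
      by (rule N.nn_integral_fst[symmetric]) measurable
    also have "\<dots> = (\<integral>\<^sup>+a. \<integral>\<^sup>+b. \<integral>\<^sup>+a'. \<integral>\<^sup>+b'. ?I (?k ((a, b), (a', b'))) \<partial>N \<partial>M \<partial>N \<partial>M)"
      by (intro nn_integral_cong N.nn_integral_fst[symmetric]) measurable
    also have "\<dots> = (\<integral>\<^sup>+a. \<integral>\<^sup>+a'. \<integral>\<^sup>+b. \<integral>\<^sup>+b'. ?I (m a a', n b b') \<partial>N \<partial>N \<partial>M \<partial>M)"
    proof (rule nn_integral_cong)
      fix a assume [measurable]: "a \<in> space M"
      have "(\<lambda>(a', b). \<integral>\<^sup>+b'. ?I (m a a', n b b') \<partial>N) \<in> borel_measurable (M \<Otimes>\<^sub>M N)"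
        by measurable
      from MN.Fubini'[OF this]
      show "(\<integral>\<^sup>+b. \<integral>\<^sup>+a'. \<integral>\<^sup>+b'. ?I (?k ((a, b), (a', b'))) \<partial>N \<partial>M \<partial>N)
          = (\<integral>\<^sup>+a'. \<integral>\<^sup>+b. \<integral>\<^sup>+b'. ?I (m a a', n b b') \<partial>N \<partial>N \<partial>M)" by simp
    qed
    also have "\<dots> = (\<integral>\<^sup>+a. \<integral>\<^sup>+a'. \<integral>\<^sup>+b. ?I (m a a', b) \<partial>N \<partial>M \<partial>M)"
    proof (rule nn_integral_cong, rule nn_integral_cong)
      fix a a' assume "a \<in> space M" "a' \<in> space M"
      hence [measurable]: "m a a' \<in> space M"
        using measurable_space[of "case_prod m" "M \<Otimes>\<^sub>M M" M "(a, a')"] M(1)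
        by (auto simp: resampling_def space_pair_measure)
      show "(\<integral>\<^sup>+b. \<integral>\<^sup>+b'. ?I (m a a', n b b') \<partial>N \<partial>N) = (\<integral>\<^sup>+b. ?I (m a a', b) \<partial>N)"
        by (rule nn_integral_resampling[OF N, symmetric]) measurable
    qed
    also have "\<dots> = (\<integral>\<^sup>+a. \<integral>\<^sup>+b. ?I (a, b) \<partial>N \<partial>M)"
      by (rule nn_integral_resampling[OF M, symmetric]) measurable
    also have "\<dots> = (\<integral>\<^sup>+p. ?I p \<partial>?P)" by (rule N.nn_integral_fst) measurable
    finally show "emeasure (distr (?P \<Otimes>\<^sub>M ?P) ?P ?k) A = emeasure ?P A" by simp
  qed simp
  moreover have "(\<lambda>(p, q). (\<lambda>(a, b) (a', b'). (m a a', n b b')) p q) = ?k" by auto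
  ultimately show ?thesis unfolding resampling_def by simp
qed

definition mix :: "'j set \<Rightarrow> ('j \<Rightarrow> 'a) \<Rightarrow> ('j \<Rightarrow> 'a) \<Rightarrow> 'j \<Rightarrow> 'a" where
  "mix K \<omega> \<omega>' = (\<lambda>i. if i \<in> K then \<omega>' i else \<omega> i)"

text \<open>It suffices to compare cylinders: the preimage of a cylinder over \<open>J\<close> is the product of a cylinder
  over \<open>J - K\<close> for the old copy and one over \<open>J \<inter> K\<close> for the new copy.\<close>
lemma resampling_PiM:
  assumes M: "\<And>i. prob_space (M i)"
  shows "resampling (PiM UNIV M) (mix K)"
proof -
  let ?P = "PiM UNIV M"
  interpret P: prob_space ?P by (rule prob_space_PiM) (rule M)
  have m[measurable]: "case_prod (mix K) \<in> ?P \<Otimes>\<^sub>M ?P \<rightarrow>\<^sub>M ?P"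
    unfolding mix_def by (rule measurable_PiM_single') (auto simp: case_prod_beta' space_pair_measure space_PiM PiE_iff)
  have "?P = distr (?P \<Otimes>\<^sub>M ?P) ?P (case_prod (mix K))"
  proof (rule measure_eqI_PiM_infinite)
    show "finite_measure ?P" by unfold_locales
    fix A J assume J: "finite J" and A: "\<And>i. i \<in> J \<Longrightarrow> A i \<in> sets (M i)"
    let ?X = "\<lambda>J. prod_emb UNIV M J (Pi\<^sub>E J A)"
    have X[measurable]: "?X I \<in> sets ?P" if "I \<subseteq> J" for I
      using that J A by (intro sets_PiM_I) (auto intro: finite_subset)
    have mem: "w \<in> ?X I \<longleftrightarrow> w \<in> space ?P \<and> (\<forall>i\<in>I. w i \<in> A i)" if "I \<subseteq> J" for w I
      using that A[THEN sets.sets_into_space] unfolding prod_emb_def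
      by (auto simp: space_PiM PiE_iff restrict_def extensional_def)
    have "emeasure (distr (?P \<Otimes>\<^sub>M ?P) ?P (case_prod (mix K))) (?X J)
        = emeasure (?P \<Otimes>\<^sub>M ?P) (case_prod (mix K) -` ?X J \<inter> space (?P \<Otimes>\<^sub>M ?P))"
      by (intro emeasure_distr m X) auto
    also have "case_prod (mix K) -` ?X J \<inter> space (?P \<Otimes>\<^sub>M ?P) = ?X (J - K) \<times> ?X (J \<inter> K)"
    proof -
      have "mix K w w' \<in> space ?P" if "w \<in> space ?P" "w' \<in> space ?P" for w w'
        using that by (auto simp: space_PiM mix_def PiE_iff)
      moreover have "(\<forall>i\<in>J. mix K w w' i \<in> A i)
          \<longleftrightarrow> (\<forall>i\<in>J. (i \<notin> K \<longrightarrow> w i \<in> A i) \<and> (i \<in> K \<longrightarrow> w' i \<in> A i))" for w w'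
        by (intro ball_cong) (auto simp: mix_def)
      ultimately show ?thesis by (auto simp: mem space_pair_measure)
    qed
    also have "emeasure (?P \<Otimes>\<^sub>M ?P) \<dots> = emeasure ?P (?X (J - K)) * emeasure ?P (?X (J \<inter> K))"
      by (intro P.emeasure_pair_measure_Times X) auto
    also have "\<dots> = (\<Prod>i\<in>J - K. emeasure (M i) (A i)) * (\<Prod>i\<in>J \<inter> K. emeasure (M i) (A i))"
      using J A by (subst (1 2) emeasure_PiM_emb) (auto intro: M)
    also have "\<dots> = (\<Prod>i\<in>J. emeasure (M i) (A i))"
      using J by (subst prod.union_disjoint[symmetric]) (auto intro!: prod.cong)
    also have "\<dots> = emeasure ?P (?X J)"
      using J A by (intro emeasure_PiM_emb[symmetric] M) auto
    finally show "emeasure ?P (?X J) = emeasure (distr (?P \<Otimes>\<^sub>M ?P) ?P (case_prod (mix K))) (?X J)" ..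
  qed auto
  thus ?thesis using m unfolding resampling_def by simp
qed

lemma nn_integral_PiM_coordinate:
  assumes M: "\<And>i. prob_space (M i)" and [measurable]: "h \<in> borel_measurable (M i)"
  shows "(\<integral>\<^sup>+\<omega>. h (\<omega> i) \<partial>PiM UNIV M) = (\<integral>\<^sup>+y. h y \<partial>M i)"
proof -
  interpret product_prob_space M UNIV
    using M by (simp add: product_prob_space_def product_prob_space_axioms_def product_sigma_finite_def
        prob_space_imp_sigma_finite)
  have "(\<integral>\<^sup>+y. h y \<partial>M i) = (\<integral>\<^sup>+y. h y \<partial>distr (PiM UNIV M) (M i) (\<lambda>\<omega>. \<omega> i))"
    by (simp add: PiM_component)
  also have "\<dots> = (\<integral>\<^sup>+\<omega>. h (\<omega> i) \<partial>PiM UNIV M)" by (rule nn_integral_distr) auto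
  finally show ?thesis ..
qed

section \<open>Exponential moments of sums of centred vectors\<close>

text \<open>A smooth substitute for \<open>exp (norm z)\<close>: it dominates it, and the concavity of the square root in
  its exponent reduces the effect of adding a vector to that of adding a real number.\<close>
definition exp_pot :: "'a::real_inner \<Rightarrow> real" where
  "exp_pot z = exp (sqrt (1 + (norm z)\<^sup>2))"

lemma exp_norm_le_exp_pot: "exp (norm z) \<le> exp_pot z"
  unfolding exp_pot_def by (simp add: real_le_rsqrt)

lemma borel_measurable_exp_pot[measurable]:
  "exp_pot \<in> borel_measurable (borel :: 'a::{real_inner, second_countable_topology} measure)"
  unfolding exp_pot_def by measurable

text \<open>Tangent line of the square root at \<open>1 + |x|\<^sup>2\<close>.\<close>
lemma exp_pot_add_le:
  fixes x z :: "'a::real_inner"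
  assumes "norm z \<le> B"
  shows "exp_pot (x + z) \<le> exp_pot x * exp (B\<^sup>2 / 2) * exp (x \<bullet> z / sqrt (1 + (norm x)\<^sup>2))"
proof -
  define h where "h = sqrt (1 + (norm x)\<^sup>2)"
  define s where "s = 1 + (norm (x + z))\<^sup>2"
  have h: "h \<ge> 1" "h\<^sup>2 = 1 + (norm x)\<^sup>2" by (auto simp: h_def add_nonneg_nonneg)
  have "s \<ge> 0" by (simp add: s_def)
  have s: "s = h\<^sup>2 + 2 * (x \<bullet> z) + (norm z)\<^sup>2"
    by (simp add: s_def h power2_norm_eq_inner inner_add_left inner_add_right inner_commute)
  have "2 * h * sqrt s \<le> h\<^sup>2 + s"
    using sum_squares_bound[of h "sqrt s"] \<open>s \<ge> 0\<close> by simp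
  also have "\<dots> = 2 * h * h + 2 * (x \<bullet> z) + (norm z)\<^sup>2" by (simp add: s power2_eq_square)
  also have "\<dots> \<le> 2 * h * h + 2 * (x \<bullet> z) + B\<^sup>2 * h"
  proof -
    have "(norm z)\<^sup>2 \<le> B\<^sup>2" using assms by (intro power_mono) auto
    also have "B\<^sup>2 \<le> B\<^sup>2 * h" using h(1) by (simp add: mult_le_cancel_left1)
    finally show ?thesis by simp
  qed
  also have "\<dots> = 2 * h * (h + B\<^sup>2 / 2 + x \<bullet> z / h)" using h(1) by (simp add: field_simps)
  finally have "sqrt s \<le> h + B\<^sup>2 / 2 + x \<bullet> z / h" using h(1) by simp
  thus ?thesis unfolding exp_pot_def s_def h_def by (simp flip: exp_add)
qed

text \<open>After the tangent line estimate only the scalar \<open>x \<bullet> Z / h\<close> is random. It is centred and bounded by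
  \<open>B\<close> whatever the dimension, so Hoeffding's lemma contributes one factor \<open>exp (B\<^sup>2 / 2)\<close>, and the
  quadratic term of the tangent line estimate the other.\<close>
lemma (in prob_space) nn_integral_exp_pot_add:
  fixes Z :: "'a \<Rightarrow> 'b::{real_inner, banach, second_countable_topology}"
  assumes Z: "integrable M Z" "(\<integral>y. Z y \<partial>M) = 0" and B: "\<And>y. y \<in> space M \<Longrightarrow> norm (Z y) \<le> B"
  shows "(\<integral>\<^sup>+y. ennreal (exp_pot (x + Z y)) \<partial>M) \<le> ennreal (exp (B\<^sup>2) * exp_pot x)"
proof -
  define h where "h = sqrt (1 + (norm x)\<^sup>2)"
  have h: "h \<ge> 1" "norm x \<le> h" by (auto simp: h_def add_nonneg_nonneg real_le_rsqrt)
  have [measurable]: "Z \<in> borel_measurable M" using Z by auto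
  define u where "u y = x \<bullet> Z y / h" for y
  have [measurable]: "u \<in> borel_measurable M" unfolding u_def by measurable
  have bound: "\<bar>u y\<bar> \<le> B" if "y \<in> space M" for y
  proof -
    have "\<bar>x \<bullet> Z y\<bar> \<le> norm x * norm (Z y)" by (rule Cauchy_Schwarz_ineq2)
    also have "\<dots> \<le> h * B" using h B[OF that] by (intro mult_mono) auto
    finally show ?thesis using h by (simp add: u_def abs_divide pos_divide_le_eq mult.commute)
  qed
  interpret interval_bounded_random_variable M u "-B" B
    by unfold_locales (auto simp: abs_le_iff minus_le_iff dest!: bound)
  have "expectation u = 0"
    unfolding u_def using Z by (simp add: integrable_inner_right)
  from Hoeffdings_lemma_nn_integral_0[OF zero_less_one this]
  have hoeff: "(\<integral>\<^sup>+y. ennreal (exp (u y)) \<partial>M) \<le> ennreal (exp (B\<^sup>2 / 2))"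
    by (simp add: power2_eq_square)
  have "(\<integral>\<^sup>+y. ennreal (exp_pot (x + Z y)) \<partial>M)
      \<le> (\<integral>\<^sup>+y. ennreal (exp_pot x * exp (B\<^sup>2 / 2)) * ennreal (exp (u y)) \<partial>M)"
  proof (rule nn_integral_mono)
    fix y assume "y \<in> space M"
    hence "exp_pot (x + Z y) \<le> (exp_pot x * exp (B\<^sup>2 / 2)) * exp (u y)"
      unfolding u_def h_def by (intro exp_pot_add_le B)
    thus "ennreal (exp_pot (x + Z y)) \<le> ennreal (exp_pot x * exp (B\<^sup>2 / 2)) * ennreal (exp (u y))"
      by (simp add: exp_pot_def flip: ennreal_mult)
  qed
  also have "\<dots> = ennreal (exp_pot x * exp (B\<^sup>2 / 2)) * (\<integral>\<^sup>+y. ennreal (exp (u y)) \<partial>M)"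
    by (rule nn_integral_cmult) measurable
  also have "\<dots> \<le> ennreal (exp_pot x * exp (B\<^sup>2 / 2)) * ennreal (exp (B\<^sup>2 / 2))"
    by (intro mult_left_mono hoeff) auto
  also have "\<dots> = ennreal (exp (B\<^sup>2) * exp_pot x)"
    by (simp add: exp_pot_def flip: ennreal_mult exp_add)
  finally show ?thesis .
qed

text \<open>The terms enter one at a time, each resampled given the previous ones. The injection \<open>c\<close> says which
  coordinates of the sample space are used.\<close>
lemma (in prob_space) nn_integral_exp_pot_iid_sum:
  fixes Z :: "'a \<Rightarrow> 'b::{real_inner, banach, second_countable_topology}" and c :: "nat \<Rightarrow> 'j"
  assumes Z: "integrable M Z" "(\<integral>y. Z y \<partial>M) = 0" and B: "\<And>y. y \<in> space M \<Longrightarrow> norm (Z y) \<le> B"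
    and c: "inj c"
  shows "(\<integral>\<^sup>+\<xi>. ennreal (exp_pot (x + (\<Sum>l<S. Z (\<xi> (c l))))) \<partial>(\<Pi>\<^sub>M j\<in>UNIV. M))
      \<le> ennreal (exp (S * B\<^sup>2) * exp_pot x)"
proof (induction S)
  case 0
  interpret P: prob_space "\<Pi>\<^sub>M (j::'j)\<in>UNIV. M" by (rule prob_space_PiM) unfold_locales
  show ?case by (simp add: P.emeasure_space_1)
next
  case (Suc S)
  let ?P = "\<Pi>\<^sub>M (j::'j)\<in>UNIV. M"
  have M: "prob_space M" by unfold_locales
  interpret P: prob_space ?P by (rule prob_space_PiM) (rule M)
  have [measurable]: "Z \<in> borel_measurable M" using Z by auto
  let ?s = "\<lambda>\<xi>. x + (\<Sum>l<S. Z (\<xi> (c l)))"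
  have fresh: "mix {c S} \<xi> \<xi>' (c l) = \<xi> (c l)" if "l < S" for \<xi> \<xi>' l
    using that injD[OF c, of l S] by (auto simp: mix_def)
  have "(\<integral>\<^sup>+\<xi>. ennreal (exp_pot (x + (\<Sum>l<Suc S. Z (\<xi> (c l))))) \<partial>?P)
      = (\<integral>\<^sup>+\<xi>. \<integral>\<^sup>+\<xi>'. ennreal (exp_pot (x + (\<Sum>l<Suc S. Z (mix {c S} \<xi> \<xi>' (c l))))) \<partial>?P \<partial>?P)"
    by (rule nn_integral_resampling[OF resampling_PiM P.prob_space_axioms]) (use M in measurable)
  also have "\<dots> = (\<integral>\<^sup>+\<xi>. \<integral>\<^sup>+\<xi>'. ennreal (exp_pot (?s \<xi> + Z (\<xi>' (c S)))) \<partial>?P \<partial>?P)"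
    by (simp add: fresh add.assoc) (simp add: mix_def)
  also have "\<dots> = (\<integral>\<^sup>+\<xi>. \<integral>\<^sup>+y. ennreal (exp_pot (?s \<xi> + Z y)) \<partial>M \<partial>?P)"
    by (intro nn_integral_cong nn_integral_PiM_coordinate[where h = "\<lambda>y. ennreal (exp_pot (?s _ + Z y))"] M)
      measurable
  also have "\<dots> \<le> (\<integral>\<^sup>+\<xi>. ennreal (exp (B\<^sup>2)) * ennreal (exp_pot (?s \<xi>)) \<partial>?P)"
    by (intro nn_integral_mono order_trans[OF nn_integral_exp_pot_add[OF Z B]])
      (auto simp: exp_pot_def simp flip: ennreal_mult)
  also have "\<dots> = ennreal (exp (B\<^sup>2)) * (\<integral>\<^sup>+\<xi>. ennreal (exp_pot (?s \<xi>)) \<partial>?P)"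
    by (rule nn_integral_cmult) measurable
  also have "\<dots> \<le> ennreal (exp (B\<^sup>2)) * ennreal (exp (S * B\<^sup>2) * exp_pot x)"
    by (intro mult_left_mono Suc.IH) auto
  also have "\<dots> = ennreal (exp (Suc S * B\<^sup>2) * exp_pot x)"
    by (simp add: exp_pot_def algebra_simps flip: ennreal_mult exp_add)
  finally show ?case .
qed

text \<open>The form in which the estimator produces such sums: the deviation of a batch average from its
  mean, measured in units of \<open>\<epsilon>\<close>.\<close>
lemma (in prob_space) nn_integral_exp_pot_average:
  fixes g :: "'a \<Rightarrow> 'b::{real_inner, banach, second_countable_topology}" and c :: "nat \<Rightarrow> 'j"
  assumes g: "integrable M g" and b: "\<And>y. y \<in> space M \<Longrightarrow> norm (g y - expectation g) \<le> b"
    and c: "inj c" and pos: "0 < S" "0 < \<epsilon>"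
  shows "(\<integral>\<^sup>+\<xi>. ennreal (exp_pot (x + ((1 / real S) *\<^sub>R (\<Sum>l<S. g (\<xi> (c l))) - expectation g) /\<^sub>R \<epsilon>))
      \<partial>(\<Pi>\<^sub>M j\<in>UNIV. M)) \<le> ennreal (exp (b\<^sup>2 / (real S * \<epsilon>\<^sup>2)) * exp_pot x)"
proof -
  define Z where "Z y = (1 / (real S * \<epsilon>)) *\<^sub>R (g y - expectation g)" for y
  have Z: "integrable M Z" "(\<integral>y. Z y \<partial>M) = 0"
    unfolding Z_def using g by (auto simp: prob_space)
  have Zb: "norm (Z y) \<le> b / (real S * \<epsilon>)" if "y \<in> space M" for y
    using b[OF that] pos unfolding Z_def norm_scaleR by (simp add: divide_right_mono)
  have sum: "((1 / real S) *\<^sub>R (\<Sum>l<S. g (\<xi> (c l))) - expectation g) /\<^sub>R \<epsilon> = (\<Sum>l<S. Z (\<xi> (c l)))" for \<xi>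
  proof -
    have "(\<Sum>l<S. Z (\<xi> (c l))) = (1 / (real S * \<epsilon>)) *\<^sub>R ((\<Sum>l<S. g (\<xi> (c l))) - real S *\<^sub>R expectation g)"
      unfolding Z_def
      by (simp add: scaleR_right.sum[symmetric] sum_subtractf sum_constant_scaleR del: sum_constant)
    thus ?thesis using pos by (simp add: scaleR_diff_right divide_simps mult.commute)
  qed
  have "real S * (b / (real S * \<epsilon>))\<^sup>2 = b\<^sup>2 / (real S * \<epsilon>\<^sup>2)"
    using pos by (simp add: field_simps power2_eq_square)
  thus ?thesis unfolding sum using nn_integral_exp_pot_iid_sum[OF Z Zb c, of x S] by simp
qed

primrec is_running :: "'n::finite sfo_state \<Rightarrow> bool" where
  "is_running (Running x x' v w c) = True"
| "is_running (Returned j k x c) = False"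

primrec position :: "'n::finite sfo_state \<Rightarrow> real^'n" where
  "position (Running x x' v w c) = x"
| "position (Returned j k x c) = x"

primrec old_position :: "'n::finite sfo_state \<Rightarrow> real^'n" where
  "old_position (Running x x' v w c) = x'"
| "old_position (Returned j k x c) = 0"

primrec old_estimate :: "'n::finite sfo_state \<Rightarrow> real^'n" where
  "old_estimate (Running x x' v w c) = v"
| "old_estimate (Returned j k x c) = 0"

primrec direction :: "'n::finite sfo_state \<Rightarrow> (real^'n) option" where
  "direction (Running x x' v w c) = w"
| "direction (Returned j k x c) = None"

primrec spent :: "'n::finite sfo_state \<Rightarrow> nat" where
  "spent (Running x x' v w c) = c"
| "spent (Returned j k x c) = c"

definition mix_seed ::
  "(nat \<times> nat) set \<Rightarrow> nat set \<Rightarrow> nat set \<Rightarrow> ('i, 'r) sfo_seed \<Rightarrow> ('i, 'r) sfo_seed \<Rightarrow> ('i, 'r) sfo_seed"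
  where "mix_seed X Y Z \<omega> \<omega>' =
    (mix X (fst \<omega>) (fst \<omega>'), mix Y (fst (snd \<omega>)) (fst (snd \<omega>')), mix Z (snd (snd \<omega>)) (snd (snd \<omega>')))"

lemma prob_space_sfo_space:
  assumes "prob_space D" "prob_space R"
  shows "prob_space (sfo_space D R)"
  unfolding sfo_space_def by (intro prob_space_pair prob_space_PiM assms prob_space_measure_pmf)

lemma resampling_sfo_space:
  fixes D :: "'i measure" and R :: "'r measure"
  assumes "prob_space D" "prob_space R"
  shows "resampling (sfo_space D R) (mix_seed X Y Z)"
proof -
  have "resampling (sfo_space D R) (\<lambda>(a, b) (a', b'). (mix X a a',
      (\<lambda>(a, b) (a', b'). (mix Y a a', mix Z b b')) b b'))"
    unfolding sfo_space_def
    by (intro resampling_pair resampling_PiM prob_space_pair prob_space_PiM assms prob_space_measure_pmf)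
  moreover have "(\<lambda>(a, b) (a', b'). (mix X a a',
      (\<lambda>(a, b) (a', b'). (mix Y a a', mix Z b b')) b b')) = (mix_seed X Y Z :: ('i, 'r) sfo_seed \<Rightarrow> _)"
    by (auto simp: fun_eq_iff mix_seed_def)
  ultimately show ?thesis by (simp only:)
qed

lemma nn_integral_pair_fst:
  assumes "prob_space N" and [measurable]: "h \<in> borel_measurable M"
  shows "(\<integral>\<^sup>+p. h (fst p) \<partial>(M \<Otimes>\<^sub>M N)) = (\<integral>\<^sup>+x. h x \<partial>M)"
proof -
  interpret N: prob_space N by fact
  have "(\<integral>\<^sup>+p. h (fst p) \<partial>(M \<Otimes>\<^sub>M N)) = (\<integral>\<^sup>+x. \<integral>\<^sup>+y. h (fst (x, y)) \<partial>N \<partial>M)"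
    by (rule N.nn_integral_fst[symmetric]) measurable
  thus ?thesis by (simp add: N.emeasure_space_1)
qed

lemma nn_integral_pair_snd:
  assumes "prob_space M" "prob_space N" and [measurable]: "h \<in> borel_measurable N"
  shows "(\<integral>\<^sup>+p. h (snd p) \<partial>(M \<Otimes>\<^sub>M N)) = (\<integral>\<^sup>+y. h y \<partial>N)"
proof -
  interpret M: prob_space M by fact
  interpret N: prob_space N by fact
  have "(\<integral>\<^sup>+p. h (snd p) \<partial>(M \<Otimes>\<^sub>M N)) = (\<integral>\<^sup>+x. \<integral>\<^sup>+y. h (snd (x, y)) \<partial>N \<partial>M)"
    by (rule N.nn_integral_fst[symmetric]) measurable
  thus ?thesis by (simp add: M.emeasure_space_1)
qed

section \<open>The run as a function of its seed\<close>

text \<open>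
  A run with arbitrary positive parameters. Apart from their parameters, the two cases of the theorem
  differ in the anchor estimator, of which it suffices to know that it is measurable and that its error,
  in units of \<open>\<epsilon>\<close>, has exponential moment at most \<open>exp (1 + A)\<close>; \<open>exp 1\<close> is the value of the potential
  at \<open>0\<close>.
\<close>
locale spider_run = smooth_objective D f L \<rho>
  for D :: "'i measure" and f :: "'i \<Rightarrow> real^'n \<Rightarrow> real" and L \<rho> :: real +
  fixes R :: "'r measure" and nc :: "('r, 'n) nc_proc" and cost :: "('r, 'n) nc_cost"
    and C :: real and x0 :: "real^'n" and P :: "('i, 'n) sfo_params" and \<epsilon> A :: real
  assumes NC: "nc_search R F L C nc cost"
    and round_length_pos: "0 < round_length P" and period_pos: "0 < period P"
    and batch_pos: "0 < batch P" and last_round_pos: "0 < last_round P"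
    and step_size_pos: "0 < step_size P" and tol_pos: "0 < tol P" and curvature_pos: "0 < curvature P"
    and eps_pos: "0 < \<epsilon>"
    and anchor_measurable: "\<And>k. (\<lambda>(\<xi>, x). anchor P (\<lambda>l. \<xi> (k, l)) x)
        \<in> borel_measurable ((\<Pi>\<^sub>M (_::nat \<times> nat)\<in>UNIV. D) \<Otimes>\<^sub>M borel)"
    and anchor_moment: "\<And>k x. (\<integral>\<^sup>+\<xi>. ennreal (exp_pot ((anchor P (\<lambda>l. \<xi> (k, l)) x - grad F x) /\<^sub>R \<epsilon>))
        \<partial>(\<Pi>\<^sub>M (_::nat \<times> nat)\<in>UNIV. D)) \<le> ennreal (exp (1 + A))"
begin

abbreviation "T \<equiv> round_length P"
abbreviation "q \<equiv> period P"
abbreviation "J \<equiv> last_round P"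
abbreviation "\<eta> \<equiv> step_size P"
abbreviation "\<delta> \<equiv> curvature P"
abbreviation "\<Omega> \<equiv> sfo_space D R"
abbreviation "fail_prob \<equiv> 1 / (16 * real J)"

abbreviation st :: "('i, 'r) sfo_seed \<Rightarrow> nat \<Rightarrow> 'n sfo_state" where
  "st \<equiv> sfo_iter P f nc cost x0"

sublocale R: prob_space R
  using NC unfolding nc_search_def by blast

sublocale \<Omega>: prob_space \<Omega>
  by (intro prob_space_sfo_space) unfold_locales

definition estimate :: "('i, 'r) sfo_seed \<Rightarrow> nat \<Rightarrow> real^'n" where
  "estimate \<omega> k =
     (if k mod q = 0 then anchor P (\<lambda>l. fst \<omega> (k, l)) (position (st \<omega> k))
      else batch_grad f (batch P) (\<lambda>l. fst \<omega> (k, l)) (position (st \<omega> k))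
         - batch_grad f (batch P) (\<lambda>l. fst \<omega> (k, l)) (old_position (st \<omega> k)) + old_estimate (st \<omega> k))"

definition nc_out :: "('i, 'r) sfo_seed \<Rightarrow> nat \<Rightarrow> (real^'n) option" where
  "nc_out \<omega> j = nc (position (st \<omega> (j * T))) (2 * \<delta>) fail_prob (fst (snd \<omega>) j)"

definition iteration_cost :: "('i, 'r) sfo_seed \<Rightarrow> nat \<Rightarrow> nat" where
  "iteration_cost \<omega> k =
     (if k mod T = 0 then cost (position (st \<omega> k)) (2 * \<delta>) fail_prob (fst (snd \<omega>) (k div T)) else 0)
     + (if k mod q = 0 then anchor_cost P else batch P)"

text \<open>The output that the state carries through a round is the one that the round started with, so the
  direction used at iteration \<open>k\<close> is a function of the round \<open>k div T\<close>.\<close>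
lemma iteration_direction:
  assumes "is_running (st \<omega> k)"
  shows "(if k mod T = 0 then nc (position (st \<omega> k)) (2 * \<delta>) fail_prob (fst (snd \<omega>) (k div T))
          else direction (st \<omega> k)) = nc_out \<omega> (k div T)"
  using assms
proof (induction k)
  case 0
  then show ?case by (simp add: nc_out_def)
next
  case (Suc k)
  obtain \<xi> r s where \<omega>: "\<omega> = (\<xi>, r, s)" by (cases \<omega>)
  have run: "is_running (st \<omega> k)" using Suc.prems by (cases "st \<omega> k") (auto simp: \<omega>)
  then obtain x x' v w c where st: "st \<omega> k = Running x x' v w c" by (cases "st \<omega> k") auto
  have dir: "direction (st \<omega> (Suc k)) = nc_out \<omega> (k div T)"
    using Suc.prems Suc.IH[OF run] st by (auto simp: \<omega> Let_def split: option.splits if_splits)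
  show ?case
  proof (cases "Suc k mod T = 0")
    case True
    hence "Suc k div T * T = Suc k" by (metis add.right_neutral div_mult_mod_eq)
    thus ?thesis using True by (simp add: nc_out_def)
  next
    case False
    hence "Suc k div T = k div T" by (simp add: div_Suc)
    thus ?thesis using False dir by simp
  qed
qed

lemma st_Suc:
  assumes "is_running (st \<omega> k)"
  shows "st \<omega> (Suc k) = (case nc_out \<omega> (k div T) of
      Some w \<Rightarrow> Running (position (st \<omega> k) - (snd (snd \<omega>) (k div T) * \<eta>) *\<^sub>R w) (position (st \<omega> k))
        (estimate \<omega> k) (Some w) (spent (st \<omega> k) + iteration_cost \<omega> k)
    | None \<Rightarrow> if norm (estimate \<omega> k) \<le> 2 * tol P
        then Returned (k div T) k (position (st \<omega> k)) (spent (st \<omega> k) + iteration_cost \<omega> k)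
        else Running (position (st \<omega> k) - (\<eta> / norm (estimate \<omega> k)) *\<^sub>R estimate \<omega> k)
          (position (st \<omega> k)) (estimate \<omega> k) None (spent (st \<omega> k) + iteration_cost \<omega> k))" (is "_ = ?rhs")
proof -
  obtain \<xi> r s where \<omega>: "\<omega> = (\<xi>, r, s)" by (cases \<omega>)
  obtain x x' v w c where st: "st \<omega> k = Running x x' v w c" using assms by (cases "st \<omega> k") auto
  have dir: "(if k mod T = 0 then nc x (2 * \<delta>) fail_prob (r (k div T)) else w) = nc_out \<omega> (k div T)"
    using iteration_direction[OF assms] by (simp add: st[unfolded \<omega>] \<omega> cong: if_cong)
  have est: "(if k mod q = 0 then anchor P (\<lambda>l. \<xi> (k, l)) x
      else batch_grad f (batch P) (\<lambda>l. \<xi> (k, l)) x - batch_grad f (batch P) (\<lambda>l. \<xi> (k, l)) x' + v) = estimate \<omega> k"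
    by (simp add: estimate_def st[unfolded \<omega>] \<omega>)
  have cost: "c + (if k mod T = 0 then cost x (2 * \<delta>) fail_prob (r (k div T)) else 0)
      + (if k mod q = 0 then anchor_cost P else batch P) = spent (st \<omega> k) + iteration_cost \<omega> k"
    by (simp add: iteration_cost_def st[unfolded \<omega>] \<omega>)
  have "st \<omega> (Suc k) = sfo_step P f nc cost (\<xi>, r, s) k (Running x x' v w c)" using st by (simp add: \<omega>)
  also have "\<dots> = (case nc_out \<omega> (k div T) of
            Some w1 \<Rightarrow> Running (x - (s (k div T) * \<eta>) *\<^sub>R w1) x (estimate \<omega> k) (nc_out \<omega> (k div T))
               (spent (st \<omega> k) + iteration_cost \<omega> k)
          | None \<Rightarrow>
              if norm (estimate \<omega> k) \<le> 2 * tol P then Returned (k div T) k x (spent (st \<omega> k) + iteration_cost \<omega> k)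
              else Running (x - (\<eta> / norm (estimate \<omega> k)) *\<^sub>R estimate \<omega> k) x (estimate \<omega> k) (nc_out \<omega> (k div T))
               (spent (st \<omega> k) + iteration_cost \<omega> k))"
    unfolding sfo_step.simps Let_def dir est cost ..
  also have "\<dots> = ?rhs"
    by (simp add: st[unfolded \<omega>] \<omega> split: option.split)
  finally show ?thesis .
qed

lemma st_Suc_returned: "\<not> is_running (st \<omega> k) \<Longrightarrow> st \<omega> (Suc k) = st \<omega> k"
  by (cases \<omega>, cases "st \<omega> k") auto

lemma st_returned_mono:
  assumes "\<not> is_running (st \<omega> k)" "k \<le> l"
  shows "st \<omega> l = st \<omega> k"
  using assms(2)
proof (induction l rule: dec_induct)
  case (step n)
  thus ?case using st_Suc_returned[of \<omega> n] assms(1) by (simp del: sfo_iter.simps)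
qed simp

lemma is_running_mono: "is_running (st \<omega> l) \<Longrightarrow> k \<le> l \<Longrightarrow> is_running (st \<omega> k)"
  using st_returned_mono by metis

lemma is_running_Suc:
  "is_running (st \<omega> (Suc k)) \<longleftrightarrow>
     is_running (st \<omega> k) \<and> (nc_out \<omega> (k div T) = None \<longrightarrow> 2 * tol P < norm (estimate \<omega> k))"
  using st_Suc[of \<omega> k] st_Suc_returned[of \<omega> k]
  by (cases "is_running (st \<omega> k)") (auto split: option.split)

lemma old_position_Suc:
    "is_running (st \<omega> (Suc k)) \<Longrightarrow> old_position (st \<omega> (Suc k)) = position (st \<omega> k)"
  and old_estimate_Suc:
    "is_running (st \<omega> (Suc k)) \<Longrightarrow> old_estimate (st \<omega> (Suc k)) = estimate \<omega> k"
  using st_Suc[of \<omega> k] is_running_mono[of \<omega> "Suc k" k] by (auto split: option.split_asm if_splits)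

lemma position_Suc:
  "is_running (st \<omega> (Suc k)) \<Longrightarrow> position (st \<omega> (Suc k)) = position (st \<omega> k) -
    (case nc_out \<omega> (k div T) of Some w \<Rightarrow> (snd (snd \<omega>) (k div T) * \<eta>) *\<^sub>R w
     | None \<Rightarrow> (\<eta> / norm (estimate \<omega> k)) *\<^sub>R estimate \<omega> k)"
  using st_Suc[of \<omega> k] is_running_mono[of \<omega> "Suc k" k] by (auto split: option.splits if_splits)

text \<open>The event of success is expressed through \<open>halts\<close> and the positions rather than through the final
  state, because the state contains the cost, which need not depend measurably on the seed.\<close>
definition halts :: "('i, 'r) sfo_seed \<Rightarrow> nat \<Rightarrow> bool" where
  "halts \<omega> k \<longleftrightarrow> is_running (st \<omega> k) \<and> \<not> is_running (st \<omega> (Suc k))"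

lemma st_after_halt:
  assumes "halts \<omega> k" "k < N"
  shows "st \<omega> N = Returned (k div T) k (position (st \<omega> k)) (spent (st \<omega> N))"
proof -
  have "st \<omega> N = st \<omega> (Suc k)"
    using assms st_returned_mono[of \<omega> "Suc k" N] by (auto simp: halts_def)
  moreover have "st \<omega> (Suc k) = Returned (k div T) k (position (st \<omega> k)) (spent (st \<omega> (Suc k)))"
    using st_Suc[of \<omega> k] assms(1) by (auto simp: halts_def split: option.splits if_splits)
  ultimately show ?thesis by simp
qed

lemma ex_halts: "\<not> is_running (st \<omega> N) \<Longrightarrow> \<exists>k<N. halts \<omega> k"
proof (induction N)
  case (Suc N)
  thus ?case by (cases "is_running (st \<omega> N)") (auto simp: halts_def less_Suc_eq)
qed simp

text \<open>The inequality \<open>j * T < k\<close> is strict because the seed and the sign of a round that starts at \<open>k\<close> are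
  still unused; this is what allows them to be resampled given the state.\<close>
lemma st_cong:
  assumes "\<And>i l. i < k \<Longrightarrow> fst \<omega> (i, l) = fst \<omega>' (i, l)"
    and "\<And>j. j * T < k \<Longrightarrow> fst (snd \<omega>) j = fst (snd \<omega>') j"
    and "\<And>j. j * T < k \<Longrightarrow> snd (snd \<omega>) j = snd (snd \<omega>') j"
  shows "st \<omega> k = st \<omega>' k"
  using assms
proof (induction k)
  case (Suc k)
  obtain \<xi> r s \<xi>' r' s' where \<omega>: "\<omega> = (\<xi>, r, s)" "\<omega>' = (\<xi>', r', s')" by (cases \<omega>, cases \<omega>')
  have IH: "st \<omega> k = st \<omega>' k" using Suc by auto
  have "k div T * T < Suc k" by (simp add: less_Suc_eq_le)
  hence "r (k div T) = r' (k div T)" "s (k div T) = s' (k div T)" "\<And>l. \<xi> (k, l) = \<xi>' (k, l)"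
    using Suc.prems by (auto simp: \<omega>)
  hence "sfo_step P f nc cost \<omega> k S = sfo_step P f nc cost \<omega>' k S" for S
    by (cases S) (simp_all only: \<omega> sfo_step.simps Let_def)
  thus ?case using IH by simp
qed simp

lemma estimate_cong:
  assumes "st \<omega> k = st \<omega>' k" "\<And>l. fst \<omega> (k, l) = fst \<omega>' (k, l)"
  shows "estimate \<omega> k = estimate \<omega>' k"
  using assms by (simp add: estimate_def)

lemma nc_out_cong:
  assumes "st \<omega> (j * T) = st \<omega>' (j * T)" "fst (snd \<omega>) j = fst (snd \<omega>') j"
  shows "nc_out \<omega> j = nc_out \<omega>' j"
  using assms by (simp add: nc_out_def)

end

section \<open>Measurability of the run\<close>

declare sfo_iter.simps(2) [simp del]

context spider_run
begin

definition nc_good :: "('i, 'r) sfo_seed \<Rightarrow> nat \<Rightarrow> bool" where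
  "nc_good \<omega> j = nc_correct F (position (st \<omega> (j * T))) (2 * \<delta>) (nc_out \<omega> j)"

text \<open>The signs have to be \<open>\<plusminus>1\<close> and the NC-search outputs correct for the steps to have length \<open>\<eta>\<close>. On
  the sample space a sign may be any real number, and a wrong output may be any vector.\<close>
definition alive :: "('i, 'r) sfo_seed \<Rightarrow> nat \<Rightarrow> bool" where
  "alive \<omega> k \<longleftrightarrow> is_running (st \<omega> k) \<and> (\<forall>j. j * T < k \<longrightarrow> nc_good \<omega> j \<and> \<bar>snd (snd \<omega>) j\<bar> = 1)"

definition err :: "('i, 'r) sfo_seed \<Rightarrow> nat \<Rightarrow> real^'n" where
  "err \<omega> k = estimate \<omega> k - grad F (position (st \<omega> k))"

lemma measurable_sample[measurable]: "(\<lambda>\<omega>. fst \<omega> i) \<in> \<Omega> \<rightarrow>\<^sub>M D"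
  unfolding sfo_space_def by measurable

lemma measurable_nc_seed[measurable]: "(\<lambda>\<omega>. fst (snd \<omega>) j) \<in> \<Omega> \<rightarrow>\<^sub>M R"
  unfolding sfo_space_def by measurable

lemma measurable_sign[measurable]: "(\<lambda>\<omega>. snd (snd \<omega>) j) \<in> \<Omega> \<rightarrow>\<^sub>M borel"
proof -
  have "(\<lambda>\<omega>. snd (snd \<omega>) j) \<in> \<Omega> \<rightarrow>\<^sub>M measure_pmf (pmf_of_set {1, -1 :: real})"
    unfolding sfo_space_def by measurable
  from measurable_compose[OF this, of "\<lambda>x. x" borel] show ?thesis by simp
qed

lemma fail_prob: "0 < fail_prob" "fail_prob < 1"
  using last_round_pos by (auto simp: divide_simps)

lemma NC_facts:
  shows pred_nc_None: "Measurable.pred (borel \<Otimes>\<^sub>M R) (\<lambda>(x, r). nc x (2 * \<delta>) fail_prob r = None)" (is ?none)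
    and measurable_nc_vec: "(\<lambda>(x, r). case nc x (2 * \<delta>) fail_prob r of None \<Rightarrow> 0 | Some w \<Rightarrow> w)
      \<in> borel_measurable (borel \<Otimes>\<^sub>M R)" (is ?vec)
    and nc_prob: "\<P>(r in R. nc_correct F x (2 * \<delta>) (nc x (2 * \<delta>) fail_prob r)) \<ge> 1 - fail_prob" (is ?prob)
    and nc_cost_le: "r \<in> space R \<Longrightarrow> real (cost x (2 * \<delta>) fail_prob r)
      \<le> C * (ln (real CARD('n) / fail_prob))\<^sup>2 * L\<^sup>2 / (2 * \<delta>)\<^sup>2" (is "_ \<Longrightarrow> ?cost")
    and C_nonneg: "0 \<le> C"
proof -
  have "0 < 2 * \<delta>" using curvature_pos by simp
  thus ?none ?vec ?prob "r \<in> space R \<Longrightarrow> ?cost" "0 \<le> C"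
    using NC fail_prob unfolding nc_search_def by blast+
qed

abbreviation nc_vec :: "('i, 'r) sfo_seed \<Rightarrow> nat \<Rightarrow> real^'n" where
  "nc_vec \<omega> j \<equiv> (case nc_out \<omega> j of None \<Rightarrow> 0 | Some w \<Rightarrow> w)"

lemma measurable_nc_out_aux:
  assumes [measurable]: "(\<lambda>\<omega>. position (st \<omega> (j * T))) \<in> borel_measurable \<Omega>"
  shows "Measurable.pred \<Omega> (\<lambda>\<omega>. nc_out \<omega> j = None)"
    and "(\<lambda>\<omega>. nc_vec \<omega> j) \<in> borel_measurable \<Omega>"
proof -
  have [measurable]: "(\<lambda>\<omega>. (position (st \<omega> (j * T)), fst (snd \<omega>) j)) \<in> \<Omega> \<rightarrow>\<^sub>M borel \<Otimes>\<^sub>M R" by measurable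
  show "Measurable.pred \<Omega> (\<lambda>\<omega>. nc_out \<omega> j = None)"
    unfolding nc_out_def
    using measurable_compose[OF \<open>(\<lambda>\<omega>. (position (st \<omega> (j * T)), fst (snd \<omega>) j)) \<in> _\<close> pred_nc_None] by simp
  show "(\<lambda>\<omega>. nc_vec \<omega> j) \<in> borel_measurable \<Omega>"
    unfolding nc_out_def
    using measurable_compose[OF \<open>(\<lambda>\<omega>. (position (st \<omega> (j * T)), fst (snd \<omega>) j)) \<in> _\<close> measurable_nc_vec] by simp
qed

lemma measurable_estimate_aux:
  assumes [measurable]: "(\<lambda>\<omega>. position (st \<omega> k)) \<in> borel_measurable \<Omega>"
    "(\<lambda>\<omega>. old_position (st \<omega> k)) \<in> borel_measurable \<Omega>"
    "(\<lambda>\<omega>. old_estimate (st \<omega> k)) \<in> borel_measurable \<Omega>"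
  shows "(\<lambda>\<omega>. estimate \<omega> k) \<in> borel_measurable \<Omega>"
proof -
  have "fst \<in> \<Omega> \<rightarrow>\<^sub>M (\<Pi>\<^sub>M (_::nat \<times> nat)\<in>UNIV. D)" unfolding sfo_space_def by measurable
  hence "(\<lambda>\<omega>. (fst \<omega>, position (st \<omega> k))) \<in> \<Omega> \<rightarrow>\<^sub>M (\<Pi>\<^sub>M (_::nat \<times> nat)\<in>UNIV. D) \<Otimes>\<^sub>M borel" by measurable
  from measurable_compose[OF this anchor_measurable[of k]]
  have "(\<lambda>\<omega>. anchor P (\<lambda>l. fst \<omega> (k, l)) (position (st \<omega> k))) \<in> borel_measurable \<Omega>" by simp
  moreover have "(\<lambda>\<omega>. batch_grad f (batch P) (\<lambda>l. fst \<omega> (k, l)) (position (st \<omega> k))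
         - batch_grad f (batch P) (\<lambda>l. fst \<omega> (k, l)) (old_position (st \<omega> k)) + old_estimate (st \<omega> k))
      \<in> borel_measurable \<Omega>"
    by (intro borel_measurable_add borel_measurable_diff measurable_batch_grad assms measurable_sample)
  ultimately show ?thesis unfolding estimate_def by (cases "k mod q = 0") auto
qed

text \<open>The stored direction is not tracked but recovered from the position at the start of the round, which
  is why the induction is over all earlier iterations.\<close>
lemma measurable_st_aux:
  "Measurable.pred \<Omega> (\<lambda>\<omega>. is_running (st \<omega> k)) \<and>
   (\<lambda>\<omega>. position (st \<omega> k)) \<in> borel_measurable \<Omega> \<and>
   (\<lambda>\<omega>. old_position (st \<omega> k)) \<in> borel_measurable \<Omega> \<and>
   (\<lambda>\<omega>. old_estimate (st \<omega> k)) \<in> borel_measurable \<Omega>"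
proof (induction k rule: less_induct)
  case (less k)
  show ?case
  proof (cases k)
    case 0
    thus ?thesis by simp
  next
    case (Suc l)
    have IH[measurable]: "Measurable.pred \<Omega> (\<lambda>\<omega>. is_running (st \<omega> i))"
        "(\<lambda>\<omega>. position (st \<omega> i)) \<in> borel_measurable \<Omega>"
        "(\<lambda>\<omega>. old_position (st \<omega> i)) \<in> borel_measurable \<Omega>"
        "(\<lambda>\<omega>. old_estimate (st \<omega> i)) \<in> borel_measurable \<Omega>" if "i \<le> l" for i
      using less.IH[of i] that Suc by auto
    have est[measurable]: "(\<lambda>\<omega>. estimate \<omega> l) \<in> borel_measurable \<Omega>"
      by (intro measurable_estimate_aux IH) auto
    define j where "j = l div T"
    have "(\<lambda>\<omega>. position (st \<omega> (j * T))) \<in> borel_measurable \<Omega>"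
      by (rule IH(2)) (simp add: j_def)
    note [measurable] = measurable_nc_out_aux[OF this]
    have [measurable]: "Measurable.pred \<Omega> (\<lambda>\<omega>. is_running (st \<omega> l))"
        "(\<lambda>\<omega>. position (st \<omega> l)) \<in> borel_measurable \<Omega>"
      by (intro IH order_refl)+
    have run[measurable]: "Measurable.pred \<Omega> (\<lambda>\<omega>. is_running (st \<omega> k))"
      unfolding Suc is_running_Suc j_def[symmetric] by measurable
    have "position (st \<omega> k) = (if is_running (st \<omega> k) then position (st \<omega> l) -
        (if nc_out \<omega> j = None then (\<eta> / norm (estimate \<omega> l)) *\<^sub>R estimate \<omega> l
         else (snd (snd \<omega>) j * \<eta>) *\<^sub>R nc_vec \<omega> j)
      else position (st \<omega> l))" for \<omega>
    proof (cases "is_running (st \<omega> k)")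
      case True
      thus ?thesis using position_Suc[of \<omega> l] by (auto simp: Suc j_def split: option.split)
    next
      case False
      thus ?thesis using st_Suc[of \<omega> l] st_Suc_returned[of \<omega> l]
        by (cases "is_running (st \<omega> l)") (auto simp: Suc split: option.splits if_splits)
    qed
    hence "(\<lambda>\<omega>. position (st \<omega> k)) \<in> borel_measurable \<Omega>" by simp
    moreover have "old_position (st \<omega> k) = (if is_running (st \<omega> k) then position (st \<omega> l) else 0)"
      "old_estimate (st \<omega> k) = (if is_running (st \<omega> k) then estimate \<omega> l else 0)" for \<omega>
      using old_position_Suc[of \<omega> l] old_estimate_Suc[of \<omega> l] by (auto simp: Suc) (cases "st \<omega> k"; simp add: Suc)+
    hence "(\<lambda>\<omega>. old_position (st \<omega> k)) \<in> borel_measurable \<Omega>"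
      "(\<lambda>\<omega>. old_estimate (st \<omega> k)) \<in> borel_measurable \<Omega>" by simp_all
    ultimately show ?thesis using run by blast
  qed
qed

lemma measurable_is_running[measurable]: "Measurable.pred \<Omega> (\<lambda>\<omega>. is_running (st \<omega> k))"
  and measurable_position[measurable]: "(\<lambda>\<omega>. position (st \<omega> k)) \<in> borel_measurable \<Omega>"
  using measurable_st_aux[of k] by auto

lemma measurable_estimate[measurable]: "(\<lambda>\<omega>. estimate \<omega> k) \<in> borel_measurable \<Omega>"
  using measurable_st_aux[of k] by (intro measurable_estimate_aux) auto

lemmas measurable_nc_out[measurable] = measurable_nc_out_aux[OF measurable_position]

lemma measurable_err[measurable]: "(\<lambda>\<omega>. err \<omega> k) \<in> borel_measurable \<Omega>"
  unfolding err_def by measurable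

lemma measurable_halts[measurable]: "Measurable.pred \<Omega> (\<lambda>\<omega>. halts \<omega> k)"
  unfolding halts_def by measurable

lemma continuous_quadratic_form_hess_F:
  "continuous_on UNIV (\<lambda>p. snd p \<bullet> (hess F (fst p) *v snd p))"
proof -
  have "continuous_on UNIV (\<lambda>p::(real^'n) \<times> (real^'n). hess F (fst p))"
    by (rule continuous_on_compose2[OF continuous_hess_F]) (auto intro!: continuous_intros)
  thus ?thesis
    unfolding inner_vec_def matrix_vector_mult_def
    by (auto intro!: continuous_intros continuous_on_component)
qed

lemma closed_hess_F_ge: "closed {x. \<forall>u. m * (u \<bullet> u) \<le> u \<bullet> (hess F x *v u)}"
proof -
  have "closed {x. m * (u \<bullet> u) \<le> u \<bullet> (hess F x *v u)}" for u
    by (intro closed_Collect_le continuous_intros continuous_hess_F_mult)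
  thus ?thesis by (intro closed_Collect_all)
qed

lemma pred_hess_F_ge[measurable]: "Measurable.pred borel (\<lambda>x. \<forall>u. m * (u \<bullet> u) \<le> u \<bullet> (hess F x *v u))"
  unfolding pred_def using borel_closed[OF closed_hess_F_ge[of m]] by simp

text \<open>The output matters only through whether it is \<open>None\<close> and through a vector, and both of these depend
  measurably on the seed.\<close>
lemma nc_correct_iff:
  "nc_correct F x d out \<longleftrightarrow>
    (if out = None then \<forall>u. - d * (u \<bullet> u) \<le> u \<bullet> (hess F x *v u)
     else norm (case out of None \<Rightarrow> 0 | Some w \<Rightarrow> w) = 1 \<and>
       (case out of None \<Rightarrow> 0 | Some w \<Rightarrow> w) \<bullet> (hess F x *v (case out of None \<Rightarrow> 0 | Some w \<Rightarrow> w)) \<le> - d / 2)"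
  by (auto simp: nc_correct_def split: option.split)

lemma measurable_nc_good[measurable]: "Measurable.pred \<Omega> (\<lambda>\<omega>. nc_good \<omega> j)"
proof -
  have [measurable]: "(\<lambda>\<omega>. nc_vec \<omega> j \<bullet> (hess F (position (st \<omega> (j * T))) *v nc_vec \<omega> j)) \<in> borel_measurable \<Omega>"
    by (rule borel_measurable_continuous_Pair[OF measurable_position measurable_nc_out(2)
          continuous_quadratic_form_hess_F])
  show ?thesis unfolding nc_good_def nc_correct_iff by measurable
qed

lemma measurable_alive[measurable]: "Measurable.pred \<Omega> (\<lambda>\<omega>. alive \<omega> k)"
  unfolding alive_def by measurable

section \<open>Fresh randomness given the past\<close>

lemma nn_integral_mix_seed:
  assumes [measurable]: "h \<in> borel_measurable \<Omega>"
  shows "(\<integral>\<^sup>+\<omega>. h \<omega> \<partial>\<Omega>) = (\<integral>\<^sup>+\<omega>. \<integral>\<^sup>+\<omega>'. h (mix_seed X Y Z \<omega> \<omega>') \<partial>\<Omega> \<partial>\<Omega>)"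
  by (intro nn_integral_resampling resampling_sfo_space assms) unfold_locales

lemma nn_integral_samples:
  assumes [measurable]: "h \<in> borel_measurable (\<Pi>\<^sub>M (_::nat \<times> nat)\<in>UNIV. D)"
  shows "(\<integral>\<^sup>+\<omega>. h (fst \<omega>) \<partial>\<Omega>) = (\<integral>\<^sup>+\<xi>. h \<xi> \<partial>(\<Pi>\<^sub>M (_::nat \<times> nat)\<in>UNIV. D))"
  unfolding sfo_space_def
  by (intro nn_integral_pair_fst prob_space_pair prob_space_PiM prob_space_measure_pmf assms) unfold_locales

lemma nn_integral_nc_seed:
  assumes [measurable]: "h \<in> borel_measurable R"
  shows "(\<integral>\<^sup>+\<omega>. h (fst (snd \<omega>) j) \<partial>\<Omega>) = (\<integral>\<^sup>+r. h r \<partial>R)"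
proof -
  let ?R = "\<Pi>\<^sub>M (_::nat)\<in>UNIV. R" and ?S = "\<Pi>\<^sub>M (_::nat)\<in>UNIV. measure_pmf (pmf_of_set {1, -1 :: real})"
  have ps: "prob_space ?R" "prob_space ?S" "prob_space (\<Pi>\<^sub>M (_::nat \<times> nat)\<in>UNIV. D)"
    by (auto intro!: prob_space_PiM prob_space_measure_pmf R.prob_space_axioms D.prob_space_axioms)
  have "(\<integral>\<^sup>+\<omega>. h (fst (snd \<omega>) j) \<partial>\<Omega>) = (\<integral>\<^sup>+p. h (fst p j) \<partial>(?R \<Otimes>\<^sub>M ?S))"
    unfolding sfo_space_def by (intro nn_integral_pair_snd ps prob_space_pair) measurable
  also have "\<dots> = (\<integral>\<^sup>+r. h (r j) \<partial>?R)" by (intro nn_integral_pair_fst ps) measurable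
  also have "\<dots> = (\<integral>\<^sup>+r. h r \<partial>R)"
    by (rule nn_integral_PiM_coordinate) (auto intro: R.prob_space_axioms)
  finally show ?thesis .
qed

lemma nn_integral_sign:
  fixes h :: "real \<Rightarrow> ennreal"
  shows "(\<integral>\<^sup>+\<omega>. h (snd (snd \<omega>) j) \<partial>\<Omega>) = (h 1 + h (-1)) / 2"
proof -
  let ?R = "\<Pi>\<^sub>M (_::nat)\<in>UNIV. R" and ?p = "pmf_of_set {1, -1 :: real}"
  let ?S = "\<Pi>\<^sub>M (_::nat)\<in>UNIV. measure_pmf ?p"
  have ps: "prob_space ?R" "prob_space ?S" "prob_space (\<Pi>\<^sub>M (_::nat \<times> nat)\<in>UNIV. D)"
    by (auto intro!: prob_space_PiM prob_space_measure_pmf R.prob_space_axioms D.prob_space_axioms)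
  have [measurable]: "h \<in> borel_measurable (measure_pmf ?p)" by simp
  have "(\<integral>\<^sup>+\<omega>. h (snd (snd \<omega>) j) \<partial>\<Omega>) = (\<integral>\<^sup>+p. h (snd p j) \<partial>(?R \<Otimes>\<^sub>M ?S))"
    unfolding sfo_space_def by (intro nn_integral_pair_snd ps prob_space_pair) measurable
  also have "\<dots> = (\<integral>\<^sup>+s. h (s j) \<partial>?S)" by (intro nn_integral_pair_snd ps) measurable
  also have "\<dots> = (\<integral>\<^sup>+s. h s \<partial>measure_pmf ?p)"
    by (rule nn_integral_PiM_coordinate) (auto intro: prob_space_measure_pmf)
  also have "\<dots> = (h 1 + h (-1)) / 2"
    by (subst nn_integral_pmf_of_set) auto
  finally show ?thesis .
qed

text \<open>Seeds that agree up to \<open>k\<close> produce the same state before iteration \<open>k\<close>, while they may differ in the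
  samples of iteration \<open>k\<close> and in the randomness of a round that starts there.\<close>
definition agree :: "nat \<Rightarrow> ('i, 'r) sfo_seed \<Rightarrow> ('i, 'r) sfo_seed \<Rightarrow> bool" where
  "agree k \<omega> \<omega>' \<longleftrightarrow> (\<forall>i l. i < k \<longrightarrow> fst \<omega> (i, l) = fst \<omega>' (i, l)) \<and>
     (\<forall>j. j * T < k \<longrightarrow> fst (snd \<omega>) j = fst (snd \<omega>') j \<and> snd (snd \<omega>) j = snd (snd \<omega>') j)"

lemma agree_mono: "agree k \<omega> \<omega>' \<Longrightarrow> i \<le> k \<Longrightarrow> agree i \<omega> \<omega>'"
  unfolding agree_def by (meson less_le_trans)

lemma agree_st: "agree k \<omega> \<omega>' \<Longrightarrow> st \<omega> k = st \<omega>' k"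
  by (rule st_cong) (auto simp: agree_def)

lemma agree_nc_out:
  assumes "agree k \<omega> \<omega>'" "j * T < k"
  shows "nc_out \<omega> j = nc_out \<omega>' j"
proof (rule nc_out_cong)
  show "st \<omega> (j * T) = st \<omega>' (j * T)"
    by (rule agree_st[OF agree_mono[OF assms(1)]]) (use assms(2) in simp)
  show "fst (snd \<omega>) j = fst (snd \<omega>') j" using assms by (simp add: agree_def)
qed

lemma agree_nc_good:
  assumes "agree k \<omega> \<omega>'" "j * T < k"
  shows "nc_good \<omega> j = nc_good \<omega>' j"
proof -
  have "st \<omega> (j * T) = st \<omega>' (j * T)"
    by (rule agree_st[OF agree_mono[OF assms(1)]]) (use assms(2) in simp)
  thus ?thesis unfolding nc_good_def using agree_nc_out[OF assms] by simp
qed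

lemma agree_alive:
  assumes "agree k \<omega> \<omega>'"
  shows "alive \<omega> k = alive \<omega>' k"
proof -
  have "nc_good \<omega> j \<and> \<bar>snd (snd \<omega>) j\<bar> = 1 \<longleftrightarrow> nc_good \<omega>' j \<and> \<bar>snd (snd \<omega>') j\<bar> = 1"
    if "j * T < k" for j
    using agree_nc_good[OF assms that] assms that unfolding agree_def by metis
  thus ?thesis unfolding alive_def agree_st[OF assms] by blast
qed

lemma agree_err:
  assumes "agree k \<omega> \<omega>'" "i < k"
  shows "err \<omega> i = err \<omega>' i"
proof -
  have st: "st \<omega> i = st \<omega>' i"
    by (rule agree_st[OF agree_mono[OF assms(1)]]) (use assms(2) in simp)
  have "estimate \<omega> i = estimate \<omega>' i"
    by (rule estimate_cong[OF st]) (use assms in \<open>simp add: agree_def\<close>)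
  thus ?thesis unfolding err_def st by simp
qed

section \<open>Concentration of the gradient estimator\<close>

lemma alive_Suc: "alive \<omega> (Suc k) \<Longrightarrow> alive \<omega> k"
  unfolding alive_def using is_running_mono[of \<omega> "Suc k" k]
  by (meson le_SucI less_SucI order_refl)

lemma alive_step_le:
  assumes "alive \<omega> (Suc k)"
  shows "norm (position (st \<omega> (Suc k)) - position (st \<omega> k)) \<le> \<eta>"
proof -
  have run: "is_running (st \<omega> (Suc k))" using assms by (simp add: alive_def)
  have "k div T * T < Suc k" by (simp add: less_Suc_eq_le)
  hence good: "nc_good \<omega> (k div T)" "\<bar>snd (snd \<omega>) (k div T)\<bar> = 1" using assms by (auto simp: alive_def)
  show ?thesis
  proof (cases "nc_out \<omega> (k div T)")
    case None
    hence "norm (estimate \<omega> k) > 0" using run is_running_Suc tol_pos by fastforce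
    thus ?thesis using None position_Suc[OF run] step_size_pos by simp
  next
    case (Some w)
    hence "norm w = 1" using good(1) by (simp add: nc_good_def nc_correct_def)
    thus ?thesis using Some position_Suc[OF run] step_size_pos good(2) by (simp add: abs_mult)
  qed
qed

text \<open>The sum, over one batch, of the squared bounds \<open>2 L \<eta> / (S \<epsilon>)\<close> on the single terms of an
  increment of the error, \<open>S\<close> being the batch size.\<close>
definition increment_variance :: real where
  "increment_variance = (2 * L * \<eta>)\<^sup>2 / (real (batch P) * \<epsilon>\<^sup>2)"

abbreviation fresh_row :: "nat \<Rightarrow> ('i, 'r) sfo_seed \<Rightarrow> ('i, 'r) sfo_seed \<Rightarrow> ('i, 'r) sfo_seed" where
  "fresh_row k \<equiv> mix_seed ({k} \<times> UNIV) {} {}"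

lemma agree_fresh_row: "agree k (fresh_row k \<omega> \<omega>') \<omega>"
  and fst_fresh_row: "fst (fresh_row k \<omega> \<omega>') (k, l) = fst \<omega>' (k, l)"
  by (auto simp: agree_def mix_seed_def mix_def)

text \<open>Restricted to runs that are alive, as only they have controlled steps; being alive is lost but never
  regained, so the restriction can be weakened along the induction.\<close>
definition err_moment :: "nat \<Rightarrow> ennreal" where
  "err_moment k = (\<integral>\<^sup>+\<omega>. (if alive \<omega> k then ennreal (exp_pot (err \<omega> k /\<^sub>R \<epsilon>)) else 0) \<partial>\<Omega>)"

lemma err_moment_fresh_row:
  "err_moment k = (\<integral>\<^sup>+\<omega>. (if alive \<omega> k
      then \<integral>\<^sup>+\<omega>'. ennreal (exp_pot (err (fresh_row k \<omega> \<omega>') k /\<^sub>R \<epsilon>)) \<partial>\<Omega> else 0) \<partial>\<Omega>)"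
proof -
  let ?m = "fresh_row k"
  have "err_moment k = (\<integral>\<^sup>+\<omega>. \<integral>\<^sup>+\<omega>'. (if alive (?m \<omega> \<omega>') k
      then ennreal (exp_pot (err (?m \<omega> \<omega>') k /\<^sub>R \<epsilon>)) else 0) \<partial>\<Omega> \<partial>\<Omega>)"
    unfolding err_moment_def by (rule nn_integral_mix_seed) measurable
  also have "\<dots> = (\<integral>\<^sup>+\<omega>. (if alive \<omega> k
      then \<integral>\<^sup>+\<omega>'. ennreal (exp_pot (err (?m \<omega> \<omega>') k /\<^sub>R \<epsilon>)) \<partial>\<Omega> else 0) \<partial>\<Omega>)"
    by (intro nn_integral_cong) (simp add: agree_alive[OF agree_fresh_row])
  finally show ?thesis .
qed

lemma err_moment_anchor:
  assumes "k mod q = 0"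
  shows "err_moment k \<le> ennreal (exp (1 + A))"
proof -
  let ?\<Xi> = "\<Pi>\<^sub>M (_::nat \<times> nat)\<in>UNIV. D"
  have "(\<integral>\<^sup>+\<omega>'. ennreal (exp_pot (err (fresh_row k \<omega> \<omega>') k /\<^sub>R \<epsilon>)) \<partial>\<Omega>) \<le> ennreal (exp (1 + A))" for \<omega>
  proof -
    let ?x = "position (st \<omega> k)"
    have [measurable]: "(\<lambda>\<xi>. anchor P (\<lambda>l. \<xi> (k, l)) ?x) \<in> borel_measurable ?\<Xi>"
      using measurable_compose[OF _ anchor_measurable[of k], of "\<lambda>\<xi>. (\<xi>, ?x)"] by simp
    have "err (fresh_row k \<omega> \<omega>') k = anchor P (\<lambda>l. fst \<omega>' (k, l)) ?x - grad F ?x" for \<omega>'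
      using assms unfolding err_def estimate_def agree_st[OF agree_fresh_row] by (simp add: fst_fresh_row)
    hence "(\<integral>\<^sup>+\<omega>'. ennreal (exp_pot (err (fresh_row k \<omega> \<omega>') k /\<^sub>R \<epsilon>)) \<partial>\<Omega>)
        = (\<integral>\<^sup>+\<omega>'. ennreal (exp_pot ((anchor P (\<lambda>l. fst \<omega>' (k, l)) ?x - grad F ?x) /\<^sub>R \<epsilon>)) \<partial>\<Omega>)" by simp
    also have "\<dots> = (\<integral>\<^sup>+\<xi>. ennreal (exp_pot ((anchor P (\<lambda>l. \<xi> (k, l)) ?x - grad F ?x) /\<^sub>R \<epsilon>)) \<partial>?\<Xi>)"
      by (rule nn_integral_samples) measurable
    also have "\<dots> \<le> ennreal (exp (1 + A))" by (rule anchor_moment)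
    finally show ?thesis .
  qed
  hence "err_moment k \<le> (\<integral>\<^sup>+\<omega>. ennreal (exp (1 + A)) \<partial>\<Omega>)"
    unfolding err_moment_fresh_row by (intro nn_integral_mono) auto
  thus ?thesis by (simp add: \<Omega>.emeasure_space_1)
qed

text \<open>Between anchors the error at \<open>k + 1\<close> is the error at \<open>k\<close> plus the deviation of a fresh batch average
  of gradient differences from its mean, and the differences have norm at most \<open>L \<eta>\<close>.\<close>
lemma err_moment_increment:
  assumes no_anchor: "Suc k mod q \<noteq> 0"
  shows "err_moment (Suc k) \<le> ennreal (exp increment_variance) * err_moment k"
proof -
  let ?k = "Suc k"
  let ?m = "fresh_row ?k"
  let ?\<Xi> = "\<Pi>\<^sub>M (_::nat \<times> nat)\<in>UNIV. D"
  have step: "(\<integral>\<^sup>+\<omega>'. ennreal (exp_pot (err (?m \<omega> \<omega>') ?k /\<^sub>R \<epsilon>)) \<partial>\<Omega>)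
      \<le> ennreal (exp increment_variance) * ennreal (exp_pot (err \<omega> k /\<^sub>R \<epsilon>))" if al: "alive \<omega> ?k" for \<omega>
  proof -
    let ?x = "position (st \<omega> ?k)" and ?y = "position (st \<omega> k)"
    define g where "g i = grad (f i) ?x - grad (f i) ?y" for i
    have run: "is_running (st \<omega> ?k)" using al by (simp add: alive_def)
    have g: "integrable D g" "D.expectation g = grad F ?x - grad F ?y"
      unfolding g_def using integrable_grad_component by (auto simp: expectation_grad_component)
    have [measurable]: "g \<in> borel_measurable D" using g by auto
    have bound: "norm (g i - D.expectation g) \<le> 2 * L * \<eta>" if "i \<in> space D" for i
    proof -
      have "norm (g i - D.expectation g) \<le> L * norm (?x - ?y) + L * norm (?x - ?y)"
        unfolding g(2) unfolding g_def
        by (intro order_trans[OF norm_triangle_ineq4] add_mono grad_component_lipschitz grad_F_lipschitz that)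
      also have "\<dots> \<le> 2 * L * \<eta>"
        using mult_left_mono[OF alive_step_le[OF al], of L] L_pos by simp
      finally show ?thesis .
    qed
    define avg where "avg \<xi> = (1 / real (batch P)) *\<^sub>R (\<Sum>l<batch P. g (\<xi> (?k, l)))" for \<xi> :: "nat \<times> nat \<Rightarrow> 'i"
    have "err (?m \<omega> \<omega>') ?k = err \<omega> k + (avg (fst \<omega>') - D.expectation g)" for \<omega>'
      using no_anchor unfolding err_def estimate_def[of _ ?k] agree_st[OF agree_fresh_row] g(2) avg_def g_def
      by (simp add: fst_fresh_row old_position_Suc[OF run] old_estimate_Suc[OF run] batch_grad_def
          sum_subtractf scaleR_diff_right)
    hence "(\<integral>\<^sup>+\<omega>'. ennreal (exp_pot (err (?m \<omega> \<omega>') ?k /\<^sub>R \<epsilon>)) \<partial>\<Omega>)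
        = (\<integral>\<^sup>+\<omega>'. ennreal (exp_pot (err \<omega> k /\<^sub>R \<epsilon> + (avg (fst \<omega>') - D.expectation g) /\<^sub>R \<epsilon>)) \<partial>\<Omega>)"
      by (simp add: scaleR_add_right)
    also have "\<dots> = (\<integral>\<^sup>+\<xi>. ennreal (exp_pot (err \<omega> k /\<^sub>R \<epsilon> + (avg \<xi> - D.expectation g) /\<^sub>R \<epsilon>)) \<partial>?\<Xi>)"
      unfolding avg_def by (rule nn_integral_samples) measurable
    also have "\<dots> \<le> ennreal (exp increment_variance * exp_pot (err \<omega> k /\<^sub>R \<epsilon>))"
      unfolding avg_def increment_variance_def
      by (rule D.nn_integral_exp_pot_average[OF g(1) bound, where c = "\<lambda>l. (?k, l)"])
        (auto simp: inj_def batch_pos eps_pos)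
    finally show ?thesis by (simp add: exp_pot_def ennreal_mult)
  qed
  have "err_moment ?k \<le> (\<integral>\<^sup>+\<omega>. ennreal (exp increment_variance) *
          (if alive \<omega> k then ennreal (exp_pot (err \<omega> k /\<^sub>R \<epsilon>)) else 0) \<partial>\<Omega>)"
    unfolding err_moment_fresh_row[of ?k] using step alive_Suc by (intro nn_integral_mono) auto
  also have "\<dots> = ennreal (exp increment_variance) * err_moment k"
    unfolding err_moment_def by (rule nn_integral_cmult) measurable
  finally show ?thesis .
qed

lemma err_moment_le:
  "err_moment k \<le> ennreal (exp (1 + A + real (k mod q) * increment_variance))"
proof (induction k)
  case 0
  show ?case using err_moment_anchor[of 0] by simp
next
  case (Suc k)
  let ?c = increment_variance
  show ?case
  proof (cases "Suc k mod q = 0")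
    case True
    thus ?thesis using err_moment_anchor by simp
  next
    case False
    have "err_moment (Suc k) \<le> ennreal (exp ?c) * ennreal (exp (1 + A + real (k mod q) * ?c))"
      by (intro order_trans[OF err_moment_increment[OF False]] mult_left_mono Suc.IH) auto
    also have "\<dots> = ennreal (exp (1 + A + real (Suc k mod q) * ?c))"
      using False by (simp add: mod_Suc algebra_simps flip: ennreal_mult exp_add split: if_splits)
    finally show ?thesis .
  qed
qed

text \<open>Markov's inequality for the potential.\<close>
lemma prob_estimate_bad:
  "\<P>(\<omega> in \<Omega>. alive \<omega> k \<and> tol P < norm (err \<omega> k))
    \<le> exp (1 + A + real q * increment_variance - tol P / \<epsilon>)"
proof -
  let ?S = "{\<omega> \<in> space \<Omega>. alive \<omega> k \<and> tol P < norm (err \<omega> k)}"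
  let ?b = increment_variance
  have [measurable]: "?S \<in> sets \<Omega>" by measurable
  have nonneg: "0 \<le> ?b" using eps_pos by (simp add: increment_variance_def)
  have "emeasure \<Omega> ?S = (\<integral>\<^sup>+\<omega>. indicator ?S \<omega> \<partial>\<Omega>)" by simp
  also have "\<dots> \<le> (\<integral>\<^sup>+\<omega>. ennreal (exp (- tol P / \<epsilon>)) *
      (if alive \<omega> k then ennreal (exp_pot (err \<omega> k /\<^sub>R \<epsilon>)) else 0) \<partial>\<Omega>)"
  proof (rule nn_integral_mono)
    fix \<omega>
    have "1 \<le> exp (- tol P / \<epsilon>) * exp_pot (err \<omega> k /\<^sub>R \<epsilon>)" if "tol P < norm (err \<omega> k)"
    proof -
      have "tol P / \<epsilon> \<le> norm (err \<omega> k /\<^sub>R \<epsilon>)"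
        using that eps_pos by (simp add: divide_inverse mult.commute[of "tol P"] mult_left_mono)
      hence "exp (tol P / \<epsilon>) \<le> exp_pot (err \<omega> k /\<^sub>R \<epsilon>)"
        by (intro order_trans[OF _ exp_norm_le_exp_pot]) simp
      thus ?thesis by (simp add: exp_minus field_simps)
    qed
    thus "indicator ?S \<omega> \<le> ennreal (exp (- tol P / \<epsilon>)) *
        (if alive \<omega> k then ennreal (exp_pot (err \<omega> k /\<^sub>R \<epsilon>)) else 0)"
      by (auto simp: indicator_def exp_pot_def simp flip: ennreal_mult)
  qed
  also have "\<dots> = ennreal (exp (- tol P / \<epsilon>)) * err_moment k"
    unfolding err_moment_def by (rule nn_integral_cmult) measurable
  also have "\<dots> \<le> ennreal (exp (- tol P / \<epsilon>)) * ennreal (exp (1 + A + real (k mod q) * ?b))"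
    by (intro mult_left_mono err_moment_le) auto
  also have "\<dots> \<le> ennreal (exp (- tol P / \<epsilon>)) * ennreal (exp (1 + A + real q * ?b))"
    using period_pos nonneg by (intro mult_left_mono ennreal_leI) (auto intro!: mult_right_mono)
  also have "\<dots> = ennreal (exp (1 + A + real q * ?b - tol P / \<epsilon>))"
    by (simp add: mult.commute exp_diff exp_minus divide_inverse flip: ennreal_mult)
  finally show ?thesis by (simp add: \<Omega>.emeasure_eq_measure)
qed

end

section \<open>Descent over a round and the probability of success\<close>

text \<open>The relations between the parameters on which the probability of success depends: a round of aligned
  steps has length \<open>\<delta> / \<rho>\<close>, a step is short enough for the descent estimate, there are four times as many
  rounds as \<open>F\<close> can pay for, and the tail of the estimator error survives the union bound.\<close>
locale tuned_spider_run = spider_run D f L \<rho> R nc cost C x0 P \<epsilon> A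
  for D :: "'i measure" and f :: "'i \<Rightarrow> real^'n \<Rightarrow> real" and L \<rho> :: real
    and R :: "'r measure" and nc cost C x0 P \<epsilon> A +
  assumes F_bdd_below: "bdd_below (range F)"
    and round_displacement: "real (round_length P) * step_size P = curvature P / \<rho>"
    and step_small: "L * step_size P \<le> tol P"
    and enough_rounds: "4 * (F x0 - (INF x. F x))
      \<le> real (last_round P) * min ((curvature P)^3 / (3 * \<rho>\<^sup>2)) (curvature P * tol P / (2 * \<rho>))"
    and small_tail: "real (last_round P) * real (round_length P) *
      exp (1 + A + real (period P) * increment_variance - tol P / \<epsilon>) \<le> 1 / 16"
begin

text \<open>The decrease of \<open>F\<close> that a round guarantees: the expected one of a second-order round or the sure one
  of a first-order round, whichever is smaller.\<close>
definition gain :: real where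
  "gain = min (\<delta>^3 / (3 * \<rho>\<^sup>2)) (\<delta> * tol P / (2 * \<rho>))"

lemma gain_pos: "0 < gain"
  unfolding gain_def using curvature_pos rho_pos tol_pos by simp

definition on_track :: "('i, 'r) sfo_seed \<Rightarrow> nat \<Rightarrow> bool" where
  "on_track \<omega> j \<longleftrightarrow> alive \<omega> (j * T) \<and> (\<forall>k<j * T. norm (err \<omega> k) \<le> tol P)"

abbreviation F_inf :: real where "F_inf \<equiv> (INF x. F x)"

lemma F_inf_le: "F_inf \<le> F x"
  using F_bdd_below by (rule cINF_lower) simp

lemma measurable_on_track[measurable]: "Measurable.pred \<Omega> (\<lambda>\<omega>. on_track \<omega> j)"
  unfolding on_track_def by measurable

lemma agree_on_track:
  assumes "agree (j * T) \<omega> \<omega>'"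
  shows "on_track \<omega> j = on_track \<omega>' j"
  unfolding on_track_def using agree_alive[OF assms] agree_err[OF assms] by auto

lemma div_round: "i < T \<Longrightarrow> (j * T + i) div T = j"
  by simp

text \<open>The estimate is longer than \<open>2 tol\<close> and wrong by at most \<open>tol\<close>, so its direction makes a slope of at
  least \<open>tol\<close>. Smoothness takes back at most half of the decrease, since \<open>L \<eta> \<le> tol\<close>.\<close>
lemma first_order_step:
  assumes "is_running (st \<omega> (Suc k))" "nc_out \<omega> (k div T) = None" "norm (err \<omega> k) \<le> tol P"
  shows "F (position (st \<omega> (Suc k))) \<le> F (position (st \<omega> k)) - \<eta> * tol P / 2"
proof -
  let ?x = "position (st \<omega> k)" and ?v = "estimate \<omega> k"
  define u where "u = - ((\<eta> / norm ?v) *\<^sub>R ?v)"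
  have v: "2 * tol P < norm ?v" using assms is_running_Suc by blast
  hence v0: "norm ?v > 0" using tol_pos by linarith
  have x': "position (st \<omega> (Suc k)) = ?x + u" using position_Suc[OF assms(1)] assms(2) by (simp add: u_def)
  have u: "norm u = \<eta>" using v0 step_size_pos by (simp add: u_def)
  have "err \<omega> k \<bullet> ?v \<le> norm (err \<omega> k) * norm ?v" by (rule norm_cauchy_schwarz)
  also have "\<dots> \<le> tol P * norm ?v" using assms(3) by (intro mult_right_mono) auto
  finally have "grad F ?x \<bullet> ?v \<ge> norm ?v * norm ?v - tol P * norm ?v"
    unfolding err_def by (simp add: inner_diff_left dot_square_norm power2_eq_square)
  moreover have "tol P * norm ?v \<le> norm ?v * norm ?v - tol P * norm ?v"
    using mult_right_mono[OF less_imp_le[OF v], of "norm ?v"] by simp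
  ultimately have "tol P * norm ?v \<le> grad F ?x \<bullet> ?v" by linarith
  hence "\<eta> / norm ?v * (tol P * norm ?v) \<le> \<eta> / norm ?v * (grad F ?x \<bullet> ?v)"
    using step_size_pos by (intro mult_left_mono) auto
  hence "grad F ?x \<bullet> u \<le> - (\<eta> * tol P)" using v0 by (auto simp: u_def)
  moreover have "F (?x + u) \<le> F ?x + grad F ?x \<bullet> u + L / 2 * (norm u)\<^sup>2"
    by (rule lipschitz_grad_upper[OF F_differentiable grad_F_lipschitz])
  moreover have "L / 2 * (norm u)\<^sup>2 \<le> \<eta> * tol P / 2"
    using mult_left_mono[OF step_small, of "\<eta>"] step_size_pos
    by (simp add: u power2_eq_square mult_ac)
  ultimately show ?thesis unfolding x' by linarith
qed

lemma first_order_round: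
  assumes track: "on_track \<omega> (Suc j)" and None: "nc_out \<omega> j = None"
  shows "F (position (st \<omega> (Suc j * T))) \<le> F (position (st \<omega> (j * T))) - \<delta> * tol P / (2 * \<rho>)"
proof -
  have run: "is_running (st \<omega> k)" if "k \<le> Suc j * T" for k
    using track is_running_mono[OF _ that] by (simp add: on_track_def alive_def)
  have "F (position (st \<omega> (j * T + i))) \<le> F (position (st \<omega> (j * T))) - real i * (\<eta> * tol P / 2)"
    if "i \<le> T" for i
    using that
  proof (induction i)
    case (Suc i)
    have "F (position (st \<omega> (Suc (j * T + i)))) \<le> F (position (st \<omega> (j * T + i))) - \<eta> * tol P / 2"
      using Suc.prems track None
      by (intro first_order_step run) (auto simp: div_round on_track_def)
    moreover have "real (Suc i) * (\<eta> * tol P / 2) = real i * (\<eta> * tol P / 2) + \<eta> * tol P / 2"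
      by (simp add: algebra_simps)
    ultimately show ?case using Suc.IH Suc.prems unfolding add_Suc_right by linarith
  qed simp
  from this[of T] have "F (position (st \<omega> (Suc j * T))) \<le> F (position (st \<omega> (j * T))) - real T * (\<eta> * tol P / 2)"
    by (simp add: add.commute)
  also have "real T * (\<eta> * tol P / 2) = \<delta> * tol P / (2 * \<rho>)"
  proof -
    have "real T * (\<eta> * tol P / 2) = (real T * \<eta>) * tol P / 2" by simp
    thus ?thesis by (simp add: round_displacement)
  qed
  finally show ?thesis .
qed

lemma second_order_round:
  assumes "is_running (st \<omega> (Suc j * T))" and Some: "nc_out \<omega> j = Some w"
  shows "position (st \<omega> (Suc j * T)) = position (st \<omega> (j * T)) - (snd (snd \<omega>) j * (\<delta> / \<rho>)) *\<^sub>R w"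
proof -
  let ?s = "snd (snd \<omega>) j"
  have run: "is_running (st \<omega> k)" if "k \<le> Suc j * T" for k
    using assms(1) that is_running_mono by blast
  have "position (st \<omega> (j * T + i)) = position (st \<omega> (j * T)) - (?s * (real i * \<eta>)) *\<^sub>R w"
    if "i \<le> T" for i
    using that
  proof (induction i)
    case (Suc i)
    have "position (st \<omega> (Suc (j * T + i))) = position (st \<omega> (j * T + i)) - (?s * \<eta>) *\<^sub>R w"
      using Suc.prems Some by (subst position_Suc[OF run]) (auto simp: div_round)
    also have "\<dots> = position (st \<omega> (j * T)) - (?s * (real i * \<eta>)) *\<^sub>R w - (?s * \<eta>) *\<^sub>R w"
      using Suc by simp
    also have "\<dots> = position (st \<omega> (j * T)) - (?s * (real (Suc i) * \<eta>)) *\<^sub>R w"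
      by (simp add: algebra_simps)
    finally show ?case by simp
  qed simp
  from this[of T] show ?thesis by (simp add: round_displacement add.commute)
qed

text \<open>The linear terms of the two expansions cancel, leaving the curvature term \<open>- \<delta>\<^sup>3 / \<rho>\<^sup>2\<close> against the
  cubic remainder \<open>\<delta>\<^sup>3 / (3 \<rho>\<^sup>2)\<close>; this is what the random sign is for.\<close>
lemma two_sided_curvature_step:
  assumes "norm w = 1" "w \<bullet> (hess F x *v w) \<le> - \<delta>"
  shows "F (x - (\<delta> / \<rho>) *\<^sub>R w) + F (x + (\<delta> / \<rho>) *\<^sub>R w) \<le> 2 * (F x - gain)"
proof -
  define k where "k = \<delta> / \<rho>"
  have k: "k > 0" using curvature_pos rho_pos by (simp add: k_def)
  have "F (x + t *\<^sub>R w) \<le> F x + t * (grad F x \<bullet> w) + t\<^sup>2 * (w \<bullet> (hess F x *v w)) / 2 + \<rho> / 6 * \<bar>t\<bar>^3" for t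
    using cubic_taylor_upper[OF F_differentiable grad_F_differentiable hess_F_lipschitz, of x "t *\<^sub>R w"] assms(1)
    by (simp add: matrix_vector_mult_scaleR power2_eq_square)
  from this[of k] this[of "-k"]
  have "F (x - k *\<^sub>R w) + F (x + k *\<^sub>R w) \<le> 2 * F x + k\<^sup>2 * (w \<bullet> (hess F x *v w)) + \<rho> / 3 * k^3"
    using k by simp
  also have "\<dots> \<le> 2 * F x - k\<^sup>2 * \<delta> + \<rho> / 3 * k^3"
    using mult_left_mono[OF assms(2), of "k\<^sup>2"] by simp
  also have "\<dots> = 2 * (F x - \<delta>^3 / (3 * \<rho>\<^sup>2))"
    using rho_pos by (simp add: k_def field_simps power2_eq_square power3_eq_cube)
  also have "\<dots> \<le> 2 * (F x - gain)" by (simp add: gain_def)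
  finally show ?thesis by (simp add: k_def)
qed

text \<open>The gains so far are added back, so that the expectation is nonincreasing in \<open>j\<close>. Runs that have
  left the track contribute \<open>0\<close>; as \<open>F - inf F\<close> is nonnegative, dropping them only helps.\<close>
definition potential :: "('i, 'r) sfo_seed \<Rightarrow> nat \<Rightarrow> ennreal" where
  "potential \<omega> j = (if on_track \<omega> j
     then ennreal (F (position (st \<omega> (j * T))) - F_inf + real j * gain) else 0)"

lemma measurable_potential[measurable]: "(\<lambda>\<omega>. potential \<omega> j) \<in> borel_measurable \<Omega>"
  unfolding potential_def by measurable

lemma on_track_SucD:
  assumes "on_track \<omega> (Suc j)"
  shows "on_track \<omega> j" "nc_good \<omega> j"
proof -
  have le: "j * T \<le> Suc j * T" and lt: "j * T < Suc j * T" using round_length_pos by auto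
  have "is_running (st \<omega> (j * T))"
    using assms is_running_mono[OF _ le] by (auto simp: on_track_def alive_def)
  thus "on_track \<omega> j" "nc_good \<omega> j"
    using assms le lt unfolding on_track_def alive_def by (meson less_le_trans)+
qed

text \<open>An upper bound for the next potential in which the sign of round \<open>j\<close> occurs as an explicit argument
  \<open>s\<close> and everything else is known when round \<open>j\<close> starts. Averaging over \<open>s\<close> is then elementary.\<close>
definition round_bound :: "('i, 'r) sfo_seed \<Rightarrow> nat \<Rightarrow> real \<Rightarrow> ennreal" where
  "round_bound \<omega> j s = (if on_track \<omega> j \<and> nc_good \<omega> j then
     (if nc_out \<omega> j = None then ennreal (F (position (st \<omega> (j * T))) - F_inf + real j * gain)
      else ennreal (F (position (st \<omega> (j * T)) - (s * (\<delta> / \<rho>)) *\<^sub>R nc_vec \<omega> j) - F_inf + real (Suc j) * gain))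
     else 0)"

lemma potential_Suc_le: "potential \<omega> (Suc j) \<le> round_bound \<omega> j (snd (snd \<omega>) j)"
proof (cases "on_track \<omega> (Suc j)")
  case True
  note prev = on_track_SucD[OF True]
  show ?thesis
  proof (cases "nc_out \<omega> j")
    case None
    have "F (position (st \<omega> (Suc j * T))) - F_inf + real (Suc j) * gain
        \<le> F (position (st \<omega> (j * T))) - F_inf + real j * gain"
    proof -
      have "gain \<le> \<delta> * tol P / (2 * \<rho>)" by (simp add: gain_def)
      thus ?thesis using first_order_round[OF True None] by (simp add: algebra_simps)
    qed
    thus ?thesis using True prev None unfolding potential_def round_bound_def by (simp add: ennreal_leI)
  next
    case (Some w)
    have run: "is_running (st \<omega> (Suc j * T))" using True by (simp add: on_track_def alive_def)
    show ?thesis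
      using True prev Some second_order_round[OF run Some] unfolding potential_def round_bound_def by simp
  qed
qed (simp add: potential_def)

lemma round_bound_average: "(round_bound \<omega> j 1 + round_bound \<omega> j (-1)) / 2 \<le> potential \<omega> j"
proof (cases "on_track \<omega> j \<and> nc_good \<omega> j")
  case True
  define x where "x = position (st \<omega> (j * T))"
  show ?thesis
  proof (cases "nc_out \<omega> j")
    case None
    have "(a + a) / 2 = a" for a :: ennreal
      unfolding mult_2_right[symmetric] by (rule mult_divide_eq_ennreal) auto
    thus ?thesis using True None unfolding round_bound_def potential_def by simp
  next
    case (Some w)
    have w: "norm w = 1" "w \<bullet> (hess F x *v w) \<le> - \<delta>"
      using True Some by (auto simp: nc_good_def nc_correct_def x_def)
    let ?a = "F (x - (\<delta> / \<rho>) *\<^sub>R w) - F_inf + real (Suc j) * gain"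
    let ?b = "F (x + (\<delta> / \<rho>) *\<^sub>R w) - F_inf + real (Suc j) * gain"
    have nn: "0 \<le> ?a" "0 \<le> ?b"
      using F_inf_le gain_pos by (auto intro!: add_nonneg_nonneg)
    have "(round_bound \<omega> j 1 + round_bound \<omega> j (-1)) / 2 = (ennreal ?a + ennreal ?b) / 2"
      using True Some by (simp add: round_bound_def x_def)
    also have "\<dots> = ennreal ((?a + ?b) / 2)"
    proof -
      have "(ennreal a + ennreal b) / 2 = ennreal ((a + b) / 2)" if "0 \<le> a" "0 \<le> b" for a b
        using divide_ennreal[of "a + b" 2] that by simp
      thus ?thesis using nn by blast
    qed
    also have "\<dots> \<le> ennreal (F x - F_inf + real j * gain)"
      using two_sided_curvature_step[OF w] by (intro ennreal_leI) (simp add: field_simps)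
    also have "\<dots> = potential \<omega> j" using True by (simp add: potential_def x_def)
    finally show ?thesis .
  qed
qed (auto simp: round_bound_def)

lemma potential_decreases:
  "(\<integral>\<^sup>+\<omega>. potential \<omega> (Suc j) \<partial>\<Omega>) \<le> (\<integral>\<^sup>+\<omega>. potential \<omega> j \<partial>\<Omega>)"
proof -
  let ?m = "mix_seed {} {} {j}"
  have agree: "agree (j * T) (?m \<omega> \<omega>') \<omega>" for \<omega> \<omega>'
    using round_length_pos by (auto simp: agree_def mix_seed_def mix_def)
  have "nc_out (?m \<omega> \<omega>') j = nc_out \<omega> j" for \<omega> \<omega>'
    by (rule nc_out_cong[OF agree_st[OF agree]]) (simp add: mix_seed_def mix_def)
  moreover from this have "nc_good (?m \<omega> \<omega>') j = nc_good \<omega> j" for \<omega> \<omega>'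
    unfolding nc_good_def agree_st[OF agree] by simp
  ultimately have bound_eq: "round_bound (?m \<omega> \<omega>') j s = round_bound \<omega> j s" for \<omega> \<omega>' s
    unfolding round_bound_def agree_st[OF agree] agree_on_track[OF agree] by simp
  have sign: "snd (snd (?m \<omega> \<omega>')) j = snd (snd \<omega>') j" for \<omega> \<omega>'
    by (simp add: mix_seed_def mix_def)
  have [measurable]: "(\<lambda>\<omega>. round_bound \<omega> j (snd (snd \<omega>) j)) \<in> borel_measurable \<Omega>"
    unfolding round_bound_def by measurable
  have "(\<integral>\<^sup>+\<omega>. potential \<omega> (Suc j) \<partial>\<Omega>) \<le> (\<integral>\<^sup>+\<omega>. round_bound \<omega> j (snd (snd \<omega>) j) \<partial>\<Omega>)"
    by (intro nn_integral_mono potential_Suc_le)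
  also have "\<dots> = (\<integral>\<^sup>+\<omega>. \<integral>\<^sup>+\<omega>'. round_bound (?m \<omega> \<omega>') j (snd (snd (?m \<omega> \<omega>')) j) \<partial>\<Omega> \<partial>\<Omega>)"
    by (rule nn_integral_mix_seed) measurable
  also have "\<dots> = (\<integral>\<^sup>+\<omega>. \<integral>\<^sup>+\<omega>'. round_bound \<omega> j (snd (snd \<omega>') j) \<partial>\<Omega> \<partial>\<Omega>)"
    unfolding bound_eq sign ..
  also have "\<dots> = (\<integral>\<^sup>+\<omega>. (round_bound \<omega> j 1 + round_bound \<omega> j (-1)) / 2 \<partial>\<Omega>)"
    by (intro nn_integral_cong nn_integral_sign)
  also have "\<dots> \<le> (\<integral>\<^sup>+\<omega>. potential \<omega> j \<partial>\<Omega>)"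
    by (intro nn_integral_mono round_bound_average)
  finally show ?thesis .
qed

lemma prob_on_track_last: "\<P>(\<omega> in \<Omega>. on_track \<omega> J) \<le> 1 / 4"
proof -
  let ?S = "{\<omega> \<in> space \<Omega>. on_track \<omega> J}"
  have [measurable]: "?S \<in> sets \<Omega>" by measurable
  have "ennreal (real J * gain) * emeasure \<Omega> ?S = (\<integral>\<^sup>+\<omega>. ennreal (real J * gain) * indicator ?S \<omega> \<partial>\<Omega>)"
    by (rule nn_integral_cmult_indicator[symmetric]) measurable
  also have "\<dots> \<le> (\<integral>\<^sup>+\<omega>. potential \<omega> J \<partial>\<Omega>)"
  proof (intro nn_integral_mono)
    fix \<omega>
    show "ennreal (real J * gain) * indicator ?S \<omega> \<le> potential \<omega> J"
      using F_inf_le[of "position (st \<omega> (J * T))"]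
      by (auto simp: potential_def indicator_def intro!: ennreal_leI)
  qed
  also have "\<dots> \<le> (\<integral>\<^sup>+\<omega>. potential \<omega> 0 \<partial>\<Omega>)"
    by (rule lift_Suc_antimono_le[of "\<lambda>j. \<integral>\<^sup>+\<omega>. potential \<omega> j \<partial>\<Omega>"]) (auto intro: potential_decreases)
  also have "\<dots> \<le> (\<integral>\<^sup>+\<omega>. ennreal (F x0 - F_inf) \<partial>\<Omega>)"
    by (intro nn_integral_mono) (simp add: potential_def)
  also have "\<dots> = ennreal (F x0 - F_inf)" by (simp add: \<Omega>.emeasure_space_1)
  finally have "real J * gain * measure \<Omega> ?S \<le> F x0 - F_inf"
    using F_inf_le[of x0] gain_pos by (simp add: \<Omega>.emeasure_eq_measure ennreal_mult'[symmetric])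
  also have "\<dots> \<le> real J * gain * (1 / 4)" using enough_rounds by (simp add: gain_def)
  finally have "(real J * gain) * measure \<Omega> ?S \<le> (real J * gain) * (1 / 4)" .
  moreover have "0 < real J * gain" using last_round_pos gain_pos by simp
  ultimately show ?thesis using mult_le_cancel_left_pos by blast
qed

text \<open>The point at which NC-search is run is determined before its seed is drawn.\<close>
lemma prob_nc_bad: "\<P>(\<omega> in \<Omega>. \<not> nc_good \<omega> j) \<le> fail_prob"
proof -
  let ?S = "{\<omega> \<in> space \<Omega>. \<not> nc_good \<omega> j}"
  let ?m = "mix_seed {} {j} {}"
  let ?bad = "\<lambda>x. {r \<in> space R. \<not> nc_correct F x (2 * \<delta>) (nc x (2 * \<delta>) fail_prob r)}"
  have [measurable]: "?S \<in> sets \<Omega>" by measurable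
  have agree: "agree (j * T) (?m \<omega> \<omega>') \<omega>" for \<omega> \<omega>'
    using round_length_pos by (auto simp: agree_def mix_seed_def mix_def)
  have bad: "?bad x \<in> sets R" "emeasure R (?bad x) \<le> ennreal fail_prob" for x
  proof -
    let ?good = "{r \<in> space R. nc_correct F x (2 * \<delta>) (nc x (2 * \<delta>) fail_prob r)}"
    \<comment> \<open>A nonmeasurable set would have measure \<open>0\<close>, against the guarantee of NC-search.\<close>
    have good: "?good \<in> sets R"
    proof (rule ccontr)
      assume "?good \<notin> sets R"
      hence "measure R ?good = 0" by (rule measure_notin_sets)
      thus False using nc_prob[of x] fail_prob by simp
    qed
    have eq: "?bad x = space R - ?good" by auto
    show "?bad x \<in> sets R" unfolding eq using good by auto
    have "measure R (?bad x) = 1 - measure R ?good" unfolding eq by (rule R.prob_compl[OF good])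
    thus "emeasure R (?bad x) \<le> ennreal fail_prob"
      using nc_prob[of x] by (simp add: R.emeasure_eq_measure ennreal_leI)
  qed
  have "emeasure \<Omega> ?S = (\<integral>\<^sup>+\<omega>. indicator ?S \<omega> \<partial>\<Omega>)" by simp
  also have "\<dots> = (\<integral>\<^sup>+\<omega>. (if nc_good \<omega> j then 0 else 1) \<partial>\<Omega>)"
    by (rule nn_integral_cong) (simp add: indicator_def)
  also have "\<dots> = (\<integral>\<^sup>+\<omega>. \<integral>\<^sup>+\<omega>'. (if nc_good (?m \<omega> \<omega>') j then 0 else 1) \<partial>\<Omega> \<partial>\<Omega>)"
    by (rule nn_integral_mix_seed) measurable
  also have "\<dots> = (\<integral>\<^sup>+\<omega>. \<integral>\<^sup>+\<omega>'. indicator (?bad (position (st \<omega> (j * T)))) (fst (snd \<omega>') j) \<partial>\<Omega> \<partial>\<Omega>)"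
  proof (intro nn_integral_cong)
    fix \<omega> \<omega>' assume "\<omega>' \<in> space \<Omega>"
    hence "fst (snd \<omega>') j \<in> space R" using measurable_space[OF measurable_nc_seed] by blast
    moreover have "nc_out (?m \<omega> \<omega>') j = nc (position (st \<omega> (j * T))) (2 * \<delta>) fail_prob (fst (snd \<omega>') j)"
      unfolding nc_out_def agree_st[OF agree] by (simp add: mix_seed_def mix_def)
    ultimately show "(if nc_good (?m \<omega> \<omega>') j then 0 else 1 :: ennreal)
        = indicator (?bad (position (st \<omega> (j * T)))) (fst (snd \<omega>') j)"
      unfolding nc_good_def agree_st[OF agree] by (simp add: indicator_def)
  qed
  also have "\<dots> = (\<integral>\<^sup>+\<omega>. emeasure R (?bad (position (st \<omega> (j * T)))) \<partial>\<Omega>)"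
  proof (intro nn_integral_cong)
    fix \<omega>
    let ?B = "?bad (position (st \<omega> (j * T)))"
    have "(\<lambda>r. indicator ?B r :: ennreal) \<in> borel_measurable R" using bad(1) by measurable
    from nn_integral_nc_seed[OF this]
    show "(\<integral>\<^sup>+\<omega>'. indicator ?B (fst (snd \<omega>') j) \<partial>\<Omega>) = emeasure R ?B"
      using bad(1) by simp
  qed
  also have "\<dots> \<le> (\<integral>\<^sup>+\<omega>. ennreal fail_prob \<partial>\<Omega>)" by (intro nn_integral_mono bad)
  also have "\<dots> = ennreal fail_prob" by (simp add: \<Omega>.emeasure_space_1)
  finally show ?thesis using fail_prob by (simp add: \<Omega>.emeasure_eq_measure)
qed

lemma prob_sign_bad: "\<P>(\<omega> in \<Omega>. \<bar>snd (snd \<omega>) j\<bar> \<noteq> 1) = 0"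
proof -
  let ?S = "{\<omega> \<in> space \<Omega>. \<bar>snd (snd \<omega>) j\<bar> \<noteq> 1}"
  have [measurable]: "?S \<in> sets \<Omega>" by measurable
  have "emeasure \<Omega> ?S = (\<integral>\<^sup>+\<omega>. indicator ?S \<omega> \<partial>\<Omega>)" by simp
  also have "\<dots> = (\<integral>\<^sup>+\<omega>. indicator {s. \<bar>s\<bar> \<noteq> 1} (snd (snd \<omega>) j) \<partial>\<Omega>)"
    by (rule nn_integral_cong) (simp add: indicator_def)
  also have "\<dots> = 0" by (subst nn_integral_sign) simp
  finally show ?thesis by (simp add: \<Omega>.emeasure_eq_measure)
qed

lemma alive_round_displacement:
  assumes "alive \<omega> k"
  shows "norm (position (st \<omega> k) - position (st \<omega> (k div T * T))) \<le> \<delta> / \<rho>"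
proof -
  have al: "alive \<omega> i" if "i \<le> k" for i
    using that assms by (induction rule: inc_induct) (auto intro: alive_Suc)
  have "norm (position (st \<omega> (k div T * T + i)) - position (st \<omega> (k div T * T))) \<le> real i * \<eta>"
    if "k div T * T + i \<le> k" for i
    using that
  proof (induction i)
    case (Suc i)
    have "norm (position (st \<omega> (Suc (k div T * T + i))) - position (st \<omega> (k div T * T + i))) \<le> \<eta>"
      using Suc.prems by (intro alive_step_le al) simp
    thus ?case
      using Suc norm_triangle_ineq[of "position (st \<omega> (Suc (k div T * T + i))) - position (st \<omega> (k div T * T + i))"
          "position (st \<omega> (k div T * T + i)) - position (st \<omega> (k div T * T))"]
      by (simp add: algebra_simps)
  qed simp
  from this[of "k mod T"] have "norm (position (st \<omega> k) - position (st \<omega> (k div T * T))) \<le> real (k mod T) * \<eta>"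
    by simp
  also have "\<dots> \<le> real T * \<eta>"
    using round_length_pos step_size_pos by (intro mult_right_mono) (auto intro: less_imp_le)
  finally show ?thesis by (simp add: round_displacement)
qed

definition accurate :: "real^'n \<Rightarrow> bool" where
  "accurate x \<longleftrightarrow> norm (grad F x) \<le> 3 * tol P \<and> - (3 * \<delta>) \<le> lambda_min (hess F x)"

lemma pred_accurate[measurable]: "Measurable.pred borel accurate"
  unfolding accurate_def lambda_min_ge_iff[OF hess_F_symmetric] by measurable

text \<open>Halting requires that the search at the start of the round found no negative curvature, and the
  current point is within \<open>\<delta> / \<rho>\<close> of the point searched.\<close>
lemma halt_accuracy:
  assumes halt: "halts \<omega> k" and al: "alive \<omega> k" and good: "nc_good \<omega> (k div T)"
    and err: "norm (err \<omega> k) \<le> tol P"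
  shows "accurate (position (st \<omega> k))"
  unfolding accurate_def
proof
  let ?x = "position (st \<omega> k)" and ?y = "position (st \<omega> (k div T * T))"
  have out: "nc_out \<omega> (k div T) = None" and est: "norm (estimate \<omega> k) \<le> 2 * tol P"
    using halt is_running_Suc[of \<omega> k] by (auto simp: halts_def not_less)
  have "norm (grad F ?x) \<le> norm (estimate \<omega> k) + norm (err \<omega> k)"
    using norm_triangle_ineq4[of "estimate \<omega> k" "err \<omega> k"] by (simp add: err_def)
  thus "norm (grad F ?x) \<le> 3 * tol P" using est err by linarith
  have "- (3 * \<delta>) * (u \<bullet> u) \<le> u \<bullet> (hess F ?x *v u)" for u
  proof -
    have "- (2 * \<delta>) * (u \<bullet> u) \<le> u \<bullet> (hess F ?y *v u)"
      using good out by (simp add: nc_good_def nc_correct_def)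
    moreover have "\<rho> * norm (?x - ?y) * (u \<bullet> u) \<le> \<delta> * (u \<bullet> u)"
      using alive_round_displacement[OF al] rho_pos
      by (intro mult_right_mono) (simp_all add: field_simps)
    ultimately show ?thesis using quadratic_form_hess_F_diff[of u ?x ?y] by (simp add: abs_le_iff)
  qed
  thus "- (3 * \<delta>) \<le> lambda_min (hess F ?x)"
    by (subst lambda_min_ge_iff[OF hess_F_symmetric]) auto
qed

lemma halts_in_time:
  assumes "\<not> on_track \<omega> J"
    and nc: "\<And>j. j < J \<Longrightarrow> nc_good \<omega> j" and sign: "\<And>j. j < J \<Longrightarrow> \<bar>snd (snd \<omega>) j\<bar> = 1"
    and est: "\<And>k. k < J * T \<Longrightarrow> \<not> (alive \<omega> k \<and> tol P < norm (err \<omega> k))"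
  obtains k where "k < J * T" "halts \<omega> k" "accurate (position (st \<omega> k))"
proof -
  have alive: "alive \<omega> k" if "is_running (st \<omega> k)" "k \<le> J * T" for k
    unfolding alive_def
  proof (intro conjI allI impI that(1))
    fix j assume "j * T < k"
    hence "j * T < J * T" using that(2) by linarith
    hence "j < J" by simp
    thus "nc_good \<omega> j" "\<bar>snd (snd \<omega>) j\<bar> = 1" using nc sign by auto
  qed
  have err: "norm (err \<omega> k) \<le> tol P" if "is_running (st \<omega> k)" "k < J * T" for k
    using est[OF that(2)] alive[of k] that by auto
  have "\<not> is_running (st \<omega> (J * T))"
  proof
    assume run: "is_running (st \<omega> (J * T))"
    have "on_track \<omega> J"
      unfolding on_track_def using alive[OF run] err is_running_mono[OF run] by auto
    thus False using assms(1) by simp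
  qed
  then obtain k where k: "k < J * T" "halts \<omega> k" using ex_halts by blast
  hence run: "is_running (st \<omega> k)" by (simp add: halts_def)
  have "k div T < J" using k(1) round_length_pos by (simp add: div_less_iff_less_mult)
  thus thesis
    using that[OF k] halt_accuracy[OF k(2) alive[OF run] nc err[OF run k(1)]] k(1) by simp
qed

text \<open>Union bound over the three kinds of failure: \<open>1/4 + 1/16 + 1/16 < 1/2\<close>. The event that some sign is not
  \<open>\<plusminus>1\<close> is null.\<close>
theorem prob_success:
  "\<P>(\<omega> in \<Omega>. \<exists>k<J * T. halts \<omega> k \<and> accurate (position (st \<omega> k))) \<ge> 1 / 2"
proof -
  define p where "p = exp (1 + A + real q * increment_variance - tol P / \<epsilon>)"
  define S1 where "S1 = {\<omega> \<in> space \<Omega>. on_track \<omega> J}"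
  define S2 where "S2 j = {\<omega> \<in> space \<Omega>. \<not> nc_good \<omega> j}" for j
  define S3 where "S3 j = {\<omega> \<in> space \<Omega>. \<bar>snd (snd \<omega>) j\<bar> \<noteq> 1}" for j
  define S4 where "S4 k = {\<omega> \<in> space \<Omega>. alive \<omega> k \<and> tol P < norm (err \<omega> k)}" for k
  have [measurable]: "S1 \<in> sets \<Omega>" "S2 j \<in> sets \<Omega>" "S3 j \<in> sets \<Omega>" "S4 k \<in> sets \<Omega>" for j k
    unfolding S1_def S2_def S3_def S4_def by measurable
  define G where "G = {\<omega> \<in> space \<Omega>. \<exists>k<J * T. halts \<omega> k \<and> accurate (position (st \<omega> k))}"
  let ?U2 = "\<Union>j<J. S2 j" and ?U3 = "\<Union>j<J. S3 j" and ?U4 = "\<Union>k<J * T. S4 k"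
  have [measurable]: "G \<in> sets \<Omega>" unfolding G_def by measurable
  have sub: "space \<Omega> \<subseteq> G \<union> (S1 \<union> (?U2 \<union> (?U3 \<union> ?U4)))"
  proof
    fix \<omega> assume \<omega>: "\<omega> \<in> space \<Omega>"
    show "\<omega> \<in> G \<union> (S1 \<union> (?U2 \<union> (?U3 \<union> ?U4)))"
    proof (rule ccontr)
      assume neg: "\<omega> \<notin> G \<union> (S1 \<union> (?U2 \<union> (?U3 \<union> ?U4)))"
      hence "\<not> on_track \<omega> J" "\<And>j. j < J \<Longrightarrow> nc_good \<omega> j" "\<And>j. j < J \<Longrightarrow> \<bar>snd (snd \<omega>) j\<bar> = 1"
        "\<And>k. k < J * T \<Longrightarrow> \<not> (alive \<omega> k \<and> tol P < norm (err \<omega> k))"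
        using \<omega> by (auto simp: S1_def S2_def S3_def S4_def)
      then obtain k where "k < J * T" "halts \<omega> k" "accurate (position (st \<omega> k))"
        by (rule halts_in_time)
      thus False using neg \<omega> by (auto simp: G_def)
    qed
  qed
  have "1 = measure \<Omega> (space \<Omega>)" by (simp add: \<Omega>.prob_space)
  also have "\<dots> \<le> measure \<Omega> (G \<union> (S1 \<union> (?U2 \<union> (?U3 \<union> ?U4))))"
    by (rule \<Omega>.finite_measure_mono[OF sub]) measurable
  also have "\<dots> \<le> measure \<Omega> G + measure \<Omega> (S1 \<union> (?U2 \<union> (?U3 \<union> ?U4)))"
    by (rule measure_Un_le) measurable
  also have "measure \<Omega> (S1 \<union> (?U2 \<union> (?U3 \<union> ?U4))) \<le> measure \<Omega> S1 + measure \<Omega> (?U2 \<union> (?U3 \<union> ?U4))"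
    by (rule measure_Un_le) measurable
  also have "measure \<Omega> (?U2 \<union> (?U3 \<union> ?U4)) \<le> measure \<Omega> ?U2 + measure \<Omega> (?U3 \<union> ?U4)"
    by (rule measure_Un_le) measurable
  also have "measure \<Omega> (?U3 \<union> ?U4) \<le> measure \<Omega> ?U3 + measure \<Omega> ?U4"
    by (rule measure_Un_le) measurable
  also have "measure \<Omega> S1 \<le> 1 / 4" unfolding S1_def by (rule prob_on_track_last)
  also have "measure \<Omega> ?U2 \<le> (\<Sum>j<J. measure \<Omega> (S2 j))" by (rule measure_UNION_le) auto
  also have "(\<Sum>j<J. measure \<Omega> (S2 j)) \<le> (\<Sum>j<J. fail_prob)"
    unfolding S2_def by (intro sum_mono prob_nc_bad)
  also have "(\<Sum>j<J. fail_prob) = 1 / 16" using last_round_pos by simp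
  also have "measure \<Omega> ?U3 \<le> (\<Sum>j<J. measure \<Omega> (S3 j))" by (rule measure_UNION_le) auto
  also have "(\<Sum>j<J. measure \<Omega> (S3 j)) = 0" unfolding S3_def by (simp only: prob_sign_bad sum.neutral_const)
  also have "measure \<Omega> ?U4 \<le> (\<Sum>k<J * T. measure \<Omega> (S4 k))" by (rule measure_UNION_le) auto
  also have "(\<Sum>k<J * T. measure \<Omega> (S4 k)) \<le> (\<Sum>k<J * T. p)"
    unfolding S4_def p_def by (intro sum_mono prob_estimate_bad)
  also have "(\<Sum>k<J * T. p) \<le> 1 / 16" using small_tail by (simp add: p_def)
  finally show ?thesis by (simp add: G_def)
qed

end

section \<open>Counting gradients\<close>

lemma card_multiples_le:
  assumes "0 < m"
  shows "real (card {k. k < N \<and> k mod m = 0}) \<le> real N / real m + 1"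
proof -
  have "{k. k < N \<and> k mod m = 0} \<subseteq> (\<lambda>i. i * m) ` {..N div m}"
  proof
    fix k assume "k \<in> {k. k < N \<and> k mod m = 0}"
    hence "k < N" "k = k div m * m" using div_mult_mod_eq[of k m] by auto
    thus "k \<in> (\<lambda>i. i * m) ` {..N div m}" using div_le_mono[of k N m] by (intro image_eqI[of _ _ "k div m"]) auto
  qed
  hence "card {k. k < N \<and> k mod m = 0} \<le> card {..N div m}"
    by (intro order_trans[OF card_mono card_image_le]) auto
  hence "real (card {k. k < N \<and> k mod m = 0}) \<le> real (N div m) + 1" by simp
  also have "real (N div m) \<le> real N / real m"
  proof -
    have "real (N div m * m) \<le> real N" by (intro of_nat_mono div_times_less_eq_dividend)
    thus ?thesis using assms by (simp add: pos_le_divide_eq)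
  qed
  finally show ?thesis by simp
qed

lemma sum_multiples_le:
  assumes "0 < m" "0 \<le> c"
  shows "(\<Sum>k<N. if k mod m = 0 then c else 0) \<le> (real N / real m + 1) * c"
proof -
  have "(\<Sum>k<N. if k mod m = 0 then c else 0) = real (card {k. k < N \<and> k mod m = 0}) * c"
    by (subst sum.inter_filter[symmetric]) (auto simp: lessThan_def Collect_conj_eq)
  also have "\<dots> \<le> (real N / real m + 1) * c"
    by (intro mult_right_mono card_multiples_le assms)
  finally show ?thesis .
qed

context spider_run
begin

lemma spent_le: "spent (st \<omega> N) \<le> (\<Sum>k<N. iteration_cost \<omega> k)"
proof (induction N)
  case (Suc N)
  show ?case
  proof (cases "is_running (st \<omega> N)")
    case True
    hence "spent (st \<omega> (Suc N)) = spent (st \<omega> N) + iteration_cost \<omega> N"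
      using st_Suc[OF True] by (auto split: option.split)
    thus ?thesis using Suc.IH by simp
  next
    case False
    thus ?thesis using Suc.IH st_Suc_returned[OF False] by simp
  qed
qed simp

definition nc_budget :: real where
  "nc_budget = C * (ln (real CARD('n) / fail_prob))\<^sup>2 * L\<^sup>2 / (2 * \<delta>)\<^sup>2"

lemma nc_budget_nonneg: "0 \<le> nc_budget"
  unfolding nc_budget_def using C_nonneg by simp

text \<open>Of the \<open>(J + 1) T\<close> iterations, at most \<open>J + 2\<close> start a round and at most \<open>(J + 1) T / q + 1\<close> anchor.
  Charging every iteration for a batch is good enough.\<close>
lemma total_cost_le:
  assumes "\<omega> \<in> space \<Omega>"
  shows "real (spent (st \<omega> ((J + 1) * T)))
    \<le> (real J + 2) * nc_budget + (real (J + 1) * real T / real q + 1) * real (anchor_cost P)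
      + real (J + 1) * real T * real (batch P)"
proof -
  let ?N = "(J + 1) * T"
  have each: "real (iteration_cost \<omega> k) \<le> (if k mod T = 0 then nc_budget else 0)
      + (if k mod q = 0 then real (anchor_cost P) else 0) + real (batch P)" for k
  proof -
    have "real (cost (position (st \<omega> k)) (2 * \<delta>) fail_prob (fst (snd \<omega>) (k div T))) \<le> nc_budget"
      unfolding nc_budget_def by (rule nc_cost_le[OF measurable_space[OF measurable_nc_seed assms]])
    thus ?thesis using nc_budget_nonneg by (auto simp: iteration_cost_def)
  qed
  have "real (spent (st \<omega> ?N)) \<le> real (\<Sum>k<?N. iteration_cost \<omega> k)"
    by (intro of_nat_mono spent_le)
  also have "\<dots> \<le> (\<Sum>k<?N. (if k mod T = 0 then nc_budget else 0)
      + (if k mod q = 0 then real (anchor_cost P) else 0) + real (batch P))"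
    unfolding of_nat_sum by (intro sum_mono each)
  also have "\<dots> = (\<Sum>k<?N. if k mod T = 0 then nc_budget else 0)
      + (\<Sum>k<?N. if k mod q = 0 then real (anchor_cost P) else 0) + real ?N * real (batch P)"
    by (simp only: sum.distrib sum_constant card_lessThan)
  also have "\<dots> \<le> (real ?N / real T + 1) * nc_budget
      + (real ?N / real q + 1) * real (anchor_cost P) + real ?N * real (batch P)"
    by (intro add_mono order_refl sum_multiples_le round_length_pos period_pos nc_budget_nonneg) auto
  also have "real ?N / real T + 1 = real J + 2"
    using round_length_pos by (simp add: add_divide_distrib)
  finally show ?thesis by (simp only: of_nat_mult)
qed

lemma returns_stationary_iff:
  assumes "real (spent (st \<omega> ((J + 1) * T))) \<le> B"
  shows "returns_stationary F e1 e2 J K0 B (spider_sfo_plus P f nc cost x0 \<omega>) \<longleftrightarrow>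
    (\<exists>k<(J + 1) * T. halts \<omega> k \<and> real k \<le> K0 \<and> norm (grad F (position (st \<omega> k))) \<le> e1 \<and>
      - e2 \<le> lambda_min (hess F (position (st \<omega> k))))" (is "?lhs \<longleftrightarrow> ?rhs")
proof
  let ?N = "(J + 1) * T"
  assume ?lhs
  then obtain j k x c where out: "st \<omega> ?N = Returned j k x c" and k: "real k \<le> K0"
    "norm (grad F x) \<le> e1" "- e2 \<le> lambda_min (hess F x)"
    unfolding returns_stationary_def spider_sfo_plus_def by auto
  then obtain i where i: "i < ?N" "halts \<omega> i" using ex_halts[of \<omega> ?N] by auto
  from st_after_halt[OF i(2,1)] out have "i = k" "x = position (st \<omega> k)" by auto
  thus ?rhs using i k by blast
next
  let ?N = "(J + 1) * T"
  assume ?rhs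
  then obtain k where k: "k < ?N" "halts \<omega> k" "real k \<le> K0"
    "norm (grad F (position (st \<omega> k))) \<le> e1" "- e2 \<le> lambda_min (hess F (position (st \<omega> k)))" by blast
  have "k div T < J + 1" using k(1) round_length_pos by (simp add: div_less_iff_less_mult)
  thus ?lhs
    unfolding returns_stationary_def spider_sfo_plus_def
    using k st_after_halt[OF k(2,1)] assms by (metis Suc_eq_plus1 less_Suc_eq_le)
qed

end

context tuned_spider_run
begin

text \<open>As the bound on the cost holds surely, it can be removed from the event, and what is left is
  measurable.\<close>
lemma prob_returns_stationary:
  assumes B: "(real J + 2) * nc_budget + (real (J + 1) * real T / real q + 1) * real (anchor_cost P)
      + real (J + 1) * real T * real (batch P) \<le> B"
    and K0: "real J * real T \<le> K0"
  shows "\<P>(\<omega> in \<Omega>. returns_stationary F (3 * tol P) (3 * \<delta>) J K0 B (spider_sfo_plus P f nc cost x0 \<omega>))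
    \<ge> 1 / 2"
proof -
  define E where "E = {\<omega> \<in> space \<Omega>. returns_stationary F (3 * tol P) (3 * \<delta>) J K0 B
    (spider_sfo_plus P f nc cost x0 \<omega>)}"
  have E: "E = {\<omega> \<in> space \<Omega>. \<exists>k<(J + 1) * T. halts \<omega> k \<and> real k \<le> K0 \<and> accurate (position (st \<omega> k))}"
    unfolding E_def accurate_def using returns_stationary_iff[OF order_trans[OF total_cost_le B]] by blast
  have "E \<in> sets \<Omega>" unfolding E by measurable
  moreover have "{\<omega> \<in> space \<Omega>. \<exists>k<J * T. halts \<omega> k \<and> accurate (position (st \<omega> k))} \<subseteq> E"
  proof
    fix \<omega> assume "\<omega> \<in> {\<omega> \<in> space \<Omega>. \<exists>k<J * T. halts \<omega> k \<and> accurate (position (st \<omega> k))}"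
    then obtain k where k: "\<omega> \<in> space \<Omega>" "k < J * T" "halts \<omega> k" "accurate (position (st \<omega> k))" by blast
    have "real k \<le> real (J * T)" using k(2) by (intro of_nat_mono less_imp_le)
    hence "real k \<le> K0" "k < (J + 1) * T" using K0 k(2) by auto
    thus "\<omega> \<in> E" unfolding E using k by blast
  qed
  ultimately have "\<P>(\<omega> in \<Omega>. \<exists>k<J * T. halts \<omega> k \<and> accurate (position (st \<omega> k))) \<le> measure \<Omega> E"
    by (intro \<Omega>.finite_measure_mono)
  thus ?thesis using prob_success unfolding E_def by linarith
qed

end

section \<open>The chosen parameters\<close>

lemma exp_ge_abs_ln: "0 < x \<Longrightarrow> x \<le> exp \<bar>ln x\<bar>" "0 < x \<Longrightarrow> 1 / x \<le> exp \<bar>ln (x :: real)\<bar>"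
proof -
  assume x: "0 < x"
  have "x = exp (ln x)" using x by simp
  also have "\<dots> \<le> exp \<bar>ln x\<bar>" by (subst exp_le_cancel_iff) simp
  finally show "x \<le> exp \<bar>ln x\<bar>" .
  have "1 / x = exp (- ln x)" using x by (simp add: exp_minus inverse_eq_divide)
  also have "\<dots> \<le> exp \<bar>ln x\<bar>" by (subst exp_le_cancel_iff) simp
  finally show "1 / x \<le> exp \<bar>ln x\<bar>" .
qed

text \<open>The number of rounds is a rational expression in the parameters, so its logarithm grows at
  most linearly in their logarithms. This is where the poly-logarithmic factors come from.\<close>
lemma number_of_rounds:
  fixes \<Delta> \<rho> \<delta> \<epsilon> :: real
  assumes pos: "0 \<le> \<Delta>" "0 < \<rho>" "0 < \<delta>" "0 < \<epsilon>"
    and M: "M = nat \<lfloor>max (3 * \<rho>\<^sup>2 * \<Delta> / \<delta>^3) (4 * \<Delta> * \<rho> / (\<delta> * \<epsilon>))\<rfloor>"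
  shows "3 * \<rho>\<^sup>2 * \<Delta> / \<delta>^3 \<le> real M + 1" "4 * \<Delta> * \<rho> / (\<delta> * \<epsilon>) \<le> real M + 1"
    and "real M \<le> 3 * \<rho>\<^sup>2 * \<Delta> / \<delta>^3 + 4 * \<Delta> * \<rho> / (\<delta> * \<epsilon>)"
    and "ln (real M + 1) \<le> 3 + 3 * (\<bar>ln \<rho>\<bar> + \<bar>ln \<delta>\<bar> + \<bar>ln \<epsilon>\<bar> + \<bar>ln (1 + \<Delta>)\<bar>)"
proof -
  define a where "a = 3 * \<rho>\<^sup>2 * \<Delta> / \<delta>^3"
  define b where "b = 4 * \<Delta> * \<rho> / (\<delta> * \<epsilon>)"
  have ab: "0 \<le> a" "0 \<le> b" using pos by (auto simp: a_def b_def)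
  have "real M = of_int \<lfloor>max a b\<rfloor>" using ab by (simp add: M a_def[symmetric] b_def[symmetric])
  hence M: "max a b \<le> real M + 1" "real M \<le> max a b" by linarith+
  thus "3 * \<rho>\<^sup>2 * \<Delta> / \<delta>^3 \<le> real M + 1" "4 * \<Delta> * \<rho> / (\<delta> * \<epsilon>) \<le> real M + 1"
    by (simp_all add: a_def b_def)
  show sum: "real M \<le> 3 * \<rho>\<^sup>2 * \<Delta> / \<delta>^3 + 4 * \<Delta> * \<rho> / (\<delta> * \<epsilon>)"
    using M(2) ab by (simp add: a_def[symmetric] b_def[symmetric] max_def split: if_splits)
  define r d e D where "r = \<bar>ln \<rho>\<bar>" and "d = \<bar>ln \<delta>\<bar>" and "e = \<bar>ln \<epsilon>\<bar>" and "D = \<bar>ln (1 + \<Delta>)\<bar>"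
  note defs = r_def d_def e_def D_def
  have nn: "0 \<le> r" "0 \<le> d" "0 \<le> e" "0 \<le> D" by (auto simp: defs)
  have up: "\<rho> \<le> exp r" "1 / \<delta> \<le> exp d" "1 / \<epsilon> \<le> exp e" "\<Delta> \<le> exp D"
    using exp_ge_abs_ln(1)[of \<rho>] exp_ge_abs_ln(2)[of \<delta>] exp_ge_abs_ln(2)[of \<epsilon>] exp_ge_abs_ln(1)[of "1 + \<Delta>"] pos
    by (auto simp: defs)
  let ?S = "r + d + e + D"
  have "a = 3 * (\<rho>\<^sup>2 * \<Delta> * (1 / \<delta>)^3)" by (simp add: a_def power_divide)
  also have "\<dots> \<le> 3 * ((exp r)\<^sup>2 * exp D * (exp d)^3)"
    using up pos by (intro mult_left_mono mult_mono power_mono) auto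
  also have "\<dots> = 3 * exp (2 * r + D + 3 * d)"
    using exp_of_nat_mult[of 2 r] exp_of_nat_mult[of 3 d] by (simp add: exp_add)
  also have "\<dots> \<le> 3 * exp (3 * ?S)" using nn by simp
  finally have a: "a \<le> 3 * exp (3 * ?S)" .
  have "b = 4 * (\<Delta> * \<rho> * (1 / \<delta>) * (1 / \<epsilon>))" by (simp add: b_def)
  also have "\<dots> \<le> 4 * (exp D * exp r * exp d * exp e)"
    using up pos by (intro mult_left_mono mult_mono) auto
  also have "\<dots> = 4 * exp (D + r + d + e)" by (simp add: exp_add)
  also have "\<dots> \<le> 4 * exp (3 * ?S)" using nn by simp
  finally have b: "b \<le> 4 * exp (3 * ?S)" .
  have "real M + 1 \<le> 8 * exp (3 * ?S)"
  proof -
    have "1 \<le> exp (3 * ?S)" using nn by simp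
    thus ?thesis using a b sum unfolding a_def[symmetric] b_def[symmetric] by linarith
  qed
  also have "8 * exp (3 * ?S) \<le> exp 3 * exp (3 * ?S)"
  proof -
    have "(2::real)^3 \<le> (exp 1)^3" using exp_ge_add_one_self[of 1] by (intro power_mono) auto
    thus ?thesis using exp_of_nat_mult[of 3 "1 :: real"] by simp
  qed
  also have "\<dots> = exp (3 + 3 * ?S)" by (simp add: exp_add)
  finally have "ln (real M + 1) \<le> ln (exp (3 + 3 * ?S))" by (subst ln_le_cancel_iff) auto
  thus "ln (real M + 1) \<le> 3 + 3 * (\<bar>ln \<rho>\<bar> + \<bar>ln \<delta>\<bar> + \<bar>ln \<epsilon>\<bar> + \<bar>ln (1 + \<Delta>)\<bar>)" by (simp add: defs)
qed

context smooth_objective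
begin

lemma measurable_batch_anchor:
  "(\<lambda>(\<xi>, x). batch_grad f S (\<lambda>l. \<xi> (k, l)) x)
    \<in> borel_measurable ((\<Pi>\<^sub>M (_::nat \<times> nat)\<in>UNIV. D) \<Otimes>\<^sub>M borel)"
  unfolding case_prod_beta' by (intro measurable_batch_grad) measurable

lemma batch_anchor_moment:
  assumes noise: "gradient_noise_bounded D f \<sigma>" and "0 \<le> \<sigma>" "0 < S" "0 < \<epsilon>"
  shows "(\<integral>\<^sup>+\<xi>. ennreal (exp_pot ((batch_grad f S (\<lambda>l. \<xi> (k, l)) x - grad F x) /\<^sub>R \<epsilon>))
      \<partial>(\<Pi>\<^sub>M (_::nat \<times> nat)\<in>UNIV. D)) \<le> ennreal (exp (1 + \<sigma>\<^sup>2 / (real S * \<epsilon>\<^sup>2)))"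
proof -
  have "norm (grad (f i) x - grad F x) \<le> \<sigma>" if "i \<in> space D" for i
    using noise that \<open>0 \<le> \<sigma>\<close> unfolding gradient_noise_bounded_def by (blast intro: power2_le_imp_le)
  hence "(\<integral>\<^sup>+\<xi>. ennreal (exp_pot (0 + (batch_grad f S (\<lambda>l. \<xi> (k, l)) x - grad F x) /\<^sub>R \<epsilon>))
      \<partial>(\<Pi>\<^sub>M (_::nat \<times> nat)\<in>UNIV. D)) \<le> ennreal (exp (\<sigma>\<^sup>2 / (real S * \<epsilon>\<^sup>2)) * exp_pot (0::real^'n))"
    using D.nn_integral_exp_pot_average[OF integrable_grad_component[of x],
        where c = "\<lambda>l. (k, l)" and b = \<sigma> and S = S and \<epsilon> = \<epsilon> and x = 0] assms(3,4)
    unfolding batch_grad_def expectation_grad_component by (simp add: inj_def)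
  also have "\<dots> = ennreal (exp (1 + \<sigma>\<^sup>2 / (real S * \<epsilon>\<^sup>2)))"
    by (simp add: exp_pot_def add.commute flip: exp_add)
  finally show ?thesis by simp
qed

end

lemma ln_two_power_le: "ln (2 ^ k :: real) \<le> real k"
proof -
  have "ln (2::real) \<le> 1" using ln_add_one_self_le_self[of "1::real"] by simp
  thus ?thesis by (simp add: ln_realpow mult_left_le)
qed

lemma ln_ge_one: "0 \<le> t \<Longrightarrow> 1 \<le> ln (256 * (real M + 1) * t + 64)"
proof -
  assume "0 \<le> t"
  hence "3 \<le> 256 * (real M + 1) * t + 64" by simp
  thus ?thesis using exp_le by (subst ln_ge_iff) linarith+
qed

text \<open>
  The parameters of the theorem. Both cases are instances, with \<open>s = 2 \<sigma> / \<epsilon>\<close> on-line and \<open>s = \<surd>n\<close> for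
  finite sums. A batch of \<open>s / n0\<close> samples makes the variance of an increment \<open>4 / (n0 s)\<close>, and a period of
  such increments together with the anchor contributes at most \<open>4\<close> to the exponent of the moment.
\<close>
locale sfo_parameters = spider_run D f L \<rho> R nc cost C x0 P \<epsilon> A
  for D :: "'i measure" and f :: "'i \<Rightarrow> real^'n \<Rightarrow> real" and L \<rho> :: real
    and R :: "'r measure" and nc cost C x0 P \<epsilon> A +
  fixes \<Delta> n0 s c :: real and M :: nat
  assumes bdd: "bdd_below (range F)" and Delta: "\<Delta> = F x0 - (INF x. F x)"
    and M: "M = nat \<lfloor>max (3 * \<rho>\<^sup>2 * \<Delta> / \<delta>^3) (4 * \<Delta> * \<rho> / (\<delta> * \<epsilon>))\<rfloor>"
    and J: "J = 4 * M + 4" and T: "real T = \<delta> * L * n0 / (\<rho> * \<epsilon>)" and eta: "\<eta> = \<epsilon> / (L * n0)"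
    and n0: "1 \<le> n0" "n0 \<le> s" and c: "10 \<le> c" "c \<le> 16"
    and batch: "real (batch P) = s / n0"
    and period: "A + real q * (4 / (n0 * s)) \<le> 4" "real (anchor_cost P) / real q = s / n0"
    and tol: "tol P = c * \<epsilon> * ln (256 * (real M + 1) * real T + 64)"
begin

lemmas pos = L_pos rho_pos eps_pos curvature_pos

lemma s_pos: "0 < s"
  using n0 by linarith

lemma Delta_nonneg: "0 \<le> \<Delta>"
  using cINF_lower[OF bdd, of x0] by (simp add: Delta)

lemmas M_facts = number_of_rounds[OF Delta_nonneg rho_pos curvature_pos eps_pos M]

lemma J_real: "real J = 4 * (real M + 1)"
  by (simp add: J)

lemma eps_le_tol: "\<epsilon> \<le> tol P"
proof -
  have "1 * \<epsilon> * 1 \<le> c * \<epsilon> * ln (256 * (real M + 1) * real T + 64)"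
    using c eps_pos by (intro mult_mono ln_ge_one) auto
  thus ?thesis by (simp add: tol)
qed

sublocale tuned_spider_run
proof
  define \<Lambda> where "\<Lambda> = 256 * (real M + 1) * real T + 64"
  have \<Lambda>: "64 \<le> \<Lambda>" "1 \<le> ln \<Lambda>" using ln_ge_one by (auto simp: \<Lambda>_def)
  show "bdd_below (range F)" by (rule bdd)
  show "real T * \<eta> = \<delta> / \<rho>"
    using pos n0 by (simp add: T eta)
  have "L * \<eta> = \<epsilon> / n0" using pos n0 by (simp add: eta)
  also have "\<dots> \<le> \<epsilon>" using pos n0 by (simp add: divide_le_eq mult_le_cancel_left1)
  finally show "L * \<eta> \<le> tol P" using eps_le_tol by simp
  have "\<Delta> \<le> (real M + 1) * (\<delta>^3 / (3 * \<rho>\<^sup>2))"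
    using M_facts(1) pos by (simp add: divide_simps mult_ac)
  moreover have "\<Delta> \<le> (real M + 1) * (\<delta> * tol P / (2 * \<rho>))"
  proof -
    have "\<Delta> \<le> (real M + 1) * (\<delta> * \<epsilon> / (4 * \<rho>))"
      using M_facts(2) pos by (simp add: divide_simps mult_ac)
    also have "\<delta> * \<epsilon> / (4 * \<rho>) \<le> \<delta> * tol P / (2 * \<rho>)"
      using eps_le_tol pos by (simp add: divide_simps)
    finally show ?thesis by (simp add: mult_left_mono)
  qed
  ultimately have "\<Delta> \<le> (real M + 1) * min (\<delta>^3 / (3 * \<rho>\<^sup>2)) (\<delta> * tol P / (2 * \<rho>))"
    by (simp add: min_def)
  thus "4 * (F x0 - (INF x. F x)) \<le> real J * min (\<delta>^3 / (3 * \<rho>\<^sup>2)) (\<delta> * tol P / (2 * \<rho>))"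
    by (simp only: Delta[symmetric] J_real mult.assoc mult_le_cancel_left_pos zero_less_numeral)
  have incr: "increment_variance = 4 / (n0 * s)"
    unfolding increment_variance_def using pos n0 s_pos
    by (simp add: eta batch field_simps power2_eq_square)
  \<comment> \<open>The tail at tolerance \<open>c \<epsilon> ln \<Lambda>\<close> is \<open>exp (5 - c ln \<Lambda>)\<close>. As \<open>ln \<Lambda> \<ge> 1\<close> and \<open>c \<ge> 10\<close>, one
    of the \<open>c\<close> logarithms beats the number of iterations, and the others absorb the \<open>5\<close>.\<close>
  have "1 + A + real q * increment_variance - tol P / \<epsilon> \<le> 5 - c * ln \<Lambda>"
    using period(1) pos by (simp add: tol \<Lambda>_def incr)
  also have "\<dots> \<le> - ln \<Lambda>"
  proof -
    have "9 * 1 \<le> (c - 1) * ln \<Lambda>" using c \<Lambda> by (intro mult_mono) auto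
    thus ?thesis by (simp add: algebra_simps)
  qed
  finally have "exp (1 + A + real q * increment_variance - tol P / \<epsilon>) \<le> exp (- ln \<Lambda>)" by simp
  also have "\<dots> = 1 / \<Lambda>" using \<Lambda> by (simp add: exp_minus inverse_eq_divide)
  finally have "real J * real T * exp (1 + A + real q * increment_variance - tol P / \<epsilon>)
      \<le> real J * real T * (1 / \<Lambda>)" by (intro mult_left_mono) auto
  also have "\<dots> \<le> 1 / 16"
  proof -
    have "64 * (real J * real T) \<le> \<Lambda>" unfolding \<Lambda>_def J_real by (simp add: algebra_simps)
    moreover have "0 \<le> real J * real T" by simp
    ultimately have "16 * (real J * real T) \<le> \<Lambda>" by linarith
    thus ?thesis using \<Lambda> by (simp add: divide_simps)
  qed
  finally show "real J * real T * exp (1 + A + real q * increment_variance - tol P / \<epsilon>) \<le> 1 / 16" .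
qed

definition monomials :: real where
  "monomials = \<Delta> * L * s / \<epsilon>\<^sup>2 + \<Delta> * \<rho> * L * s / (\<epsilon> * \<delta>\<^sup>2) +
      \<Delta> * L\<^sup>2 * \<rho>\<^sup>2 / \<delta>^5 + \<Delta> * L\<^sup>2 * \<rho> / (\<epsilon> * \<delta>^3) + real (anchor_cost P) + L\<^sup>2 / \<delta>\<^sup>2 + L * s * \<delta> / (\<rho> * \<epsilon>)"

lemma monomials_nonneg: "0 \<le> monomials"
  unfolding monomials_def using pos s_pos Delta_nonneg by (intro add_nonneg_nonneg) auto

text \<open>The square of \<open>1 + S\<close> is the poly-logarithmic factor. The bound on \<open>ln s\<close> is separate because \<open>s\<close>
  stands for a different expression in either case; it is needed as \<open>n0\<close>, and with it \<open>T\<close>, is only bounded by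
  \<open>s\<close>.\<close>
context
  fixes d S :: real
  assumes d: "d = real CARD('n)"
    and S: "\<bar>ln d\<bar> + \<bar>ln L\<bar> + \<bar>ln \<rho>\<bar> + \<bar>ln \<delta>\<bar> + \<bar>ln \<epsilon>\<bar> + \<bar>ln (1 + \<Delta>)\<bar> \<le> S" and ln_s: "\<bar>ln s\<bar> \<le> 1 + S"
begin

lemma S_nonneg: "0 \<le> S"
  using S by linarith

lemma tolerance_le: "tol P \<le> 1000 * (1 + S)\<^sup>2 * \<epsilon>"
proof -
  let ?t = "real T"
  have t: "1 \<le> ?t" using round_length_pos by simp
  have "?t \<le> \<delta> * L * s / (\<rho> * \<epsilon>)"
    unfolding T using pos n0 by (intro divide_right_mono mult_left_mono) auto
  hence "ln ?t \<le> ln (\<delta> * L * s / (\<rho> * \<epsilon>))" using t pos s_pos by (subst ln_le_cancel_iff) auto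
  also have "\<dots> = ln \<delta> + ln L + ln s - (ln \<rho> + ln \<epsilon>)"
    using pos s_pos by (simp add: ln_div ln_mult)
  finally have ln_t: "ln ?t \<le> 1 + 2 * S" using S ln_s by linarith
  have "1 * 1 \<le> (real M + 1) * ?t" using t by (intro mult_mono) auto
  moreover have "256 * (real M + 1) * ?t + 64 = 256 * ((real M + 1) * ?t) + 64" by (simp only: mult.assoc)
  moreover have "256 * y + 64 \<le> 2 ^ 9 * y" if "1 * 1 \<le> y" for y :: real using that by simp
  ultimately have "256 * (real M + 1) * ?t + 64 \<le> 2 ^ 9 * ((real M + 1) * ?t)" by metis
  hence "ln (256 * (real M + 1) * ?t + 64) \<le> ln (2 ^ 9 * ((real M + 1) * ?t))"
    using t by (subst ln_le_cancel_iff) (auto intro!: add_nonneg_pos mult_pos_pos)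
  also have "\<dots> = ln (2 ^ 9) + (ln (real M + 1) + ln ?t)"
    using t by (subst ln_mult; (subst ln_mult)?) (auto simp: ln_mult)
  also have "\<dots> \<le> 13 * (1 + S)"
    using ln_two_power_le[of 9] M_facts(4) ln_t S S_nonneg by simp linarith
  finally have "c * \<epsilon> * ln (256 * (real M + 1) * ?t + 64) \<le> 16 * \<epsilon> * (13 * (1 + S))"
    using pos c S_nonneg ln_ge_one[of ?t M] by (intro mult_mono) auto
  also have "\<dots> = 208 * \<epsilon> * ((1 + S) * 1)" by simp
  also have "\<dots> \<le> 1000 * \<epsilon> * ((1 + S) * (1 + S))"
    using pos S_nonneg by (intro mult_mono) auto
  finally show ?thesis by (simp add: tol power2_eq_square mult_ac)
qed

text \<open>
  By the choice of the batch and of the period, \<open>T\<close> iterations cost \<open>L s \<delta> / (\<rho> \<epsilon>)\<close> gradients for the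
  batches and as many for the anchors. The two terms in the bound for \<open>M\<close> turn \<open>M\<close> times this quantity, and
  \<open>M\<close> times \<open>L\<^sup>2 / \<delta>\<^sup>2\<close> for the NC-searches, into the first four monomials; the summands without \<open>M\<close>
  give the last three.
\<close>
lemma gradient_cost_le:
  "(real J + 2) * nc_budget + (real (J + 1) * real T / real q + 1) * real (anchor_cost P)
      + real (J + 1) * real T * real (batch P)
    \<le> 400 * (1 + C) * (1 + S)\<^sup>2 * monomials"
proof -
  define Q where "Q = (1 + S)\<^sup>2"
  define a where "a = real (anchor_cost P)"
  define t1 t2 t3 t4 t6 X where "t1 = \<Delta> * L * s / \<epsilon>\<^sup>2" and "t2 = \<Delta> * \<rho> * L * s / (\<epsilon> * \<delta>\<^sup>2)"
    and "t3 = \<Delta> * L\<^sup>2 * \<rho>\<^sup>2 / \<delta>^5" and "t4 = \<Delta> * L\<^sup>2 * \<rho> / (\<epsilon> * \<delta>^3)"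
    and "t6 = L\<^sup>2 / \<delta>\<^sup>2" and "X = L * s * \<delta> / (\<rho> * \<epsilon>)"
  note t_defs = t1_def t2_def t3_def t4_def t6_def X_def
  have U: "monomials = t1 + t2 + t3 + t4 + a + t6 + X" by (simp add: monomials_def t_defs a_def)
  have nn: "0 \<le> t1" "0 \<le> t2" "0 \<le> t3" "0 \<le> t4" "0 \<le> t6" "0 \<le> X" "0 \<le> a"
    using pos Delta_nonneg s_pos by (auto simp: t_defs a_def)
  have Q: "1 \<le> Q" using S_nonneg by (simp add: Q_def one_le_power)
  have TX: "real T * real (batch P) = X" "real T / real q * a = X"
  proof -
    show "real T * real (batch P) = X" using pos n0 by (simp add: T batch X_def mult_ac)
    have "real T / real q * a = real T * (a / real q)" by simp
    thus "real T / real q * a = X" using pos n0 period(2) by (simp add: T a_def X_def mult_ac)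
  qed
  have MX: "real M * X \<le> 3 * t2 + 4 * t1"
  proof -
    have "real M * X \<le> (3 * \<rho>\<^sup>2 * \<Delta> / \<delta>^3 + 4 * \<Delta> * \<rho> / (\<delta> * \<epsilon>)) * X"
      using M_facts(3) nn by (intro mult_right_mono) auto
    also have "\<dots> = 3 * t2 + 4 * t1"
      using pos by (simp add: t_defs field_simps power2_eq_square power3_eq_cube)
    finally show ?thesis .
  qed
  have Mt6: "real M * t6 \<le> 3 * t3 + 4 * t4"
  proof -
    have "real M * t6 \<le> (3 * \<rho>\<^sup>2 * \<Delta> / \<delta>^3 + 4 * \<Delta> * \<rho> / (\<delta> * \<epsilon>)) * t6"
      using M_facts(3) nn by (intro mult_right_mono) auto
    also have "\<dots> = 3 * t3 + 4 * t4"
      using pos by (simp add: t_defs field_simps power2_eq_square power3_eq_cube eval_nat_numeral)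
    finally show ?thesis .
  qed
  define l where "l = ln (d / fail_prob)"
  have l: "0 \<le> l" "l \<le> 9 * (1 + S)"
  proof -
    have d1: "1 \<le> d" by (simp add: d Suc_leI)
    have eq: "d / fail_prob = 2 ^ 6 * ((real M + 1) * d)" by (simp add: J_real)
    have "1 * 1 \<le> (real M + 1) * d" using d1 by (intro mult_mono) auto
    thus "0 \<le> l" unfolding l_def eq by (intro ln_ge_zero) simp
    have "l = ln (2 ^ 6) + (ln (real M + 1) + ln d)"
      unfolding l_def eq using d1 by (subst ln_mult; (subst ln_mult)?) (auto simp: ln_mult)
    thus "l \<le> 9 * (1 + S)" using ln_two_power_le[of 6] M_facts(4) S S_nonneg by simp linarith
  qed
  have lQ: "l\<^sup>2 \<le> 81 * Q"
  proof -
    have "l\<^sup>2 \<le> (9 * (1 + S))\<^sup>2" using l by (intro power_mono)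
    also have "(9 * (1 + S))\<^sup>2 = 81 * Q" unfolding Q_def power_mult_distrib by simp
    finally show ?thesis .
  qed
  have nc: "(real J + 2) * nc_budget \<le> 400 * (C * Q * (t3 + t4 + t6))"
  proof -
    have "(real J + 2) * nc_budget = (C * l\<^sup>2) * (real M * t6 + 3 / 2 * t6)"
      unfolding nc_budget_def d[symmetric] l_def[symmetric]
      using pos by (simp add: J_real t6_def field_simps power2_eq_square)
    also have "\<dots> \<le> (C * (81 * Q)) * (4 * (t3 + t4 + t6))"
      using C_nonneg lQ Mt6 nn Q by (intro mult_mono mult_left_mono) auto
    also have "\<dots> = 324 * (C * Q * (t3 + t4 + t6))" by (simp add: algebra_simps)
    also have "\<dots> \<le> 400 * (C * Q * (t3 + t4 + t6))"
      using C_nonneg Q nn by (intro mult_right_mono) auto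
    finally show ?thesis .
  qed
  have est: "(real (J + 1) * real T / real q + 1) * a + real (J + 1) * real T * real (batch P)
      \<le> 400 * (Q * (t1 + t2 + a + X))"
  proof -
    have "(real (J + 1) * real T / real q + 1) * a + real (J + 1) * real T * real (batch P)
        = real (J + 1) * (real T / real q * a) + a + real (J + 1) * (real T * real (batch P))"
      by (simp add: algebra_simps)
    also have "\<dots> = 8 * (real M * X) + 10 * X + a" by (simp only: TX) (simp add: J algebra_simps)
    also have "\<dots> \<le> 400 * (t1 + t2 + a + X)" using MX nn by simp
    also have "\<dots> = 400 * (1 * (t1 + t2 + a + X))" by simp
    also have "\<dots> \<le> 400 * (Q * (t1 + t2 + a + X))"
      using Q nn by (intro mult_left_mono mult_right_mono) auto
    finally show ?thesis .
  qed
  have "C * Q * (t3 + t4 + t6) \<le> C * Q * monomials"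
    unfolding U using C_nonneg Q nn by (intro mult_left_mono) auto
  moreover have "Q * (t1 + t2 + a + X) \<le> Q * monomials"
    unfolding U using Q nn by (intro mult_left_mono) auto
  ultimately have "(real J + 2) * nc_budget + ((real (J + 1) * real T / real q + 1) * a
      + real (J + 1) * real T * real (batch P)) \<le> 400 * (C * Q * monomials) + 400 * (Q * monomials)"
    using nc est by linarith
  also have "\<dots> = 400 * (1 + C) * Q * monomials" by (simp add: algebra_simps)
  finally show ?thesis by (simp add: a_def Q_def add.assoc)
qed

text \<open>The slack \<open>5 / 2 = 1000 / 400\<close> pays for the factor \<open>2\<close> in \<open>s = 2 \<sigma> / \<epsilon>\<close>.\<close>
lemma spider_sfo_plus_guarantee:
  assumes B: "monomials \<le> 5 / 2 * B" and K0: "K0 = (4 * real M + 4) * (L * n0 * \<delta> / (\<rho> * \<epsilon>))"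
  shows "tol P \<le> 1000 * (1 + S)\<^sup>2 * \<epsilon> \<and>
    \<P>(\<omega> in sfo_space D R. returns_stationary F (3 * tol P) (3 * \<delta>) J K0
        (1000 * (1 + C) * (1 + S)\<^sup>2 * B) (spider_sfo_plus P f nc cost x0 \<omega>)) \<ge> 1 / 2"
proof (intro conjI tolerance_le prob_returns_stationary)
  show "real J * real T \<le> K0" by (simp add: K0 J T mult_ac)
  have "400 * (1 + C) * (1 + S)\<^sup>2 * monomials \<le> 400 * (1 + C) * (1 + S)\<^sup>2 * (5 / 2 * B)"
    using C_nonneg by (intro mult_left_mono B) auto
  also have "\<dots> = 1000 * (1 + C) * (1 + S)\<^sup>2 * B" by (simp add: algebra_simps)
  finally show "(real J + 2) * nc_budget + (real (J + 1) * real T / real q + 1) * real (anchor_cost P)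
      + real (J + 1) * real T * real (batch P) \<le> 1000 * (1 + C) * (1 + S)\<^sup>2 * B"
    using gradient_cost_le by linarith
qed

end

end

theorem theorem6:
  fixes D :: "'i measure" and f :: "'i \<Rightarrow> real^'n \<Rightarrow> real" and F :: "real^'n \<Rightarrow> real"
    and R :: "'r measure" and nc :: "('r, 'n) nc_proc" and cost :: "('r, 'n) nc_cost"
    and x0 :: "real^'n"
    and L \<rho> \<epsilon> \<delta> \<Delta> n0 C K0 \<eta> d :: real and M J T :: nat
  assumes objective: "stochastic_objective D f" and F: "F = mean_obj D f"
    and d: "d = real CARD('n)"
    and pos: "0 < L" "0 < \<rho>" "0 < \<epsilon>" "0 < \<delta>"
    and i: "bdd_below (range F)" "\<Delta> = F x0 - (INF x. F x)"
    and ii: "gradients_lipschitz D f L"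
    and iv: "hessians_lipschitz D f \<rho>"
    and NC: "nc_search R F L C nc cost"
    and M: "M = nat \<lfloor>max (3 * \<rho>\<^sup>2 * \<Delta> / \<delta>^3) (4 * \<Delta> * \<rho> / (\<delta> * \<epsilon>))\<rfloor>"
    and J: "J = 4 * M + 4"
    and T: "0 < T" "real T = \<delta> * L * n0 / (\<rho> * \<epsilon>)"
    and K0: "K0 = (4 * real M + 4) * (L * n0 * \<delta> / (\<rho> * \<epsilon>))"
    and \<eta>: "\<eta> = \<epsilon> / (L * n0)"
  shows
    "(\<forall>(\<sigma>::real) (S1::nat) (S2::nat) (q::nat) (tol_eps::real).
        0 < \<sigma> \<longrightarrow> gradient_noise_bounded D f \<sigma> \<longrightarrow>
        1 \<le> n0 \<longrightarrow> n0 \<le> 2 * \<sigma> / \<epsilon> \<longrightarrow>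
        0 < S1 \<longrightarrow> real S1 = 2 * \<sigma>\<^sup>2 / \<epsilon>\<^sup>2 \<longrightarrow>
        0 < S2 \<longrightarrow> real S2 = 2 * \<sigma> / (\<epsilon> * n0) \<longrightarrow>
        0 < q \<longrightarrow> real q = \<sigma> * n0 / \<epsilon> \<longrightarrow>
        tol_eps = 10 * \<epsilon> * ln (256 * (real M + 1) * (\<delta> * L * n0 / (\<rho> * \<epsilon>)) + 64) \<longrightarrow>
          tol_eps \<le> 1000 * polylog [d, L, \<rho>, \<sigma>, 1 + \<Delta>, \<epsilon>, \<delta>] * \<epsilon> \<and>
          \<P>(\<omega> in sfo_space D R.
             returns_stationary F (3 * tol_eps) (3 * \<delta>) J K0
               (1000 * (1 + C) * polylog [d, L, \<rho>, \<sigma>, 1 + \<Delta>, \<epsilon>, \<delta>] *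
                 (\<Delta> * L * \<sigma> / \<epsilon>^3 + \<Delta> * \<sigma> * L * \<rho> / (\<epsilon>\<^sup>2 * \<delta>\<^sup>2) +
                  \<Delta> * L\<^sup>2 * \<rho>\<^sup>2 / \<delta>^5 + \<Delta> * L\<^sup>2 * \<rho> / (\<epsilon> * \<delta>^3) +
                  \<sigma>\<^sup>2 / \<epsilon>\<^sup>2 + L\<^sup>2 / \<delta>\<^sup>2 + L * \<sigma> * \<delta> / (\<rho> * \<epsilon>\<^sup>2)))
               (spider_sfo_plus
                  \<lparr>anchor = batch_grad f S1, anchor_cost = S1, batch = S2, period = q,
                   round_length = T, last_round = J, step_size = \<eta>, tol = tol_eps,
                   curvature = \<delta>\<rparr>
                  f nc cost x0 \<omega>)) \<ge> 1 / 2)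
     \<and>
     (\<forall>(I::'i set) (n::nat) (S2::nat) (q::nat) (tol_eps::real).
        finite I \<longrightarrow> card I = n \<longrightarrow> 0 < n \<longrightarrow> D = uniform_count_measure I \<longrightarrow>
        1 \<le> n0 \<longrightarrow> n0 \<le> sqrt n \<longrightarrow>
        0 < S2 \<longrightarrow> real S2 = sqrt n / n0 \<longrightarrow>
        0 < q \<longrightarrow> real q = n0 * sqrt n \<longrightarrow>
        tol_eps = 16 * \<epsilon> * ln (256 * (real M + 1) * (\<delta> * L * n0 / (\<rho> * \<epsilon>)) + 64) \<longrightarrow>
          tol_eps \<le> 1000 * polylog [d, real n, L, \<rho>, 1 + \<Delta>, \<epsilon>, \<delta>] * \<epsilon> \<and>
          \<P>(\<omega> in sfo_space D R.
             returns_stationary F (3 * tol_eps) (3 * \<delta>) J K0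
               (1000 * (1 + C) * polylog [d, real n, L, \<rho>, 1 + \<Delta>, \<epsilon>, \<delta>] *
                 (\<Delta> * L * sqrt n / \<epsilon>\<^sup>2 + \<Delta> * \<rho> * L * sqrt n / (\<epsilon> * \<delta>\<^sup>2) +
                  \<Delta> * L\<^sup>2 * \<rho>\<^sup>2 / \<delta>^5 + \<Delta> * L\<^sup>2 * \<rho> / (\<epsilon> * \<delta>^3) +
                  real n + L\<^sup>2 / \<delta>\<^sup>2 + L * sqrt n * \<delta> / (\<rho> * \<epsilon>)))
               (spider_sfo_plus
                  \<lparr>anchor = (\<lambda>_. grad F), anchor_cost = n, batch = S2, period = q,
                   round_length = T, last_round = J, step_size = \<eta>, tol = tol_eps,
                   curvature = \<delta>\<rparr>
                  f nc cost x0 \<omega>)) \<ge> 1 / 2)"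
proof -
  interpret smooth_objective D f L \<rho>
    by unfold_locales (fact objective pos ii iv)+
  have \<eta>_pos: "0 < \<eta>" if "1 \<le> n0" using that pos by (simp add: \<eta>)
  have tol_pos: "0 < c * \<epsilon> * ln (256 * (real M + 1) * (\<delta> * L * n0 / (\<rho> * \<epsilon>)) + 64)" if "0 < c" for c
    unfolding T(2)[symmetric] using that pos less_le_trans[OF zero_less_one ln_ge_one[of "real T" M]] by simp
  show ?thesis (is "?online \<and> ?finite")
  proof
    show ?online
    proof (intro allI impI)
      fix \<sigma> tol_eps :: real and S1 S2 q :: nat
      assume \<sigma>: "0 < \<sigma>" "gradient_noise_bounded D f \<sigma>" and n0: "1 \<le> n0" "n0 \<le> 2 * \<sigma> / \<epsilon>"
        and S1: "0 < S1" "real S1 = 2 * \<sigma>\<^sup>2 / \<epsilon>\<^sup>2" and S2: "0 < S2" "real S2 = 2 * \<sigma> / (\<epsilon> * n0)"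
        and q: "0 < q" "real q = \<sigma> * n0 / \<epsilon>"
        and tol: "tol_eps = 10 * \<epsilon> * ln (256 * (real M + 1) * (\<delta> * L * n0 / (\<rho> * \<epsilon>)) + 64)"
      define P where "P = \<lparr>anchor = batch_grad f S1, anchor_cost = S1, batch = S2, period = q,
        round_length = T, last_round = J, step_size = \<eta>, tol = tol_eps, curvature = \<delta>\<rparr>"
      have P: "anchor P = batch_grad f S1" "anchor_cost P = S1" "batch P = S2" "period P = q"
        "round_length P = T" "last_round P = J" "step_size P = \<eta>" "tol P = tol_eps" "curvature P = \<delta>"
        by (simp_all add: P_def)
      \<comment> \<open>The anchor is itself a batch average; its variance bound in units of \<open>\<epsilon>\<^sup>2\<close> is the exponent \<open>A\<close>.\<close>
      have A: "\<sigma>\<^sup>2 / (real S1 * \<epsilon>\<^sup>2) = 1 / 2"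
        using \<sigma>(1) pos unfolding S1(2) by (simp add: field_simps power2_eq_square)
      interpret run: sfo_parameters D f L \<rho> R nc cost C x0 P \<epsilon> "1 / 2" \<Delta> n0 "2 * \<sigma> / \<epsilon>" 10 M
      proof (unfold_locales, unfold P)
        show "1 / 2 + real q * (4 / (n0 * (2 * \<sigma> / \<epsilon>))) \<le> 4"
          using \<sigma>(1) pos n0 unfolding q(2) by (simp add: field_simps power2_eq_square)
        show "real S1 / real q = 2 * \<sigma> / \<epsilon> / n0"
          using \<sigma>(1) pos n0 unfolding S1(2) q(2) by (simp add: field_simps power2_eq_square)
        show "0 < tol_eps" unfolding tol by (rule tol_pos) simp
      qed (fact NC[unfolded F] T S1(1) S2(1) q(1) \<eta>_pos[OF n0(1)] pos i[unfolded F] M J n0 \<eta>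
          measurable_batch_anchor batch_anchor_moment[OF \<sigma>(2) less_imp_le[OF \<sigma>(1)] S1(1) pos(3), unfolded A]
        | simp add: J S2 T(2) tol)+
      define S where "S = \<bar>ln d\<bar> + (\<bar>ln L\<bar> + (\<bar>ln \<rho>\<bar> + (\<bar>ln \<sigma>\<bar> + (\<bar>ln (1 + \<Delta>)\<bar> + (\<bar>ln \<epsilon>\<bar> + \<bar>ln \<delta>\<bar>)))))"
      have polylog: "polylog [d, L, \<rho>, \<sigma>, 1 + \<Delta>, \<epsilon>, \<delta>] = (1 + S)\<^sup>2"
        by (simp add: polylog_def S_def)
      have S: "\<bar>ln d\<bar> + \<bar>ln L\<bar> + \<bar>ln \<rho>\<bar> + \<bar>ln (curvature P)\<bar> + \<bar>ln \<epsilon>\<bar> + \<bar>ln (1 + \<Delta>)\<bar> \<le> S"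
        by (simp add: S_def P)
      have ln_s: "\<bar>ln (2 * \<sigma> / \<epsilon>)\<bar> \<le> 1 + S"
      proof -
        have "ln (2 * \<sigma> / \<epsilon>) = ln 2 + ln \<sigma> - ln \<epsilon>" using \<sigma> pos by (simp add: ln_div ln_mult)
        moreover have "0 \<le> ln (2::real)" "ln (2::real) \<le> 1" using ln_two_power_le[of 1] by auto
        ultimately show ?thesis unfolding S_def by linarith
      qed
      let ?B = "\<Delta> * L * \<sigma> / \<epsilon>^3 + \<Delta> * \<sigma> * L * \<rho> / (\<epsilon>\<^sup>2 * \<delta>\<^sup>2) +
                  \<Delta> * L\<^sup>2 * \<rho>\<^sup>2 / \<delta>^5 + \<Delta> * L\<^sup>2 * \<rho> / (\<epsilon> * \<delta>^3) +
                  \<sigma>\<^sup>2 / \<epsilon>\<^sup>2 + L\<^sup>2 / \<delta>\<^sup>2 + L * \<sigma> * \<delta> / (\<rho> * \<epsilon>\<^sup>2)"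
      have B: "run.monomials \<le> 5 / 2 * ?B"
      proof -
        have eqs: "\<Delta> * L * (2 * \<sigma> / \<epsilon>) / \<epsilon>\<^sup>2 = 2 * (\<Delta> * L * \<sigma> / \<epsilon>^3)"
          "\<Delta> * \<rho> * L * (2 * \<sigma> / \<epsilon>) / (\<epsilon> * \<delta>\<^sup>2) = 2 * (\<Delta> * \<sigma> * L * \<rho> / (\<epsilon>\<^sup>2 * \<delta>\<^sup>2))"
          "L * (2 * \<sigma> / \<epsilon>) * \<delta> / (\<rho> * \<epsilon>) = 2 * (L * \<sigma> * \<delta> / (\<rho> * \<epsilon>\<^sup>2))"
          "real S1 = 2 * (\<sigma>\<^sup>2 / \<epsilon>\<^sup>2)"
          by (simp_all add: S1 power2_eq_square power3_eq_cube mult_ac)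
        have weights: "2 * x1 + 2 * x2 + x3 + x4 + 2 * x5 + x6 + 2 * x7 \<le> 5 / 2 * (x1 + x2 + x3 + x4 + x5 + x6 + x7)"
          if "0 \<le> x1" "0 \<le> x2" "0 \<le> x3" "0 \<le> x4" "0 \<le> x5" "0 \<le> x6" "0 \<le> x7"
          for x1 x2 x3 x4 x5 x6 x7 :: real
          using that by simp
        show ?thesis
          unfolding run.monomials_def P eqs using pos \<sigma> run.Delta_nonneg by (intro weights) auto
      qed
      show "tol_eps \<le> 1000 * polylog [d, L, \<rho>, \<sigma>, 1 + \<Delta>, \<epsilon>, \<delta>] * \<epsilon> \<and>
          \<P>(\<omega> in sfo_space D R.
             returns_stationary F (3 * tol_eps) (3 * \<delta>) J K0
               (1000 * (1 + C) * polylog [d, L, \<rho>, \<sigma>, 1 + \<Delta>, \<epsilon>, \<delta>] * ?B)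
               (spider_sfo_plus
                  \<lparr>anchor = batch_grad f S1, anchor_cost = S1, batch = S2, period = q,
                   round_length = T, last_round = J, step_size = \<eta>, tol = tol_eps,
                   curvature = \<delta>\<rparr>
                  f nc cost x0 \<omega>)) \<ge> 1 / 2"
        using run.spider_sfo_plus_guarantee[OF d S ln_s B] unfolding polylog P_def[symmetric] P F
        by (simp only: K0)
    qed
    show ?finite
    proof (intro allI impI)
      fix I :: "'i set" and n S2 q :: nat and tol_eps :: real
      assume n: "finite I" "card I = n" "0 < n" "D = uniform_count_measure I"
        and n0: "1 \<le> n0" "n0 \<le> sqrt n" and S2: "0 < S2" "real S2 = sqrt n / n0"
        and q: "0 < q" "real q = n0 * sqrt n"
        and tol: "tol_eps = 16 * \<epsilon> * ln (256 * (real M + 1) * (\<delta> * L * n0 / (\<rho> * \<epsilon>)) + 64)"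
      define P where "P = \<lparr>anchor = (\<lambda>_::nat \<Rightarrow> 'i. grad F), anchor_cost = n, batch = S2, period = q,
        round_length = T, last_round = J, step_size = \<eta>, tol = tol_eps, curvature = \<delta>\<rparr>"
      have P: "anchor P = (\<lambda>_::nat \<Rightarrow> 'i. grad F)" "anchor_cost P = n" "batch P = S2" "period P = q"
        "round_length P = T" "last_round P = J" "step_size P = \<eta>" "tol P = tol_eps" "curvature P = \<delta>"
        by (simp_all add: P_def)
      have meas: "(\<lambda>(\<xi>, x). grad F x) \<in> borel_measurable ((\<Pi>\<^sub>M (_::nat \<times> nat)\<in>UNIV. D) \<Otimes>\<^sub>M borel)"
        unfolding F by measurable
      \<comment> \<open>The anchor is exact, so \<open>A = 0\<close>.\<close>
      have moment: "(\<integral>\<^sup>+\<xi>. ennreal (exp_pot ((grad F x - grad (mean_obj D f) x) /\<^sub>R \<epsilon>))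
          \<partial>(\<Pi>\<^sub>M (_::nat \<times> nat)\<in>UNIV. D)) \<le> ennreal (exp (1 + 0))" for x
      proof -
        interpret \<Xi>: prob_space "\<Pi>\<^sub>M (_::nat \<times> nat)\<in>UNIV. D"
          by (rule prob_space_PiM) (rule D.prob_space_axioms)
        show ?thesis by (simp add: F exp_pot_def \<Xi>.emeasure_space_1)
      qed
      interpret run: sfo_parameters D f L \<rho> R nc cost C x0 P \<epsilon> 0 \<Delta> n0 "sqrt n" 16 M
      proof (unfold_locales, unfold P)
        show "0 + real q * (4 / (n0 * sqrt n)) \<le> 4"
          using n n0 unfolding q(2) by (simp add: field_simps power2_eq_square)
        show "real n / real q = sqrt n / n0"
          using n n0 unfolding q(2) by (simp add: field_simps)
        show "0 < tol_eps" unfolding tol by (rule tol_pos) simp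
      qed (fact NC[unfolded F] T S2 q(1) \<eta>_pos[OF n0(1)] pos i[unfolded F] M J n0 \<eta> meas moment
        | simp add: J T(2) tol)+
      define S where "S = \<bar>ln d\<bar> + (\<bar>ln (real n)\<bar> + (\<bar>ln L\<bar> + (\<bar>ln \<rho>\<bar> + (\<bar>ln (1 + \<Delta>)\<bar> + (\<bar>ln \<epsilon>\<bar> + \<bar>ln \<delta>\<bar>)))))"
      have polylog: "polylog [d, real n, L, \<rho>, 1 + \<Delta>, \<epsilon>, \<delta>] = (1 + S)\<^sup>2"
        by (simp add: polylog_def S_def)
      have S: "\<bar>ln d\<bar> + \<bar>ln L\<bar> + \<bar>ln \<rho>\<bar> + \<bar>ln (curvature P)\<bar> + \<bar>ln \<epsilon>\<bar> + \<bar>ln (1 + \<Delta>)\<bar> \<le> S"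
        by (simp add: S_def P)
      have ln_s: "\<bar>ln (sqrt n)\<bar> \<le> 1 + S"
      proof -
        have "ln (sqrt n) = ln (real n) / 2" using n by (simp add: ln_sqrt)
        thus ?thesis unfolding S_def by linarith
      qed
      have B: "run.monomials \<le> 5 / 2 * run.monomials" using run.monomials_nonneg by simp
      show "tol_eps \<le> 1000 * polylog [d, real n, L, \<rho>, 1 + \<Delta>, \<epsilon>, \<delta>] * \<epsilon> \<and>
          \<P>(\<omega> in sfo_space D R.
             returns_stationary F (3 * tol_eps) (3 * \<delta>) J K0
               (1000 * (1 + C) * polylog [d, real n, L, \<rho>, 1 + \<Delta>, \<epsilon>, \<delta>] *
                 (\<Delta> * L * sqrt n / \<epsilon>\<^sup>2 + \<Delta> * \<rho> * L * sqrt n / (\<epsilon> * \<delta>\<^sup>2) +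
                  \<Delta> * L\<^sup>2 * \<rho>\<^sup>2 / \<delta>^5 + \<Delta> * L\<^sup>2 * \<rho> / (\<epsilon> * \<delta>^3) +
                  real n + L\<^sup>2 / \<delta>\<^sup>2 + L * sqrt n * \<delta> / (\<rho> * \<epsilon>)))
               (spider_sfo_plus
                  \<lparr>anchor = (\<lambda>_. grad F), anchor_cost = n, batch = S2, period = q,
                   round_length = T, last_round = J, step_size = \<eta>, tol = tol_eps,
                   curvature = \<delta>\<rparr>
                  f nc cost x0 \<omega>)) \<ge> 1 / 2"
        using run.spider_sfo_plus_guarantee[OF d S ln_s B]
        unfolding polylog P_def[symmetric] run.monomials_def P by (simp only: K0 F)
    qed
  qed
qed

end
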